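(* Let $G=(V,E)$ be a connected graph with $n$ nodes and $m$ edges, let $\alpha\in(0,1)$ be a constant, and let $(\xi(t))_{t\ge0}$ be the Edge Model on $G$ with parameter $\alpha$ and initial vector $\xi(0)\in\mathbb{R}^n$. Let $\epsilon\in(0,1)$ and let $T=T_\epsilon$ be the first time $t$ such that $\phi(\xi(t))\le\epsilon$. All constants hidden in $O,\Omega,\Theta$ below depend only on $\alpha$. 1. (Convergence time) With high probability, $$T=O\left(\frac{m\log\left(n\|\xi(0)\|_2^2/\epsilon\right)}{\lambda_2(L)}\right).$$ Furthermore, there exists an initial state $\xi(0)$ for which this bound is tight up to constants, i.e. for which $\mathbb{E}(T_\epsilon)=\Omega\left(\frac{m\log\left(n\|\xi(0)\|_2^2/\epsilon\right)}{\lambda_2(L)}\right)$. 2. (Concentration) If $G$ is regular and $\sum_{i}\xi_i(0)=0$, then the limit value $F$ satisfies $$\mathrm{Var}(F)=\Theta\left(\frac{\|\xi(0)\|_2^2}{n^2}\right).$$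
   Context: $G=(V,E)$ is a connected undirected graph with node set $V=\{1,\dots,n\}$, $m$ edges and node degrees $d_i$. Edge Model with parameter $\alpha$: $\xi(0)\in\mathbb{R}^n$ is given. At each step $t\ge1$ a directed edge $(u,v)$ is chosen uniformly at random among all $2m$ directed edges (each undirected edge gives two directed edges), independently over steps; then $\xi_u(t)=\alpha\,\xi_u(t-1)+(1-\alpha)\,\xi_v(t-1)$ and $\xi_{u'}(t)=\xi_{u'}(t-1)$ for all $u'\ne u$. All node values converge to a common (random) value, denoted $F$. $L=D-A$ is the graph Laplacian ($D$ the diagonal degree matrix, $A$ the adjacency matrix), with eigenvalues $0=\lambda_1(L)<\lambda_2(L)\le\dots\le\lambda_n(L)$. Potential: with $\pi_i=d_i/(2m)$, $\phi(\xi)=\sum_u\pi_u\xi_u^2-\left(\sum_u\pi_u\xi_u\right)^2=\frac12\sum_{u,v\in V}\pi_u\pi_v(\xi_u-\xi_v)^2$. $\|x\|_2$ is the Euclidean norm. "With high probability" means with probability at least $1-n^{-c}$ for a constant $c\ge1$. A bound $O(\cdot)$ whose argument is negative (because the logarithm is negative) or undefined (because $\xi(0)=0$) is read as $0$. *)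

theory Defs
  imports
    "HOL-Probability.Probability"
    "Graph_Theory.Graph_Theory"
    "Jordan_Normal_Form.Char_Poly"
begin

text \<open>
  A finite simple undirected graph is a \<^locale>\<open>pair_graph\<close>: a loop-free symmetric digraph whose arc
  set is a set of ordered pairs. Thus \<^term>\<open>parcs G\<close> is exactly the set of the \<open>2m\<close> directed edges.
  Nodes are numbered \<open>0,\<dots>,n-1\<close>, in line with matrix indices. The case \<open>n = 1\<close> is excluded: there
  is then no edge to choose and no second eigenvalue.

  A vector \<open>\<xi> \<in> \<real>\<^sup>n\<close> is a function \<^typ>\<open>nat \<Rightarrow> real\<close> of which only the values on the nodes are
  used; its Euclidean norm is \<^term>\<open>L2_set \<xi> (pverts G)\<close>.
\<close>

type_synonym ugraph = "nat pair_pre_digraph"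

definition connected_graph :: "nat \<Rightarrow> ugraph \<Rightarrow> bool" where
  "connected_graph n G \<longleftrightarrow>
     2 \<le> n \<and> pair_graph G \<and> pverts G = {0..<n} \<and> Digraph_Component.connected (with_proj G)"

definition num_edges :: "ugraph \<Rightarrow> nat" where
  "num_edges G = card (parcs G) div 2"

definition degree_of :: "ugraph \<Rightarrow> nat \<Rightarrow> nat" where
  "degree_of G v = out_degree (with_proj G) v"

definition regular_graph :: "ugraph \<Rightarrow> bool" where
  "regular_graph G \<longleftrightarrow> (\<exists>d. \<forall>v\<in>pverts G. degree_of G v = d)"

definition adjacency_matrix :: "ugraph \<Rightarrow> real mat" where
  "adjacency_matrix G =
     mat (card (pverts G)) (card (pverts G)) (\<lambda>(i, j). if (i, j) \<in> parcs G then 1 else 0)"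

definition degree_matrix :: "ugraph \<Rightarrow> real mat" where
  "degree_matrix G =
     mat (card (pverts G)) (card (pverts G)) (\<lambda>(i, j). if i = j then real (degree_of G i) else 0)"

definition laplacian :: "ugraph \<Rightarrow> real mat" where
  "laplacian G = degree_matrix G - adjacency_matrix G"

text \<open>
  The real eigenvalues of \<open>A\<close> in ascending order, repeated according to algebraic multiplicity.
  For a symmetric matrix these are all its eigenvalues.
\<close>

definition eigenvalue_list :: "real mat \<Rightarrow> real list" where
  "eigenvalue_list A = sorted_list_of_multiset (proots (char_poly A))"

definition lambda2 :: "ugraph \<Rightarrow> real" where
  "lambda2 G = eigenvalue_list (laplacian G) ! 1"

definition node_weight :: "ugraph \<Rightarrow> nat \<Rightarrow> real" where
  "node_weight G v = real (degree_of G v) / (2 * real (num_edges G))"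

definition potential :: "ugraph \<Rightarrow> (nat \<Rightarrow> real) \<Rightarrow> real" where
  "potential G \<xi> = (\<Sum>u\<in>pverts G. node_weight G u * (\<xi> u)\<^sup>2)
                  - (\<Sum>u\<in>pverts G. node_weight G u * \<xi> u)\<^sup>2"

text \<open>
  The sample space is the set of sequences \<open>\<omega>\<close> of directed edges, with independent uniform
  coordinates; \<open>\<omega> t\<close> is the edge used in the step from time \<open>t\<close> to time \<open>t + 1\<close>.
\<close>

definition edge_space :: "ugraph \<Rightarrow> (nat \<Rightarrow> nat \<times> nat) measure" where
  "edge_space G = PiM UNIV (\<lambda>_. measure_pmf (pmf_of_set (parcs G)))"

primrec edge_model ::
    "real \<Rightarrow> (nat \<Rightarrow> real) \<Rightarrow> nat \<Rightarrow> (nat \<Rightarrow> nat \<times> nat) \<Rightarrow> (nat \<Rightarrow> real)" where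
  "edge_model \<alpha> \<xi>0 0 \<omega> = \<xi>0"
| "edge_model \<alpha> \<xi>0 (Suc t) \<omega> =
     (let \<xi> = edge_model \<alpha> \<xi>0 t \<omega>; (u, v) = \<omega> t
      in \<xi>(u := \<alpha> * \<xi> u + (1 - \<alpha>) * \<xi> v))"

text \<open>The infimum is \<open>\<infinity>\<close> if the potential never drops to \<open>\<epsilon>\<close>.\<close>

definition hitting_time ::
    "ugraph \<Rightarrow> real \<Rightarrow> (nat \<Rightarrow> real) \<Rightarrow> real \<Rightarrow> (nat \<Rightarrow> nat \<times> nat) \<Rightarrow> enat" where
  "hitting_time G \<alpha> \<xi>0 \<epsilon> \<omega> = (INF t\<in>{t. potential G (edge_model \<alpha> \<xi>0 t \<omega>) \<le> \<epsilon>}. enat t)"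

text \<open>
  The common limit is read off at node 0; that almost surely all nodes converge to it is part of
  the statement that uses it.
\<close>

definition limit_value :: "real \<Rightarrow> (nat \<Rightarrow> real) \<Rightarrow> (nat \<Rightarrow> nat \<times> nat) \<Rightarrow> real" where
  "limit_value \<alpha> \<xi>0 \<omega> = lim (\<lambda>t. edge_model \<alpha> \<xi>0 t \<omega> 0)"

text \<open>
  \<open>m log(n \<parallel>\<xi>\<parallel>\<^sup>2 / \<epsilon>) / \<lambda>\<^sub>2(L)\<close>, read as 0 where it is undefined or negative.
\<close>

definition time_bound :: "ugraph \<Rightarrow> (nat \<Rightarrow> real) \<Rightarrow> real \<Rightarrow> real" where
  "time_bound G \<xi> \<epsilon> =
     (if L2_set \<xi> (pverts G) = 0 then 0
      else max 0 (real (num_edges G)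
                  * ln (real (card (pverts G)) * (L2_set \<xi> (pverts G))\<^sup>2 / \<epsilon>) / lambda2 G))"

end

theory Submission
  imports Defs
begin

text \<open>
  Write \<open>\<beta> = 1 - \<alpha>\<close> and let \<open>D(\<xi>) = \<xi>\<^sup>T L \<xi>\<close> be the Dirichlet form of the graph. Two one-step identities
  drive all three claims. The directed edges \<open>(u, v)\<close> and \<open>(v, u)\<close> together lower \<open>\<parallel>\<xi>\<parallel>\<^sup>2\<close> by
  \<open>2 \<alpha> \<beta> (\<xi> u - \<xi> v)\<^sup>2\<close>, so its mean decrease in one step is \<open>\<alpha> \<beta> D(\<xi>) / m\<close> (\<open>mean_sqnorm\<close>). A linear
  functional of \<open>\<xi>\<close> follows in the mean the heat flow \<open>I - \<beta> L / 2m\<close> (\<open>mean_lin\<close>); in particular the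
  unweighted average of the node values is a martingale.

  Upper bound on the convergence time. The squared distance of \<open>\<xi>\<close> to the constant vectors is
  \<open>\<parallel>\<xi>\<parallel>\<^sup>2\<close> minus a multiple of the square of that martingale, and \<open>D\<close> is at least \<open>\<lambda>\<^sub>2\<close> times it. Hence it
  contracts in the mean by the factor \<open>1 - \<alpha> \<beta> \<lambda>\<^sub>2 / m\<close>. It bounds the potential, and Markov's
  inequality finishes the argument (\<open>convergence_time_whp\<close>).

  Variance of the limit. The average gains from its noise a mean square increment proportional to
  \<open>D(\<xi>)\<close>, and so is the mean loss of \<open>\<parallel>\<xi>\<parallel>\<^sup>2\<close>. Hence a suitable combination of the square of the
  average and of \<open>\<parallel>\<xi>\<parallel>\<^sup>2\<close> has constant expectation; comparing time 0 with time infinity, where all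
  entries equal \<open>F\<close>, gives the exact value of the variance (\<open>variance_limit_value\<close>).

  Lower bound on the convergence time. Once the potential is below \<open>\<epsilon>\<close>, all node values lie, and stay,
  in an interval of length \<open>2 n \<surd>\<epsilon>\<close>. So it suffices to start at a height \<open>K\<close> that is \<open>\<surd>\<epsilon>\<close> times a power
  of \<open>n\<close>, and to find two nodes that with probability \<open>1/2\<close> still differ by \<open>K\<close> over a power of \<open>n\<close> at
  a time of order \<open>m ln n / \<lambda>\<^sub>2\<close>; for such \<open>K\<close> the logarithm in the bound is of order \<open>ln n\<close>. The mean of
  \<open>\<langle>f, \<xi>\<rangle>\<close> for an eigenvector \<open>f\<close> of \<open>\<lambda>\<^sub>2\<close> decays slowly enough, but fluctuations may hide
  it, and which argument works depends on the shape of \<open>f\<close>. Cut \<open>f\<close> at the levels \<open>\<plusminus> n powr (-1/4)\<close>.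

  If both parts of \<open>f\<close> beyond the levels are small in norm, then \<open>f\<close> correlates with a vector \<open>g\<close> with
  small entries. The variance of \<open>\<langle>g, \<xi>\<rangle>\<close> is at most a constant times the square of the largest
  entry times the total energy loss of \<open>\<xi>\<close>, so Chebyshev's inequality applies to the start \<open>K f\<close>
  (\<open>spread_start_stays_apart\<close>).

  Otherwise one of these parts is a nonnegative vector \<open>g\<close> with support on at most \<open>\<surd>n\<close> nodes and with
  Rayleigh quotient at most \<open>4 \<lambda>\<^sub>2\<close>. Start with \<open>K\<close> on its support and with 0 elsewhere. Values remain
  nonnegative, and the weighted logarithm \<open>\<Sum> g\<^sup>2 ln \<xi>\<close> decreases in one step by at most a constant
  times \<open>D(g) / m\<close> in the mean (\<open>mean_log_energy\<close>). So some value on the support stays large, while the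
  average, being a martingale, stays small (\<open>localised_start_stays_apart\<close>).

  Graphs of bounded size are finite in number and are treated by choosing the constant small enough.
\<close>

section \<open>The Dirichlet form of a connected graph\<close>

lemma sum_square_nonneg_vanish:
  fixes f :: "nat \<Rightarrow> real"
  assumes "(\<Sum>u<n. (f u)\<^sup>2) = 0" "u < n"
  shows "f u = 0"
proof -
  have "(f u)\<^sup>2 = 0"
    using assms sum_nonneg_eq_0_iff[of "{..<n}" "\<lambda>u. (f u)\<^sup>2"] by simp
  then show ?thesis by simp
qed

locale connected_ugraph =
  fixes n :: nat and G :: ugraph
  assumes connected: "connected_graph n G"
begin

abbreviation E :: "(nat \<times> nat) set" where "E \<equiv> parcs G"

abbreviation m :: real where "m \<equiv> real (num_edges G)"

abbreviation deg :: "nat \<Rightarrow> real" where "deg u \<equiv> real (degree_of G u)"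

lemma pair_graph: "pair_graph G"
  using connected by (simp add: connected_graph_def)

lemma two_le_n: "2 \<le> n"
  using connected by (simp add: connected_graph_def)

lemma pverts_eq: "pverts G = {..<n}"
  using connected by (simp add: connected_graph_def atLeast0LessThan)

lemma finite_E [simp]: "finite E"
proof -
  interpret pair_graph G by (rule pair_graph)
  show ?thesis by (rule pair_finite_arcs)
qed

lemma E_sym: "(u, v) \<in> E \<Longrightarrow> (v, u) \<in> E"
proof -
  interpret pair_graph G by (rule pair_graph)
  show "(u, v) \<in> E \<Longrightarrow> (v, u) \<in> E" by (rule arcs_symmetric)
qed

lemma E_lt: "(u, v) \<in> E \<Longrightarrow> u < n \<and> v < n"
proof -
  interpret pair_graph G by (rule pair_graph)
  show "(u, v) \<in> E \<Longrightarrow> u < n \<and> v < n"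
    using in_arcsD1 in_arcsD2 pverts_eq by auto
qed

lemma E_neq: "(u, v) \<in> E \<Longrightarrow> u \<noteq> v"
proof -
  interpret pair_graph G by (rule pair_graph)
  show "(u, v) \<in> E \<Longrightarrow> u \<noteq> v" using pair_no_loops by fastforce
qed

text \<open>
  Connectedness enters the whole proof through this fact.
\<close>

lemma constant_of_edgewise_equal:
  assumes eq: "\<And>u v. (u, v) \<in> E \<Longrightarrow> f u = f v" and "u < n" "v < n"
  shows "f u = f v"
proof -
  interpret pair_graph G by (rule pair_graph)
  have "reachable (with_proj (mk_symmetric (with_proj G))) u v"
    using connected assms(2,3) pverts_eq
    unfolding connected_graph_def Digraph_Component.connected_def strongly_connected_def
    by simp
  then have "(u, v) \<in> rtrancl_on (verts (with_proj (mk_symmetric (with_proj G))))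
               (arcs_ends (with_proj (mk_symmetric (with_proj G))))"
    by (simp add: reachable_def)
  then show ?thesis
  proof (induction rule: rtrancl_on_induct)
    case (step x y)
    have "(x, y) \<in> E \<or> (y, x) \<in> E"
      using step by (auto simp: parcs_mk_symmetric)
    with step.IH eq show ?case by metis
  qed simp
qed

lemma E_nonempty: "E \<noteq> {}"
proof
  assume "E = {}"
  then have "(0::nat) = 1"
    using constant_of_edgewise_equal[of "\<lambda>u. u" 0 1] two_le_n by simp
  then show False by simp
qed

lemma sum_E_swap: "(\<Sum>(u, v)\<in>E. F u v) = (\<Sum>(u, v)\<in>E. F v u)"
  by (rule sum.reindex_bij_witness[of _ prod.swap prod.swap]) (auto intro: E_sym)

lemma card_E: "real (card E) = 2 * m"
proof -
  let ?A = "{(u, v) \<in> E. u < v}"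
  have E: "E = ?A \<union> prod.swap ` ?A"
    using E_sym E_neq by (force simp: image_iff)
  have "card (?A \<union> prod.swap ` ?A) = card ?A + card (prod.swap ` ?A)"
    by (rule card_Un_disjoint) (auto intro: finite_subset[OF _ finite_E])
  then have "card E = 2 * card ?A"
    using E by (simp add: card_image)
  then show ?thesis by (simp add: num_edges_def)
qed

lemma m_pos: "0 < m"
proof -
  have "0 < card E" using E_nonempty by (simp add: card_gt_0_iff)
  then show ?thesis using card_E by simp
qed

lemma neighbours: "{e \<in> E. fst e = u} = Pair u ` {v. (u, v) \<in> E}"
  by auto

lemma finite_neighbours [simp]: "finite {v. (u, v) \<in> E}"
  by (rule finite_subset[of _ "{..<n}"]) (auto dest: E_lt)

lemma deg_eq: "deg u = real (card {v. (u, v) \<in> E})"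
proof -
  have "degree_of G u = card {e \<in> E. fst e = u}"
    by (simp add: degree_of_def out_degree_def out_arcs_def)
  also have "\<dots> = card {v. (u, v) \<in> E}"
    unfolding neighbours by (rule card_image) (simp add: inj_on_def)
  finally show ?thesis by simp
qed

lemma sum_E_eq: "(\<Sum>(u, v)\<in>E. F u v) = (\<Sum>u<n. \<Sum>v | (u, v) \<in> E. F u v)"
proof -
  have "E = (SIGMA u:{..<n}. {v. (u, v) \<in> E})"
    using E_lt by auto
  then have "(\<Sum>(u, v)\<in>E. F u v) = (\<Sum>(u, v)\<in>(SIGMA u:{..<n}. {v. (u, v) \<in> E}). F u v)"
    by simp
  also have "\<dots> = (\<Sum>u<n. \<Sum>v | (u, v) \<in> E. F u v)"
    by (rule sum.Sigma[symmetric]) auto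
  finally show ?thesis .
qed

lemma sum_deg: "(\<Sum>u<n. deg u) = 2 * m"
  using sum_E_eq[of "\<lambda>_ _. 1 :: real"] card_E by (simp add: deg_eq)

definition lap :: "(nat \<Rightarrow> real) \<Rightarrow> nat \<Rightarrow> real" where
  "lap f u = (\<Sum>v | (u, v) \<in> E. f u - f v)"

text \<open>
  The polarised quadratic form \<open>f\<^sup>T L g\<close>; the factor \<open>1/2\<close> accounts for both orientations of an edge.
\<close>

definition dirichlet :: "(nat \<Rightarrow> real) \<Rightarrow> (nat \<Rightarrow> real) \<Rightarrow> real" where
  "dirichlet f g = (\<Sum>(u, v)\<in>E. (f u - f v) * (g u - g v)) / 2"

lemma dirichlet_nonneg: "0 \<le> dirichlet f f"
  unfolding dirichlet_def by (auto intro!: sum_nonneg)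

lemma dirichlet_sym: "dirichlet f g = dirichlet g f"
  unfolding dirichlet_def by (simp add: mult.commute)

lemma dirichlet_lap: "dirichlet f g = (\<Sum>u<n. lap f u * g u)"
proof -
  have "(\<Sum>(u, v)\<in>E. (f u - f v) * g u) = (\<Sum>u<n. lap f u * g u)"
    unfolding sum_E_eq lap_def by (simp add: sum_distrib_right)
  moreover have "(\<Sum>(u, v)\<in>E. (f u - f v) * g v) = - (\<Sum>(u, v)\<in>E. (f u - f v) * g u)"
    by (subst sum_E_swap) (simp add: sum_negf[symmetric] case_prod_unfold algebra_simps)
  moreover have "(\<Sum>(u, v)\<in>E. (f u - f v) * (g u - g v))
      = (\<Sum>(u, v)\<in>E. (f u - f v) * g u) - (\<Sum>(u, v)\<in>E. (f u - f v) * g v)"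
    by (simp add: sum_subtractf[symmetric] case_prod_unfold algebra_simps)
  ultimately show ?thesis unfolding dirichlet_def by simp
qed

lemma dirichlet_add_scaled:
  "dirichlet (\<lambda>u. f u + s * g u) (\<lambda>u. f u + s * g u)
     = dirichlet f f + 2 * s * dirichlet f g + s\<^sup>2 * dirichlet g g"
  unfolding dirichlet_def sum_divide_distrib sum_distrib_left sum.distrib[symmetric]
  by (intro sum.cong) (auto simp: power2_eq_square field_simps)

lemma dirichlet_cong:
  "(\<And>u. u < n \<Longrightarrow> f u = f' u) \<Longrightarrow> (\<And>u. u < n \<Longrightarrow> g u = g' u) \<Longrightarrow> dirichlet f g = dirichlet f' g'"
  unfolding dirichlet_def
  by (intro arg_cong2[of _ _ _ _ "(/)"] sum.cong) (auto dest!: E_lt)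

lemma dirichlet_scale: "dirichlet (\<lambda>u. c * f u) (\<lambda>u. d * g u) = c * d * dirichlet f g"
  unfolding dirichlet_def sum_divide_distrib sum_distrib_left
  by (intro sum.cong) (auto simp: field_simps)

lemma dirichlet_shift: "dirichlet (\<lambda>u. f u - c) (\<lambda>u. g u - d) = dirichlet f g"
  unfolding dirichlet_def by simp

lemma dirichlet_eq_0:
  assumes "dirichlet f f = 0" "u < n" "v < n"
  shows "f u = f v"
proof (rule constant_of_edgewise_equal[OF _ assms(2,3)])
  fix x y assume xy: "(x, y) \<in> E"
  have "(\<Sum>e\<in>E. (f (fst e) - f (snd e))\<^sup>2) = 0"
    using assms(1) by (simp add: dirichlet_def case_prod_unfold power2_eq_square)
  then have "(f x - f y)\<^sup>2 = 0"
    using sum_nonneg_eq_0_iff[of E "\<lambda>e. (f (fst e) - f (snd e))\<^sup>2"] xy by force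
  then show "f x = f y" by simp
qed

end

section \<open>The second smallest eigenvalue of the Laplacian\<close>

lemma linear_coefficient_vanishes:
  fixes a b :: real
  assumes "\<And>s. 0 \<le> 2 * s * a + s\<^sup>2 * b"
  shows "a = 0"
proof (cases "b = 0")
  case True
  then show ?thesis using assms[of "- a"] by (simp add: power2_eq_square)
      (metis mult_eq_0_iff not_square_less_zero order_antisym_conv not_less)
next
  case False
  have "0 \<le> 2 * (- a / b) * a + (- a / b)\<^sup>2 * b" by (rule assms)
  also have "\<dots> = - (a\<^sup>2) / b" using False by (simp add: field_simps power2_eq_square)
  finally have *: "a\<^sup>2 / b \<le> 0" by simp
  have "0 \<le> b" using assms[of 1] assms[of "-1"] by simp
  with False * have "a\<^sup>2 \<le> 0" by (simp add: divide_le_0_iff)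
  then show ?thesis by simp
qed

text \<open>
  The value 0 stands at position 0 because it occurs once and every other entry is at least
  \<open>\<mu> > 0\<close>.
\<close>

lemma sorted_nth_1_of_mset:
  fixes xs :: "real list"
  assumes "sorted xs" "count (mset xs) 0 = 1" "\<mu> \<in> set xs" "0 < \<mu>"
    and "\<And>x. x \<in> set xs \<Longrightarrow> x \<noteq> 0 \<Longrightarrow> \<mu> \<le> x"
  shows "xs ! 1 = \<mu>"
proof -
  have "0 \<in> set xs" using assms(2) by (metis count_greater_zero_iff less_one set_mset_mset)
  then obtain x ys where xs: "xs = x # ys" by (cases xs) auto
  have "x \<le> 0" using \<open>0 \<in> set xs\<close> assms(1) by (auto simp: xs)
  then have x: "x = 0" using assms(5)[of x] assms(4) by (force simp: xs)
  have "0 \<notin> set ys" using assms(2) by (auto simp: xs x count_eq_zero_iff)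
  have "\<mu> \<in> set ys" using assms(3,4) by (auto simp: xs x)
  then obtain y zs where ys: "ys = y # zs" by (cases ys) auto
  have "y \<le> \<mu>" using \<open>\<mu> \<in> set ys\<close> assms(1) by (auto simp: xs ys)
  moreover have "\<mu> \<le> y" using assms(5)[of y] \<open>0 \<notin> set ys\<close> by (auto simp: xs ys)
  ultimately show ?thesis by (simp add: xs ys)
qed

context connected_ugraph
begin

lemma sum_lap: "(\<Sum>u<n. lap f u) = 0"
  using dirichlet_lap[of f "\<lambda>_. 1"] by (simp add: dirichlet_def)

lemma lap_eq: "u < n \<Longrightarrow> lap f u = deg u * f u - (\<Sum>v | (u, v) \<in> E. f v)"
  by (simp add: lap_def sum_subtractf deg_eq)

text \<open>
  Compactness of the unit sphere in the sum-zero hyperplane. Vectors are functions on all of the naturals, so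
  coordinates from \<open>n\<close> on are pinned to 0 and Tychonoff's theorem gives a compact box.
\<close>

lemma rayleigh_minimiser_exists:
  "\<exists>f. (\<Sum>u<n. f u) = 0 \<and> (\<Sum>u<n. (f u)\<^sup>2) = 1 \<and>
    (\<forall>g. (\<Sum>u<n. g u) = 0 \<longrightarrow> (\<Sum>u<n. (g u)\<^sup>2) = 1 \<longrightarrow> dirichlet f f \<le> dirichlet g g)"
proof -
  define B :: "(nat \<Rightarrow> real) set" where "B = PiE UNIV (\<lambda>i. if i < n then {-1..1} else {0})"
  define S where "S = B \<inter> {f. (\<Sum>u<n. f u) = 0} \<inter> {f. (\<Sum>u<n. (f u)\<^sup>2) = 1}"
  have cont: "continuous_on A (\<lambda>f. f i)" for i :: nat and A :: "(nat \<Rightarrow> real) set"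
    by (rule continuous_on_subset[OF continuous_on_product_coordinates]) simp
  have "compactin (product_topology (\<lambda>_. euclidean) UNIV) B"
    unfolding B_def compactin_PiE by (auto simp: compactin_euclidean_iff)
  then have "compact B"
    by (simp add: euclidean_product_topology compactin_euclidean_iff)
  moreover have "closed {f :: nat \<Rightarrow> real. (\<Sum>u<n. f u) = 0}"
    by (intro closed_Collect_eq continuous_intros cont)
  moreover have "closed {f :: nat \<Rightarrow> real. (\<Sum>u<n. (f u)\<^sup>2) = 1}"
    by (intro closed_Collect_eq continuous_intros cont)
  ultimately have "compact S"
    unfolding S_def by (intro compact_Int_closed)
  \<comment> \<open>A unit vector with sum 0, to see that the set is nonempty; this needs two nodes.\<close>
  define e :: "nat \<Rightarrow> real" where "e = (\<lambda>u. if u = 0 then 1 / sqrt 2 else if u = 1 then - 1 / sqrt 2 else 0)"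
  have s2: "1 \<le> sqrt 2" "- 1 \<le> sqrt 2" by (simp_all add: order_trans[of _ 0])
  have n: "{..<n} = insert 0 (insert 1 {2..<n})" using two_le_n by auto
  have "e \<in> S"
    unfolding S_def B_def e_def using two_le_n s2
    by (auto simp: n field_simps power2_eq_square)
  then have "S \<noteq> {}" by auto
  have "continuous_on S (\<lambda>f. dirichlet f f)"
    unfolding dirichlet_def case_prod_unfold by (intro continuous_intros cont) simp_all
  from continuous_attains_inf[OF \<open>compact S\<close> \<open>S \<noteq> {}\<close> this] obtain f
    where f: "f \<in> S" and min: "\<And>g. g \<in> S \<Longrightarrow> dirichlet f f \<le> dirichlet g g" by auto
  have "dirichlet f f \<le> dirichlet g g" if g: "(\<Sum>u<n. g u) = 0" "(\<Sum>u<n. (g u)\<^sup>2) = 1" for g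
  proof -
    define g' where "g' = (\<lambda>u. if u < n then g u else 0)"
    have "\<bar>g u\<bar> \<le> 1" if "u < n" for u
    proof -
      have "(g u)\<^sup>2 \<le> (\<Sum>u<n. (g u)\<^sup>2)" by (rule member_le_sum) (use that in auto)
      then show ?thesis using g by (simp add: abs_square_le_1)
    qed
    then have "g' \<in> S" using g unfolding S_def B_def g'_def by (auto simp: abs_le_iff)
    then have "dirichlet f f \<le> dirichlet g' g'" by (rule min)
    also have "dirichlet g' g' = dirichlet g g" by (rule dirichlet_cong) (simp_all add: g'_def)
    finally show ?thesis .
  qed
  with f show ?thesis unfolding S_def by auto
qed

text \<open>
  A fixed minimiser of the Rayleigh quotient orthogonal to the constants. It is an eigenvector
  (\<open>lap_gap_vector\<close>), and its Rayleigh quotient is \<open>\<lambda>\<^sub>2\<close> (\<open>lambda2_eq_gap\<close>).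
\<close>

definition gap_vector :: "nat \<Rightarrow> real" where
  "gap_vector = (SOME f. (\<Sum>u<n. f u) = 0 \<and> (\<Sum>u<n. (f u)\<^sup>2) = 1 \<and>
    (\<forall>g. (\<Sum>u<n. g u) = 0 \<longrightarrow> (\<Sum>u<n. (g u)\<^sup>2) = 1 \<longrightarrow> dirichlet f f \<le> dirichlet g g))"

definition gap :: real where "gap = dirichlet gap_vector gap_vector"

lemma sum_gap_vector: "(\<Sum>u<n. gap_vector u) = 0"
  and norm_gap_vector: "(\<Sum>u<n. (gap_vector u)\<^sup>2) = 1"
  and gap_le_normalised: "(\<Sum>u<n. g u) = 0 \<Longrightarrow> (\<Sum>u<n. (g u)\<^sup>2) = 1 \<Longrightarrow> gap \<le> dirichlet g g"
  using someI_ex[OF rayleigh_minimiser_exists] unfolding gap_def gap_vector_def by blast+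

lemma gap_nonneg: "0 \<le> gap"
  unfolding gap_def by (rule dirichlet_nonneg)

lemma gap_pos: "0 < gap"
proof (rule ccontr)
  assume "\<not> 0 < gap"
  then have "dirichlet gap_vector gap_vector = 0" using gap_nonneg by (simp add: gap_def)
  then have const: "gap_vector u = gap_vector 0" if "u < n" for u
    using dirichlet_eq_0 that by simp
  have "(\<Sum>u<n. gap_vector u) = (\<Sum>u<n. gap_vector 0)"
    by (rule sum.cong[OF refl]) (use const in blast)
  then have "gap_vector 0 = 0" using two_le_n sum_gap_vector by simp
  then have "gap_vector u = 0" if "u < n" for u using const[OF that] by simp
  then have "(\<Sum>u<n. (gap_vector u)\<^sup>2) = 0" by simp
  then show False using norm_gap_vector by simp
qed

lemma rayleigh_gap:
  assumes "(\<Sum>u<n. g u) = 0"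
  shows "gap * (\<Sum>u<n. (g u)\<^sup>2) \<le> dirichlet g g"
proof (cases "(\<Sum>u<n. (g u)\<^sup>2) = 0")
  case True
  then show ?thesis using dirichlet_nonneg by simp
next
  case False
  define c where "c = (\<Sum>u<n. (g u)\<^sup>2)"
  have "0 \<le> c" unfolding c_def by (rule sum_nonneg) simp
  with False have c: "0 < c" by (simp add: c_def)
  have "gap \<le> dirichlet (\<lambda>u. (1 / sqrt c) * g u) (\<lambda>u. (1 / sqrt c) * g u)"
  proof (rule gap_le_normalised)
    show "(\<Sum>u<n. (1 / sqrt c) * g u) = 0"
      using assms by (simp only: sum_distrib_left[symmetric] mult_zero_right)
    have "(1 / sqrt c)\<^sup>2 = 1 / c" using c by (simp add: power_divide)
    then have "(\<Sum>u<n. ((1 / sqrt c) * g u)\<^sup>2) = (1 / c) * c"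
      unfolding power_mult_distrib sum_distrib_left[symmetric] by (simp only: c_def)
    then show "(\<Sum>u<n. ((1 / sqrt c) * g u)\<^sup>2) = 1" using c by simp
  qed
  also have "\<dots> = dirichlet g g / c" using c unfolding dirichlet_scale by (simp add: field_simps)
  finally show ?thesis using c unfolding c_def[symmetric] by (simp add: pos_le_divide_eq)
qed

text \<open>
  First variation: perturbing the minimiser in the direction of the residual \<open>L f - gap f\<close>, which is
  itself orthogonal to the constants, cannot lower the Rayleigh quotient, so the residual vanishes.
\<close>

lemma lap_gap_vector:
  assumes "u < n"
  shows "lap gap_vector u = gap * gap_vector u"
proof -
  let ?f = gap_vector
  define r where "r = (\<lambda>u. lap ?f u - gap * ?f u)"
  have r0: "(\<Sum>u<n. r u) = 0"
    using sum_lap[of ?f] sum_gap_vector by (simp add: r_def sum_subtractf sum_distrib_left[symmetric])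
  have "dirichlet ?f r - gap * (\<Sum>u<n. ?f u * r u) = 0"
  proof (rule linear_coefficient_vanishes)
    fix s :: real
    have "gap * (\<Sum>u<n. (?f u + s * r u)\<^sup>2) \<le> dirichlet (\<lambda>u. ?f u + s * r u) (\<lambda>u. ?f u + s * r u)"
      by (rule rayleigh_gap) (simp add: sum.distrib sum_gap_vector sum_distrib_left[symmetric] r0)
    moreover have "(\<Sum>u<n. (?f u + s * r u)\<^sup>2)
        = 1 + 2 * s * (\<Sum>u<n. ?f u * r u) + s\<^sup>2 * (\<Sum>u<n. (r u)\<^sup>2)"
      unfolding norm_gap_vector[symmetric] sum_distrib_left sum.distrib[symmetric]
      by (intro sum.cong refl) (simp add: power2_eq_square algebra_simps)
    ultimately show "0 \<le> 2 * s * (dirichlet ?f r - gap * (\<Sum>u<n. ?f u * r u))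
        + s\<^sup>2 * (dirichlet r r - gap * (\<Sum>u<n. (r u)\<^sup>2))"
      unfolding dirichlet_add_scaled gap_def[symmetric] by (simp add: algebra_simps)
  qed
  then have "(\<Sum>u<n. (r u)\<^sup>2) = 0"
    unfolding dirichlet_lap r_def sum_distrib_left sum_subtractf[symmetric]
    by (simp add: power2_eq_square algebra_simps)
  then have "r u = 0" using assms by (rule sum_square_nonneg_vanish)
  then show ?thesis by (simp add: r_def)
qed

lemma laplacian_carrier [simp]: "laplacian G \<in> carrier_mat n n"
  unfolding laplacian_def degree_matrix_def adjacency_matrix_def pverts_eq
  by (intro minus_carrier_mat) simp

lemma laplacian_index:
  "i < n \<Longrightarrow> j < n \<Longrightarrow>
    laplacian G $$ (i, j) = (if i = j then deg i else 0) - (if (i, j) \<in> E then 1 else 0)"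
  by (simp add: laplacian_def degree_matrix_def adjacency_matrix_def pverts_eq)

lemma laplacian_row_sum:
  assumes "i < n"
  shows "(\<Sum>j<n. laplacian G $$ (i, j) * f j) = lap f i"
proof -
  have "(\<Sum>j<n. laplacian G $$ (i, j) * f j)
      = (\<Sum>j<n. (if i = j then deg i * f j else 0)) - (\<Sum>j<n. if (i, j) \<in> E then f j else 0)"
    unfolding sum_subtractf[symmetric] by (rule sum.cong) (auto simp: laplacian_index assms dest: E_neq)
  also have "(\<Sum>j<n. if (i, j) \<in> E then f j else 0) = (\<Sum>j | (i, j) \<in> E. f j)"
    by (rule sum.mono_neutral_cong_right) (auto dest: E_lt)
  finally show ?thesis using assms by (simp add: lap_eq)
qed

lemma laplacian_column_sum: "j < n \<Longrightarrow> (\<Sum>i<n. laplacian G $$ (i, j)) = 0"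
proof -
  assume j: "j < n"
  have "(\<Sum>i<n. laplacian G $$ (i, j)) = (\<Sum>i<n. laplacian G $$ (j, i) * 1)"
    by (rule sum.cong) (auto simp: laplacian_index j dest: E_sym)
  also have "\<dots> = 0" using laplacian_row_sum[OF j, of "\<lambda>_. 1"] by (simp add: lap_def)
  finally show ?thesis .
qed

lemma laplacian_mult_vec:
  "v \<in> carrier_vec n \<Longrightarrow> laplacian G *\<^sub>v v = vec n (lap (($) v))"
  by (rule eq_vecI)
    (auto simp: scalar_prod_def laplacian_row_sum[symmetric] atLeast0LessThan carrier_matD[OF laplacian_carrier])

lemma harmonic_mean_zero:
  assumes "\<And>u. u < n \<Longrightarrow> lap f u = 0" "(\<Sum>u<n. f u) = 0" "u < n"
  shows "f u = 0"
proof -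
  have "dirichlet f f = 0" by (simp add: dirichlet_lap assms(1))
  then have "(\<Sum>v<n. f v) = (\<Sum>v<n. f u)"
    by (intro sum.cong refl) (use dirichlet_eq_0 assms(3) in blast)
  then have "real n * f u = 0" using assms(2) by simp
  then show ?thesis using two_le_n by simp
qed

text \<open>
  The eigenvalue 0 is simple also algebraically. The columns of \<open>L\<close> sum to 0, so adding all
  rows of \<open>x I - L\<close> to the first one turns that row into \<open>x\<close> times the all-ones row; this splits off
  the factor \<open>x\<close>. At \<open>x = 0\<close> the remaining determinant belongs to a system
  that forces a vector to be harmonic with sum 0, hence zero.
\<close>

lemma char_poly_laplacian_factor:
  obtains g where "char_poly (laplacian G) = [:0, 1:] * g" "poly g 0 \<noteq> 0"
proof -
  let ?L = "laplacian G"
  define C where "C = char_poly_matrix ?L"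
  define N where "N = mat n n (\<lambda>(i, j). if i = 0 then 1 else C $$ (i, j))"
  \<comment> \<open>Left multiplication by \<open>R\<close> adds all rows to the first one.\<close>
  define R :: "real poly mat" where "R = mat n n (\<lambda>(i, j). if i = 0 \<or> i = j then 1 else 0)"
  define N0 :: "real mat" where "N0 = mat n n (\<lambda>(i, j). if i = 0 then 1 else - ?L $$ (i, j))"
  have C: "C \<in> carrier_mat n n" by (simp add: C_def)
  have R: "R \<in> carrier_mat n n" by (simp add: R_def)
  have N: "N \<in> carrier_mat n n" by (simp add: N_def)
  have N0: "N0 \<in> carrier_mat n n" by (simp add: N0_def)
  have C_ix: "C $$ (i, j) = (if i = j then [:0, 1:] else 0) - [:?L $$ (i, j):]" if "i < n" "j < n" for i j
    using that carrier_matD[OF laplacian_carrier] by (auto simp: C_def char_poly_matrix_def)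
  have col: "(\<Sum>i<n. C $$ (i, j)) = [:0, 1:]" if j: "j < n" for j
  proof -
    have "(\<Sum>i<n. C $$ (i, j)) = (\<Sum>i<n. if i = j then [:0, 1:] else 0) - (\<Sum>i<n. [:?L $$ (i, j):])"
      unfolding sum_subtractf[symmetric] by (rule sum.cong) (auto simp: C_ix j)
    also have "(\<Sum>i<n. [:?L $$ (i, j):]) = [:\<Sum>i<n. ?L $$ (i, j):]"
      by (induction n) auto
    finally show ?thesis using j by (simp add: laplacian_column_sum)
  qed
  have RC: "R * C = multrow 0 [:0, 1:] N"
  proof (rule eq_matI)
    fix i j assume ij: "i < dim_row (multrow 0 [:0, 1:] N)" "j < dim_col (multrow 0 [:0, 1:] N)"
    then have ij: "i < n" "j < n" using N by auto
    have "(R * C) $$ (i, j) = (\<Sum>k<n. R $$ (i, k) * C $$ (k, j))"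
      using ij R C by (simp add: scalar_prod_def atLeast0LessThan)
    also have "(\<Sum>k<n. R $$ (i, k) * C $$ (k, j)) = (if i = 0 then (\<Sum>k<n. C $$ (k, j)) else (\<Sum>k<n. if i = k then C $$ (k, j) else 0))"
    proof -
      have "R $$ (i, k) * C $$ (k, j) = (if i = 0 then C $$ (k, j) else if i = k then C $$ (k, j) else 0)"
        if "k < n" for k
        using ij that by (simp add: R_def)
      then have "(\<Sum>k<n. R $$ (i, k) * C $$ (k, j))
          = (\<Sum>k<n. if i = 0 then C $$ (k, j) else if i = k then C $$ (k, j) else 0)"
        by (intro sum.cong) simp_all
      then show ?thesis by simp
    qed
    finally show "(R * C) $$ (i, j) = multrow 0 [:0, 1:] N $$ (i, j)"
      using ij N by (auto simp: col N_def)
  qed (use R C N in auto)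
  have "diag_mat R = map (\<lambda>_. 1) [0..<n]" by (auto simp: diag_mat_def R_def)
  then have "det R = 1"
    by (subst det_upper_triangular[OF _ R]) (auto simp: R_def map_replicate_const)
  then have "char_poly ?L = det (R * C)"
    using det_mult[OF R C] by (simp add: char_poly_def C_def)
  also have "\<dots> = [:0, 1:] * det N"
    unfolding RC by (rule det_multrow) (use two_le_n N in auto)
  finally have 1: "char_poly ?L = [:0, 1:] * det N" .
  have "poly (det N) 0 = det N0"
    by (rule poly_det_cong[OF N0 N]) (auto simp: N_def N0_def C_ix)
  moreover have "det N0 \<noteq> 0"
  proof
    assume "det N0 = 0"
    then obtain v where v: "v \<in> carrier_vec n" "v \<noteq> 0\<^sub>v n" "N0 *\<^sub>v v = 0\<^sub>v n"
      using det_0_iff_vec_prod_zero_field[OF N0] by auto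
    have row: "(\<Sum>j<n. N0 $$ (i, j) * v $ j) = 0" if "i < n" for i
    proof -
      have "(N0 *\<^sub>v v) $ i = (\<Sum>j<n. N0 $$ (i, j) * v $ j)"
        using that v(1) N0 by (simp add: scalar_prod_def atLeast0LessThan)
      then show ?thesis using v(3) that by simp
    qed
    have s: "(\<Sum>j<n. v $ j) = 0" using row[of 0] two_le_n by (simp add: N0_def)
    have l: "lap (($) v) i = 0" if "i < n" "i \<noteq> 0" for i
      using row[OF that(1)] laplacian_row_sum[OF that(1), of "($) v"] that
      by (simp add: N0_def sum_negf)
    have "lap (($) v) 0 = (\<Sum>i<n. lap (($) v) i)"
      using l two_le_n by (subst sum.remove[of _ 0]) auto
    then have "lap (($) v) 0 = 0" by (simp add: sum_lap)
    with l have "v $ i = 0" if "i < n" for i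
      using harmonic_mean_zero[of "($) v", OF _ s that] by metis
    then have "v = 0\<^sub>v n" using v(1) by (intro eq_vecI) auto
    with v(2) show False by simp
  qed
  ultimately show ?thesis using that[OF 1] by simp
qed

text \<open>
  An eigenvector for a nonzero eigenvalue is orthogonal to the constants, so the Rayleigh bound applies
  to it.
\<close>

lemma eigenvalue_laplacian_cases:
  assumes "poly (char_poly (laplacian G)) \<kappa> = 0"
  shows "\<kappa> = 0 \<or> gap \<le> \<kappa>"
proof -
  obtain v where v: "v \<in> carrier_vec n" "v \<noteq> 0\<^sub>v n" "laplacian G *\<^sub>v v = \<kappa> \<cdot>\<^sub>v v"
    using assms eigenvalue_root_char_poly[OF laplacian_carrier]
    unfolding eigenvalue_def eigenvector_def by (auto simp: carrier_matD[OF laplacian_carrier])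
  have lap: "lap (($) v) i = \<kappa> * v $ i" if "i < n" for i
    using arg_cong[OF v(3), of "\<lambda>w. w $ i"] v(1) that by (simp add: laplacian_mult_vec)
  define s where "s = (\<Sum>i<n. (v $ i)\<^sup>2)"
  have "s \<noteq> 0"
  proof
    assume "s = 0"
    then have "v $ i = 0" if "i < n" for i
      using sum_square_nonneg_vanish[of "($) v"] that unfolding s_def by blast
    then have "v = 0\<^sub>v n" using v(1) by (intro eq_vecI) auto
    with v(2) show False by simp
  qed
  moreover have "0 \<le> s" unfolding s_def by (rule sum_nonneg) simp
  ultimately have s: "0 < s" by simp
  have "gap \<le> \<kappa>" if "\<kappa> \<noteq> 0"
  proof -
    have "\<kappa> * (\<Sum>i<n. v $ i) = 0"
      using sum_lap[of "($) v"] by (simp add: lap sum_distrib_left)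
    then have "gap * s \<le> dirichlet (($) v) (($) v)"
      unfolding s_def using that by (intro rayleigh_gap) simp
    also have "\<dots> = \<kappa> * s"
      by (simp add: dirichlet_lap lap s_def sum_distrib_left power2_eq_square mult.assoc)
    finally show ?thesis using s by simp
  qed
  then show ?thesis by blast
qed

lemma gap_root: "poly (char_poly (laplacian G)) gap = 0"
proof -
  let ?v = "vec n gap_vector"
  have "lap (vec_index ?v) i = lap gap_vector i" if "i < n" for i
    unfolding lap_def using that by (intro sum.cong) (auto dest: E_lt)
  then have "laplacian G *\<^sub>v ?v = gap \<cdot>\<^sub>v ?v"
    by (subst laplacian_mult_vec) (auto simp: lap_gap_vector intro!: eq_vecI)
  moreover have "?v \<noteq> 0\<^sub>v n"
  proof
    assume *: "?v = 0\<^sub>v n"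
    have "gap_vector i = 0" if "i < n" for i
      using arg_cong[OF *, of "\<lambda>w. w $ i"] that by simp
    then show False using norm_gap_vector by simp
  qed
  ultimately have "eigenvalue (laplacian G) gap"
    unfolding eigenvalue_def eigenvector_def
    by (intro exI[of _ ?v]) (simp add: carrier_matD[OF laplacian_carrier])
  then show ?thesis using eigenvalue_root_char_poly[OF laplacian_carrier] by simp
qed

theorem lambda2_eq_gap: "lambda2 G = gap"
proof -
  let ?p = "char_poly (laplacian G)"
  obtain g where g: "?p = [:0, 1:] * g" "poly g 0 \<noteq> 0" by (rule char_poly_laplacian_factor)
  have p0: "?p \<noteq> 0" using g by auto
  have "order 0 [:0, 1::real:] = 1" using order_power_n_n[of "0::real" 1] by simp
  moreover have "order 0 g = 0" using g(2) by (rule order_0I)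
  ultimately have ord: "order 0 ?p = 1" using p0 unfolding g(1) by (subst order_mult) auto
  show ?thesis
    unfolding lambda2_def eigenvalue_list_def
  proof (rule sorted_nth_1_of_mset)
    show "count (mset (sorted_list_of_multiset (proots ?p))) 0 = 1"
      using ord p0 by simp
    show "gap \<in> set (sorted_list_of_multiset (proots ?p))"
      using gap_root p0 by simp
    show "gap \<le> x" if "x \<in> set (sorted_list_of_multiset (proots ?p))" "x \<noteq> 0" for x
      using eigenvalue_laplacian_cases[of x] that p0 by simp
  qed (simp_all add: gap_pos)
qed

lemma lambda2_pos: "0 < lambda2 G"
  using gap_pos by (simp add: lambda2_eq_gap)

lemma rayleigh_lambda2:
  assumes "(\<Sum>u<n. g u) = 0"
  shows "lambda2 G * (\<Sum>u<n. (g u)\<^sup>2) \<le> dirichlet g g"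
  using rayleigh_gap[OF assms] by (simp add: lambda2_eq_gap)

end

section \<open>Expectations along the process\<close>

definition step :: "real \<Rightarrow> (nat \<Rightarrow> real) \<Rightarrow> nat \<times> nat \<Rightarrow> (nat \<Rightarrow> real)" where
  "step \<alpha> \<xi> e = \<xi>(fst e := \<alpha> * \<xi> (fst e) + (1 - \<alpha>) * \<xi> (snd e))"

lemma edge_model_Suc: "edge_model \<alpha> \<xi> (Suc t) \<omega> = step \<alpha> (edge_model \<alpha> \<xi> t \<omega>) (\<omega> t)"
  by (simp add: step_def Let_def case_prod_unfold)

text \<open>
  Splitting off the first instead of the last edge exhibits the Markov property: what follows the
  first step is the same process with a shifted sequence of edges.
\<close>

lemma edge_model_Suc_shift:
  "edge_model \<alpha> \<xi> (Suc t) \<omega> = edge_model \<alpha> (step \<alpha> \<xi> (\<omega> 0)) t (\<lambda>i. \<omega> (Suc i))"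
proof (induction t)
  case 0
  show ?case unfolding edge_model_Suc by simp
next
  case (Suc t)
  show ?case by (subst edge_model_Suc, subst Suc.IH) (simp only: edge_model_Suc)
qed

declare edge_model.simps(2) [simp del]

locale edge_process = connected_ugraph +
  fixes \<alpha> :: real
  assumes \<alpha>_pos: "0 < \<alpha>" and \<alpha>_less_1: "\<alpha> < 1"
begin

abbreviation \<beta> :: real where "\<beta> \<equiv> 1 - \<alpha>"

lemma \<beta>_pos: "0 < \<beta>"
  using \<alpha>_less_1 by simp

text \<open>
  The transition operator of the Markov chain, acting on functions of the state. Its powers give expectations
  (\<open>integral_edge_model\<close>) and, on indicator functions, probabilities (\<open>prob_edge_model\<close>). Both
  \<open>mean_step (expect t h)\<close> and \<open>expect t (mean_step h)\<close> equal \<open>expect (Suc t) h\<close>, so drift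
  inequalities can be iterated algebraically.
\<close>

definition mean_step :: "((nat \<Rightarrow> real) \<Rightarrow> real) \<Rightarrow> (nat \<Rightarrow> real) \<Rightarrow> real" where
  "mean_step h \<xi> = (\<Sum>e\<in>E. h (step \<alpha> \<xi> e)) / (2 * m)"

abbreviation expect :: "nat \<Rightarrow> ((nat \<Rightarrow> real) \<Rightarrow> real) \<Rightarrow> (nat \<Rightarrow> real) \<Rightarrow> real" where
  "expect t \<equiv> mean_step ^^ t"

lemma mean_step_cong:
  "(\<And>e. e \<in> E \<Longrightarrow> h (step \<alpha> \<xi> e) = k (step \<alpha> \<xi> e)) \<Longrightarrow> mean_step h \<xi> = mean_step k \<xi>"
  unfolding mean_step_def by (metis (no_types, lifting) sum.cong)

lemma mean_step_linear: "mean_step (\<lambda>\<xi>. a * h \<xi> + b * k \<xi>) \<xi> = a * mean_step h \<xi> + b * mean_step k \<xi>"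
  by (simp add: mean_step_def sum.distrib sum_distrib_left add_divide_distrib)

lemma expect_Suc: "expect (Suc t) h \<xi> = (\<Sum>e\<in>E. expect t h (step \<alpha> \<xi> e)) / (2 * m)"
  by (simp add: mean_step_def)

lemma expect_Suc': "expect (Suc t) h \<xi> = expect t (mean_step h) \<xi>"
  by (simp add: funpow_swap1)

lemma expect_linear: "expect t (\<lambda>\<xi>. a * h \<xi> + b * k \<xi>) \<xi> = a * expect t h \<xi> + b * expect t k \<xi>"
proof (induction t arbitrary: \<xi>)
  case (Suc t)
  show ?case unfolding expect_Suc Suc.IH
    by (simp add: sum.distrib sum_distrib_left add_divide_distrib)
qed simp

lemma expect_const [simp]: "expect t (\<lambda>_. c) \<xi> = c"
proof (induction t arbitrary: \<xi>)
  case (Suc t)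
  show ?case unfolding expect_Suc Suc.IH using m_pos by (simp add: card_E)
qed simp

lemma expect_mono_on:
  assumes step: "\<And>\<xi> e. \<xi> \<in> I \<Longrightarrow> e \<in> E \<Longrightarrow> step \<alpha> \<xi> e \<in> I"
    and le: "\<And>\<xi>. \<xi> \<in> I \<Longrightarrow> h \<xi> \<le> k \<xi>" and "\<xi> \<in> I"
  shows "expect t h \<xi> \<le> expect t k \<xi>"
  using assms(3)
proof (induction t arbitrary: \<xi>)
  case 0
  then show ?case by (simp add: le)
next
  case (Suc t)
  show ?case unfolding expect_Suc
    by (intro divide_right_mono sum_mono Suc.IH step Suc.prems) (use m_pos in auto)
qed

lemma expect_mono:
  assumes "\<And>\<xi>. h \<xi> \<le> k \<xi>"
  shows "expect t h \<xi> \<le> expect t k \<xi>"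
  by (rule expect_mono_on[of UNIV]) (simp_all add: assms)

primrec law :: "nat \<Rightarrow> (nat \<Rightarrow> real) \<Rightarrow> (nat \<Rightarrow> real) pmf" where
  "law 0 \<xi> = return_pmf \<xi>"
| "law (Suc t) \<xi> = bind_pmf (pmf_of_set E) (\<lambda>e. law t (step \<alpha> \<xi> e))"

lemma finite_set_law [simp]: "finite (set_pmf (law t \<xi>))"
  by (induction t arbitrary: \<xi>) (simp_all add: set_pmf_of_set E_nonempty)

lemma expectation_law: "measure_pmf.expectation (law t \<xi>) h = expect t h \<xi>"
proof (induction t arbitrary: \<xi>)
  case (Suc t)
  have "measure_pmf.expectation (law (Suc t) \<xi>) h
      = (\<Sum>e\<in>E. measure_pmf.expectation (law t (step \<alpha> \<xi> e)) h /\<^sub>R real (card E))"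
    unfolding law.simps using E_nonempty by (intro pmf_expectation_bind_pmf_of_set) simp_all
  then show ?case
    unfolding Suc.IH expect_Suc card_E
    by (simp only: real_scaleR_def sum_distrib_left divide_inverse_commute)
qed simp

abbreviation \<Omega> :: "(nat \<Rightarrow> nat \<times> nat) measure" where "\<Omega> \<equiv> edge_space G"

lemma prob_space_\<Omega>: "prob_space \<Omega>"
  unfolding edge_space_def by (rule prob_space_PiM) (rule prob_space_measure_pmf)

lemma space_\<Omega> [simp]: "space \<Omega> = UNIV"
  by (simp add: edge_space_def space_PiM)

lemma coordinate_measurable [measurable]: "(\<lambda>\<omega>. \<omega> i) \<in> measurable \<Omega> (count_space UNIV)"
proof -
  have "(\<lambda>\<omega>. \<omega> i) \<in> measurable \<Omega> (measure_pmf (pmf_of_set E))"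
    unfolding edge_space_def by (rule measurable_component_singleton) simp
  then show ?thesis by (simp cong: measurable_cong_sets)
qed

lemma shift_measurable: "(\<lambda>\<omega> i. \<omega> (Suc i)) \<in> measurable \<Omega> \<Omega>"
proof -
  have "(\<lambda>\<omega>. \<lambda>i\<in>UNIV. \<omega> (Suc i)) \<in> measurable \<Omega> \<Omega>"
    unfolding edge_space_def
    by (rule measurable_restrict) (rule measurable_component_singleton, simp)
  then show ?thesis by (simp add: restrict_def)
qed

text \<open>
  Every function of the state at time \<open>t\<close> is measurable because the state depends on finitely many
  coordinates with countably many values; hence the discrete sigma-algebra on the states.
\<close>

lemma edge_model_measurable:
  "edge_model \<alpha> \<xi> t \<in> measurable \<Omega> (count_space UNIV)"
proof (induction t arbitrary: \<xi>)
  case 0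
  have "edge_model \<alpha> \<xi> 0 = (\<lambda>_. \<xi>)" by auto
  then show ?case by simp
next
  case (Suc t)
  have "(\<lambda>\<omega>. edge_model \<alpha> (step \<alpha> \<xi> (\<omega> 0)) t (\<lambda>i. \<omega> (Suc i))) \<in> measurable \<Omega> (count_space UNIV)"
  proof (rule measurable_compose_countable[where g = "\<lambda>\<omega>. \<omega> 0"
        and f = "\<lambda>e \<omega>. edge_model \<alpha> (step \<alpha> \<xi> e) t (\<lambda>i. \<omega> (Suc i))"])
    show "(\<lambda>\<omega>. edge_model \<alpha> (step \<alpha> \<xi> e) t (\<lambda>i. \<omega> (Suc i))) \<in> measurable \<Omega> (count_space UNIV)" for e
      by (rule measurable_compose[OF shift_measurable Suc.IH])
  qed (rule coordinate_measurable)
  then show ?case by (simp add: edge_model_Suc_shift[abs_def])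
qed

lemma edge_model_fun_measurable [measurable]:
  "(\<lambda>\<omega>. h (edge_model \<alpha> \<xi> t \<omega>)) \<in> borel_measurable \<Omega>" for h :: "(nat \<Rightarrow> real) \<Rightarrow> real"
  by (rule measurable_compose[OF edge_model_measurable]) simp

lemma emeasure_distr_edge_model:
  "emeasure (distr \<Omega> (count_space UNIV) (edge_model \<alpha> \<xi> t)) A
    = (\<integral>\<^sup>+ \<omega>. indicator A (edge_model \<alpha> \<xi> t \<omega>) \<partial>\<Omega>)"
proof -
  have "(\<integral>\<^sup>+ x. indicator A x \<partial>distr \<Omega> (count_space UNIV) (edge_model \<alpha> \<xi> t))
      = (\<integral>\<^sup>+ \<omega>. indicator A (edge_model \<alpha> \<xi> t \<omega>) \<partial>\<Omega>)"
    by (rule nn_integral_distr[OF edge_model_measurable]) simp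
  then show ?thesis by simp
qed

text \<open>
  The sequence space is invariant under prepending an independent first coordinate; by Fubini's theorem
  the law of the process satisfies the recursion that defines \<open>law\<close>.
\<close>

lemma distr_edge_model:
  "distr \<Omega> (count_space UNIV) (edge_model \<alpha> \<xi> t) = measure_pmf (law t \<xi>)"
proof (induction t arbitrary: \<xi>)
  case 0
  interpret prob_space \<Omega> by (rule prob_space_\<Omega>)
  have "edge_model \<alpha> \<xi> 0 = (\<lambda>_. \<xi>)" by auto
  then show ?case
    by (intro measure_eqI) (auto simp: emeasure_distr emeasure_space_1 indicator_def
        simp flip: space_\<Omega> split: if_splits)
next
  case (Suc t)
  let ?M = "measure_pmf (pmf_of_set E)"
  interpret sequence_space ?M by unfold_locales
  interpret S: prob_space \<Omega> by (rule prob_space_\<Omega>)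
  have \<Omega>: "\<Omega> = distr (?M \<Otimes>\<^sub>M \<Omega>) \<Omega> (\<lambda>(s, \<omega>). case_nat s \<omega>)"
    using PiM_iter by (simp add: edge_space_def)
  have cons: "(\<lambda>(s, \<omega>). case_nat s \<omega>) \<in> measurable (?M \<Otimes>\<^sub>M \<Omega>) \<Omega>"
    unfolding edge_space_def by measurable
  show ?case
  proof (rule measure_eqI)
    fix A :: "(nat \<Rightarrow> real) set"
    have 1: "(\<lambda>\<omega>. indicator A (edge_model \<alpha> \<xi>' t' \<omega>) :: ennreal) \<in> borel_measurable \<Omega>" for \<xi>' t'
      by (rule measurable_compose[OF edge_model_measurable]) simp
    have 2: "emeasure (law t \<xi>') A = (\<integral>\<^sup>+ \<omega>. indicator A (edge_model \<alpha> \<xi>' t \<omega>) \<partial>\<Omega>)" for \<xi>'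
      unfolding Suc.IH[symmetric] by (rule emeasure_distr_edge_model)
    have "emeasure (distr \<Omega> (count_space UNIV) (edge_model \<alpha> \<xi> (Suc t))) A
        = (\<integral>\<^sup>+ \<omega>. indicator A (edge_model \<alpha> \<xi> (Suc t) \<omega>) \<partial>\<Omega>)"
      by (rule emeasure_distr_edge_model)
    also have "\<dots> = (\<integral>\<^sup>+ x. indicator A (edge_model \<alpha> \<xi> (Suc t) (case x of (s, \<omega>) \<Rightarrow> case_nat s \<omega>)) \<partial>(?M \<Otimes>\<^sub>M \<Omega>))"
      by (subst \<Omega>, subst nn_integral_distr[OF cons]) (simp_all add: 1)
    also have "\<dots> = (\<integral>\<^sup>+ s. \<integral>\<^sup>+ \<omega>. indicator A (edge_model \<alpha> \<xi> (Suc t) (case_nat s \<omega>)) \<partial>\<Omega> \<partial>?M)"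
      by (subst S.nn_integral_fst[symmetric]) (auto intro!: measurable_compose[OF cons 1])
    also have "\<dots> = (\<integral>\<^sup>+ s. emeasure (law t (step \<alpha> \<xi> s)) A \<partial>?M)"
      unfolding edge_model_Suc_shift by (simp add: 2)
    also have "\<dots> = emeasure (law (Suc t) \<xi>) A"
      by (simp add: emeasure_bind_pmf)
    finally show "emeasure (distr \<Omega> (count_space UNIV) (edge_model \<alpha> \<xi> (Suc t))) A
        = emeasure (law (Suc t) \<xi>) A" .
  qed simp
qed

lemma integral_edge_model: "(\<integral>\<omega>. h (edge_model \<alpha> \<xi> t \<omega>) \<partial>\<Omega>) = expect t h \<xi>"
  for h :: "(nat \<Rightarrow> real) \<Rightarrow> real"
proof -
  have "(\<integral>\<omega>. h (edge_model \<alpha> \<xi> t \<omega>) \<partial>\<Omega>) = (\<integral>x. h x \<partial>distr \<Omega> (count_space UNIV) (edge_model \<alpha> \<xi> t))"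
    by (rule integral_distr[symmetric, OF edge_model_measurable]) simp
  then show ?thesis by (simp add: distr_edge_model expectation_law)
qed

lemma integrable_edge_model: "integrable \<Omega> (\<lambda>\<omega>. h (edge_model \<alpha> \<xi> t \<omega>))"
  for h :: "(nat \<Rightarrow> real) \<Rightarrow> real"
proof -
  have "integrable (distr \<Omega> (count_space UNIV) (edge_model \<alpha> \<xi> t)) h"
    unfolding distr_edge_model by (rule integrable_measure_pmf_finite) simp
  then show ?thesis by (subst (asm) integrable_distr_eq[OF edge_model_measurable]) simp_all
qed

lemma prob_edge_model:
  "measure \<Omega> {\<omega>. edge_model \<alpha> \<xi> t \<omega> \<in> A} = expect t (indicator A) \<xi>"
proof -
  have "{\<omega> \<in> space \<Omega>. edge_model \<alpha> \<xi> t \<omega> \<in> A} \<in> sets \<Omega>"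
    using measurable_sets[OF edge_model_measurable, of A \<xi> t] by (simp add: vimage_def)
  then have "measure \<Omega> {\<omega>. edge_model \<alpha> \<xi> t \<omega> \<in> A} = (\<integral>\<omega>. indicator {\<omega>. edge_model \<alpha> \<xi> t \<omega> \<in> A} \<omega> \<partial>\<Omega>)"
    by simp
  also have "\<dots> = (\<integral>\<omega>. indicator A (edge_model \<alpha> \<xi> t \<omega>) \<partial>\<Omega>)"
    by (rule Bochner_Integration.integral_cong) (auto simp: indicator_def)
  finally show ?thesis by (simp add: integral_edge_model)
qed

lemma edge_model_event_measurable [measurable]:
  "{\<omega>. P (edge_model \<alpha> \<xi> t \<omega>)} \<in> sets \<Omega>"
  using measurable_sets[OF edge_model_measurable, of "{x. P x}" \<xi> t] by (simp add: vimage_def)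

lemma AE_edges: "AE \<omega> in \<Omega>. \<forall>t. \<omega> t \<in> E"
proof -
  have "AE \<omega> in \<Omega>. \<omega> t \<in> E" for t
    unfolding edge_space_def
    by (rule AE_PiM_component) (auto simp: prob_space_measure_pmf AE_measure_pmf_iff set_pmf_of_set E_nonempty)
  then show ?thesis by (simp add: AE_all_countable)
qed

text \<open>A node value is only ever replaced by a convex combination of node values.\<close>

lemma step_between:
  assumes "e \<in> E" "\<And>u. u < n \<Longrightarrow> a \<le> \<xi> u \<and> \<xi> u \<le> b" "u < n"
  shows "a \<le> step \<alpha> \<xi> e u \<and> step \<alpha> \<xi> e u \<le> b"
proof -
  obtain x y where e: "e = (x, y)" by (cases e)
  have xy: "x < n" "y < n" using E_lt assms(1) e by auto
  have "\<alpha> * a + \<beta> * a \<le> \<alpha> * \<xi> x + \<beta> * \<xi> y"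
    using \<alpha>_pos \<beta>_pos assms(2)[OF xy(1)] assms(2)[OF xy(2)] by (intro add_mono mult_left_mono) auto
  moreover have "\<alpha> * \<xi> x + \<beta> * \<xi> y \<le> \<alpha> * b + \<beta> * b"
    using \<alpha>_pos \<beta>_pos assms(2)[OF xy(1)] assms(2)[OF xy(2)] by (intro add_mono mult_left_mono) auto
  ultimately show ?thesis
    using assms(2)[OF assms(3)] by (auto simp: step_def e algebra_simps)
qed

lemma edge_model_between:
  assumes "\<And>t. \<omega> t \<in> E" "\<And>u. u < n \<Longrightarrow> a \<le> edge_model \<alpha> \<xi> s \<omega> u \<and> edge_model \<alpha> \<xi> s \<omega> u \<le> b"
    and "s \<le> t" "u < n"
  shows "a \<le> edge_model \<alpha> \<xi> t \<omega> u \<and> edge_model \<alpha> \<xi> t \<omega> u \<le> b"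
  using assms(3,4)
proof (induction t arbitrary: u rule: dec_induct)
  case base
  then show ?case by (rule assms(2))
next
  case (step t)
  show ?case unfolding edge_model_Suc
    by (rule step_between[OF assms(1) step.IH step.prems])
qed

end

section \<open>Mean drift and the upper bound on the convergence time\<close>

text \<open>
  The infimum over a nonempty set of times is attained.
\<close>

lemma hitting_time_le_iff:
  "hitting_time G \<alpha> \<xi> \<epsilon> \<omega> \<le> enat k \<longleftrightarrow> (\<exists>t\<le>k. potential G (edge_model \<alpha> \<xi> t \<omega>) \<le> \<epsilon>)"
proof
  let ?A = "enat ` {t. potential G (edge_model \<alpha> \<xi> t \<omega>) \<le> \<epsilon>}"
  assume *: "hitting_time G \<alpha> \<xi> \<epsilon> \<omega> \<le> enat k"
  have "?A \<noteq> {}"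
  proof
    assume "?A = {}"
    then have "hitting_time G \<alpha> \<xi> \<epsilon> \<omega> = \<infinity>" unfolding hitting_time_def by (simp add: Inf_enat_def)
    with * show False by simp
  qed
  then have "Inf ?A \<in> ?A" unfolding Inf_enat_def by (auto intro: LeastI)
  with * show "\<exists>t\<le>k. potential G (edge_model \<alpha> \<xi> t \<omega>) \<le> \<epsilon>"
    unfolding hitting_time_def by auto
next
  assume "\<exists>t\<le>k. potential G (edge_model \<alpha> \<xi> t \<omega>) \<le> \<epsilon>"
  then obtain t where t: "t \<le> k" "potential G (edge_model \<alpha> \<xi> t \<omega>) \<le> \<epsilon>" by blast
  have "hitting_time G \<alpha> \<xi> \<epsilon> \<omega> \<le> enat t"
    unfolding hitting_time_def by (rule INF_lower) (use t in simp)
  also have "\<dots> \<le> enat k" using t by simp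
  finally show "hitting_time G \<alpha> \<xi> \<epsilon> \<omega> \<le> enat k" .
qed

lemma ennreal_of_enat_le_iff_floor:
  assumes "0 \<le> x"
  shows "ennreal_of_enat T \<le> ennreal x \<longleftrightarrow> T \<le> enat (nat \<lfloor>x\<rfloor>)"
proof (cases T)
  case (enat k)
  have "ennreal_of_enat T \<le> ennreal x \<longleftrightarrow> real k \<le> x"
    using assms by (simp add: enat ennreal_of_nat_eq_real_of_nat)
  also have "\<dots> \<longleftrightarrow> k \<le> nat \<lfloor>x\<rfloor>" using assms by (simp add: le_nat_iff le_floor_iff)
  finally show ?thesis by (simp add: enat)
next
  case infinity
  then show ?thesis by (simp add: top_unique)
qed

context connected_ugraph
begin

definition lin :: "(nat \<Rightarrow> real) \<Rightarrow> (nat \<Rightarrow> real) \<Rightarrow> real" where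
  "lin g \<xi> = (\<Sum>u<n. g u * \<xi> u)"

definition sqnorm :: "(nat \<Rightarrow> real) \<Rightarrow> real" where
  "sqnorm \<xi> = (\<Sum>u<n. (\<xi> u)\<^sup>2)"

text \<open>
  The squared Euclidean distance to the constant vectors, see \<open>spread_eq\<close>.
\<close>

definition spread :: "(nat \<Rightarrow> real) \<Rightarrow> real" where
  "spread \<xi> = sqnorm \<xi> - (lin (\<lambda>_. 1) \<xi>)\<^sup>2 / n"

lemma sqnorm_nonneg: "0 \<le> sqnorm \<xi>"
  unfolding sqnorm_def by (rule sum_nonneg) simp

lemma sqnorm_eq_L2: "(L2_set \<xi> {..<n})\<^sup>2 = sqnorm \<xi>"
  by (simp add: sqnorm_def L2_set_def sum_nonneg)

lemma time_bound_eq: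
  assumes "0 < sqnorm \<xi>" "1 \<le> n * sqnorm \<xi> / \<epsilon>"
  shows "time_bound G \<xi> \<epsilon> = m * ln (n * sqnorm \<xi> / \<epsilon>) / lambda2 G"
proof -
  have "L2_set \<xi> {..<n} \<noteq> 0" using assms(1) sqnorm_eq_L2[of \<xi>] by auto
  moreover have "0 \<le> m * ln (n * sqnorm \<xi> / \<epsilon>) / lambda2 G"
    using assms(2) lambda2_pos by (intro divide_nonneg_pos mult_nonneg_nonneg) simp_all
  ultimately show ?thesis by (simp add: time_bound_def pverts_eq sqnorm_eq_L2)
qed

lemma n_pos: "0 < real n"
  using two_le_n by simp

lemma spread_eq: "spread \<xi> = (\<Sum>u<n. (\<xi> u - lin (\<lambda>_. 1) \<xi> / n)\<^sup>2)"
proof -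
  let ?c = "lin (\<lambda>_. 1) \<xi> / n"
  have "(\<Sum>u<n. (\<xi> u - ?c)\<^sup>2) = (\<Sum>u<n. (\<xi> u)\<^sup>2 - 2 * ?c * \<xi> u + ?c\<^sup>2)"
    by (rule sum.cong) (simp_all add: power2_eq_square algebra_simps)
  also have "\<dots> = sqnorm \<xi> - 2 * ?c * lin (\<lambda>_. 1) \<xi> + n * ?c\<^sup>2"
    by (simp add: sum.distrib sum_subtractf sum_distrib_left sqnorm_def lin_def)
  also have "\<dots> = spread \<xi>"
    using n_pos by (simp add: spread_def field_simps power2_eq_square)
  finally show ?thesis by simp
qed

lemma spread_nonneg: "0 \<le> spread \<xi>"
  unfolding spread_eq by (rule sum_nonneg) simp

lemma spread_le_sqnorm: "spread \<xi> \<le> sqnorm \<xi>"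
  unfolding spread_def by simp

lemma sum_deviation: "(\<Sum>u<n. \<xi> u - lin (\<lambda>_. 1) \<xi> / n) = 0"
  using n_pos by (simp add: sum_subtractf lin_def)

lemma rayleigh_spread: "lambda2 G * spread \<xi> \<le> dirichlet \<xi> \<xi>"
  unfolding spread_eq
  using rayleigh_lambda2[OF sum_deviation] by (simp add: dirichlet_shift)

lemma deviation_le_spread: "u < n \<Longrightarrow> (\<xi> u - lin (\<lambda>_. 1) \<xi> / n)\<^sup>2 \<le> spread \<xi>"
  unfolding spread_eq by (rule member_le_sum) auto

text \<open>
  Testing the Rayleigh quotient with the indicator of a node gives \<open>\<lambda>\<^sub>2 \<le> 2 deg v\<close>, using \<open>n \<ge> 2\<close>;
  sum over the nodes.
\<close>

lemma lambda2_le: "n * lambda2 G \<le> 4 * m"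
proof -
  have half: "lambda2 G / 2 \<le> deg v" if v: "v < n" for v
  proof -
    define e :: "nat \<Rightarrow> real" where "e = (\<lambda>u. if u = v then 1 else 0)"
    have "lap e v = (\<Sum>w | (v, w) \<in> E. 1)"
      unfolding lap_def by (rule sum.cong) (auto simp: e_def dest: E_neq)
    moreover have "dirichlet e e = lap e v"
      using v by (simp add: dirichlet_lap e_def if_distrib[of "\<lambda>x. _ * x"] cong: if_cong)
    ultimately have "dirichlet e e = deg v" by (simp add: deg_eq)
    moreover have "sqnorm e = 1"
      using v by (simp add: sqnorm_def e_def if_distrib[of "\<lambda>x. x\<^sup>2"] cong: if_cong)
    moreover have "lin (\<lambda>_. 1) e = 1" using v by (simp add: lin_def e_def)
    ultimately have "lambda2 G * (1 - 1 / n) \<le> deg v"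
      using rayleigh_spread[of e] by (simp add: spread_def)
    moreover have "lambda2 G * (1 / 2) \<le> lambda2 G * (1 - 1 / n)"
      using two_le_n lambda2_pos by (intro mult_left_mono) (auto simp: field_simps)
    ultimately have "lambda2 G * (1 / 2) \<le> deg v" by (rule order_trans[rotated])
    then show ?thesis by simp
  qed
  have "(\<Sum>v<n. lambda2 G / 2) \<le> (\<Sum>v<n. deg v)" by (rule sum_mono) (use half in simp)
  then show ?thesis by (simp add: sum_deg)
qed

lemma lambda2_le_2m: "lambda2 G \<le> 2 * m"
proof -
  have "2 * lambda2 G \<le> n * lambda2 G"
    using two_le_n lambda2_pos by (intro mult_right_mono) auto
  then show ?thesis using lambda2_le by simp
qed

lemma deg_le: "u < n \<Longrightarrow> deg u \<le> 2 * m"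
  unfolding sum_deg[symmetric] by (rule member_le_sum) auto

lemma node_weight_eq: "node_weight G u = deg u / (2 * m)"
  by (simp add: node_weight_def)

lemma sum_node_weight: "(\<Sum>u<n. node_weight G u) = 1"
  using m_pos by (simp add: node_weight_eq sum_divide_distrib[symmetric] sum_deg)

lemma potential_shift:
  "potential G \<xi> = (\<Sum>u<n. node_weight G u * (\<xi> u - c)\<^sup>2) - (\<Sum>u<n. node_weight G u * (\<xi> u - c))\<^sup>2"
proof -
  let ?w = "node_weight G"
  have "(\<Sum>u<n. ?w u * (\<xi> u - c)\<^sup>2) = (\<Sum>u<n. ?w u * (\<xi> u)\<^sup>2 - 2 * c * (?w u * \<xi> u) + c\<^sup>2 * ?w u)"
    by (rule sum.cong) (simp_all add: power2_eq_square algebra_simps)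
  also have "\<dots> = (\<Sum>u<n. ?w u * (\<xi> u)\<^sup>2) - 2 * c * (\<Sum>u<n. ?w u * \<xi> u) + c\<^sup>2"
    by (simp add: sum.distrib sum_subtractf sum_distrib_left[symmetric] sum_node_weight)
  finally have 1: "(\<Sum>u<n. ?w u * (\<xi> u - c)\<^sup>2)
      = (\<Sum>u<n. ?w u * (\<xi> u)\<^sup>2) - 2 * c * (\<Sum>u<n. ?w u * \<xi> u) + c\<^sup>2" .
  have "(\<Sum>u<n. ?w u * (\<xi> u - c)) = (\<Sum>u<n. ?w u * \<xi> u - c * ?w u)"
    by (rule sum.cong) (simp_all add: algebra_simps)
  then have 2: "(\<Sum>u<n. ?w u * (\<xi> u - c)) = (\<Sum>u<n. ?w u * \<xi> u) - c"
    by (simp add: sum_subtractf sum_distrib_left[symmetric] sum_node_weight)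
  show ?thesis unfolding potential_def pverts_eq 1 2 by (simp add: power2_eq_square algebra_simps)
qed

text \<open>
  The potential is a variance with respect to the node weights, hence at most the weighted second
  moment about the plain average; every weight is at most 1.
\<close>

lemma potential_le_spread: "potential G \<xi> \<le> spread \<xi>"
proof -
  let ?c = "lin (\<lambda>_. 1) \<xi> / n"
  have "potential G \<xi> \<le> (\<Sum>u<n. node_weight G u * (\<xi> u - ?c)\<^sup>2)"
    unfolding potential_shift[of \<xi> ?c] by simp
  also have "\<dots> \<le> (\<Sum>u<n. 1 * (\<xi> u - ?c)\<^sup>2)"
  proof (intro sum_mono mult_right_mono)
    fix u assume "u \<in> {..<n}"
    then show "node_weight G u \<le> 1" using deg_le m_pos by (simp add: node_weight_eq)
  qed simp
  finally show ?thesis by (simp add: spread_eq)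
qed

lemma edge_difference_sum: "(\<Sum>(u, v)\<in>E. (f u - f v) * g u) = dirichlet f g"
  unfolding sum_E_eq dirichlet_lap lap_def by (simp add: sum_distrib_right)

lemma edge_square_sum: "(\<Sum>(u, v)\<in>E. (f u - f v)\<^sup>2) = 2 * dirichlet f f"
  by (simp add: dirichlet_def power2_eq_square)

end

context edge_process
begin

lemma sum_step:
  fixes F :: "nat \<Rightarrow> real \<Rightarrow> real"
  assumes "(u, v) \<in> E"
  shows "(\<Sum>w<n. F w (step \<alpha> \<xi> (u, v) w))
    = (\<Sum>w<n. F w (\<xi> w)) + (F u (\<alpha> * \<xi> u + \<beta> * \<xi> v) - F u (\<xi> u))"
proof -
  have u: "u < n" using assms E_lt by blast
  have "(\<Sum>w\<in>{..<n} - {u}. F w (step \<alpha> \<xi> (u, v) w)) = (\<Sum>w\<in>{..<n} - {u}. F w (\<xi> w))"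
    by (rule sum.cong) (auto simp: step_def)
  then show ?thesis
    using u sum.remove[of "{..<n}" u "\<lambda>w. F w (step \<alpha> \<xi> (u, v) w)"]
      sum.remove[of "{..<n}" u "\<lambda>w. F w (\<xi> w)"]
    by (simp add: step_def)
qed

lemma lin_step:
  "(u, v) \<in> E \<Longrightarrow> lin g (step \<alpha> \<xi> (u, v)) = lin g \<xi> - \<beta> * ((\<xi> u - \<xi> v) * g u)"
  unfolding lin_def by (subst sum_step) (simp_all add: algebra_simps)

lemma sqnorm_step:
  "(u, v) \<in> E \<Longrightarrow> sqnorm (step \<alpha> \<xi> (u, v)) = sqnorm \<xi> + ((\<alpha> * \<xi> u + \<beta> * \<xi> v)\<^sup>2 - (\<xi> u)\<^sup>2)"
  unfolding sqnorm_def by (subst sum_step[of _ _ "\<lambda>_ x. x\<^sup>2"]) simp_all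

lemma mean_step_eq:
  assumes "\<And>u v. (u, v) \<in> E \<Longrightarrow> h (step \<alpha> \<xi> (u, v)) = c + F u v"
  shows "mean_step h \<xi> = c + (\<Sum>(u, v)\<in>E. F u v) / (2 * m)"
proof -
  have "(\<Sum>e\<in>E. h (step \<alpha> \<xi> e)) = (\<Sum>(u, v)\<in>E. c + F u v)"
    by (rule sum.cong) (auto simp: assms)
  also have "\<dots> = 2 * m * c + (\<Sum>(u, v)\<in>E. F u v)"
    by (simp add: case_prod_unfold sum.distrib card_E)
  finally show ?thesis using m_pos by (simp add: mean_step_def add_divide_distrib)
qed

lemma mean_lin: "mean_step (lin g) \<xi> = lin g \<xi> - \<beta> / (2 * m) * dirichlet \<xi> g"
proof -
  have "mean_step (lin g) \<xi> = lin g \<xi> + (\<Sum>(u, v)\<in>E. - \<beta> * ((\<xi> u - \<xi> v) * g u)) / (2 * m)"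
    by (rule mean_step_eq) (simp add: lin_step algebra_simps)
  also have "(\<Sum>(u, v)\<in>E. - \<beta> * ((\<xi> u - \<xi> v) * g u)) = - \<beta> * dirichlet \<xi> g"
    unfolding edge_difference_sum[symmetric] case_prod_unfold sum_distrib_left ..
  finally show ?thesis by (simp only: mult_minus_left minus_divide_left diff_conv_add_uminus times_divide_eq_left)
qed

text \<open>
  The contributions of \<open>(u, v)\<close> and \<open>(v, u)\<close> add up to
  \<open>(\<alpha>\<^sup>2 + \<beta>\<^sup>2 - 1) (\<xi>\<^sub>u\<^sup>2 + \<xi>\<^sub>v\<^sup>2) + 4 \<alpha> \<beta> \<xi>\<^sub>u \<xi>\<^sub>v = - 2 \<alpha> \<beta> (\<xi>\<^sub>u - \<xi>\<^sub>v)\<^sup>2\<close>.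
\<close>

lemma mean_sqnorm: "mean_step sqnorm \<xi> = sqnorm \<xi> - \<alpha> * \<beta> / m * dirichlet \<xi> \<xi>"
proof -
  let ?F = "\<lambda>u v. (\<alpha> * \<xi> u + \<beta> * \<xi> v)\<^sup>2 - (\<xi> u)\<^sup>2"
  have "2 * (\<Sum>(u, v)\<in>E. ?F u v) = (\<Sum>(u, v)\<in>E. ?F u v) + (\<Sum>(u, v)\<in>E. ?F v u)"
    using sum_E_swap[of ?F] by simp
  also have "\<dots> = (\<Sum>(u, v)\<in>E. - (2 * \<alpha> * \<beta>) * (\<xi> u - \<xi> v)\<^sup>2)"
    unfolding case_prod_unfold sum.distrib[symmetric]
    by (rule sum.cong) (simp_all add: power2_eq_square algebra_simps)
  also have "\<dots> = - (2 * \<alpha> * \<beta>) * (2 * dirichlet \<xi> \<xi>)"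
    unfolding edge_square_sum[symmetric] case_prod_unfold sum_distrib_left ..
  finally have *: "(\<Sum>(u, v)\<in>E. ?F u v) = - (2 * \<alpha> * \<beta>) * dirichlet \<xi> \<xi>" by simp
  have "mean_step sqnorm \<xi> = sqnorm \<xi> + (\<Sum>(u, v)\<in>E. ?F u v) / (2 * m)"
    by (rule mean_step_eq) (rule sqnorm_step)
  then show ?thesis unfolding * by simp
qed

lemma mean_lin_square:
  "mean_step (\<lambda>\<xi>. (lin g \<xi>)\<^sup>2) \<xi> = (lin g \<xi>)\<^sup>2 - \<beta> / m * lin g \<xi> * dirichlet \<xi> g
     + \<beta>\<^sup>2 / (2 * m) * (\<Sum>(u, v)\<in>E. (g u)\<^sup>2 * (\<xi> u - \<xi> v)\<^sup>2)"
proof -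
  let ?X = "lin g \<xi>"
  have "mean_step (\<lambda>\<xi>. (lin g \<xi>)\<^sup>2) \<xi> = ?X\<^sup>2
      + (\<Sum>(u, v)\<in>E. - (2 * \<beta> * ?X) * ((\<xi> u - \<xi> v) * g u) + \<beta>\<^sup>2 * ((g u)\<^sup>2 * (\<xi> u - \<xi> v)\<^sup>2)) / (2 * m)"
    by (rule mean_step_eq) (simp add: lin_step power2_eq_square algebra_simps)
  also have "(\<Sum>(u, v)\<in>E. - (2 * \<beta> * ?X) * ((\<xi> u - \<xi> v) * g u) + \<beta>\<^sup>2 * ((g u)\<^sup>2 * (\<xi> u - \<xi> v)\<^sup>2))
      = - (2 * \<beta> * ?X) * dirichlet \<xi> g + \<beta>\<^sup>2 * (\<Sum>(u, v)\<in>E. (g u)\<^sup>2 * (\<xi> u - \<xi> v)\<^sup>2)"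
    unfolding edge_difference_sum[symmetric] case_prod_unfold sum_distrib_left sum.distrib ..
  also have "(- (2 * \<beta> * x) * d + \<beta>\<^sup>2 * s) / (2 * m) = - (\<beta> / m * x * d) + \<beta>\<^sup>2 / (2 * m) * s" for x d s
    using m_pos by (simp add: add_divide_distrib diff_divide_distrib)
      (simp add: field_simps)
  finally show ?thesis by simp
qed

lemma dirichlet_const [simp]: "dirichlet \<xi> (\<lambda>_. c) = 0"
  by (simp add: dirichlet_def)

lemma mean_lin_const_square:
  "mean_step (\<lambda>\<xi>. (lin (\<lambda>_. c) \<xi>)\<^sup>2) \<xi> = (lin (\<lambda>_. c) \<xi>)\<^sup>2 + \<beta>\<^sup>2 * c\<^sup>2 / m * dirichlet \<xi> \<xi>"
  unfolding mean_lin_square using edge_square_sum[of \<xi>]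
  by (simp add: case_prod_unfold sum_distrib_left[symmetric])

text \<open>
  The contraction rate of the mean spread.
\<close>

definition rate :: real where "rate = \<alpha> * \<beta> * lambda2 G / m"

lemma \<alpha>\<beta>_le: "\<alpha> * \<beta> \<le> 1 / 4"
proof -
  have "0 \<le> (\<alpha> - 1 / 2)\<^sup>2" by simp
  then show ?thesis by (simp add: power2_eq_square algebra_simps)
qed

lemma rate_le: "rate \<le> 1 / 2"
proof -
  have "\<alpha> * \<beta> * lambda2 G \<le> 1 / 4 * (2 * m)"
    using \<alpha>\<beta>_le lambda2_le_2m lambda2_pos by (intro mult_mono) auto
  then show ?thesis using m_pos by (simp add: rate_def pos_divide_le_eq)
qed

lemma rate_pos: "0 < rate"
  using \<alpha>_pos \<beta>_pos lambda2_pos m_pos by (simp add: rate_def)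

text \<open>
  The square of the average grows in the mean, so the spread loses at least as much as the squared norm.
\<close>

lemma mean_spread_le: "mean_step spread \<xi> \<le> (1 - rate) * spread \<xi>"
proof -
  have "mean_step spread \<xi> = mean_step (\<lambda>\<xi>. 1 * sqnorm \<xi> + (- (1 / n)) * (lin (\<lambda>_. 1) \<xi>)\<^sup>2) \<xi>"
    by (rule mean_step_cong) (simp add: spread_def)
  also have "\<dots> = spread \<xi> - \<alpha> * \<beta> / m * dirichlet \<xi> \<xi> - \<beta>\<^sup>2 / m * dirichlet \<xi> \<xi> / n"
    unfolding mean_step_linear mean_sqnorm mean_lin_const_square
    by (simp add: spread_def add_divide_distrib algebra_simps)
  also have "\<dots> \<le> spread \<xi> - \<alpha> * \<beta> / m * dirichlet \<xi> \<xi>"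
    using dirichlet_nonneg[of \<xi>] m_pos by simp
  also have "\<dots> \<le> spread \<xi> - \<alpha> * \<beta> / m * (lambda2 G * spread \<xi>)"
    using rayleigh_spread[of \<xi>] \<alpha>_pos \<beta>_pos m_pos by (intro diff_left_mono mult_left_mono) auto
  finally show ?thesis by (simp add: rate_def algebra_simps)
qed

lemma expect_spread_le: "expect t spread \<xi> \<le> (1 - rate) ^ t * spread \<xi>"
proof (induction t arbitrary: \<xi>)
  case (Suc t)
  have "expect (Suc t) spread \<xi> \<le> expect t (\<lambda>\<xi>. (1 - rate) * spread \<xi> + 0 * spread \<xi>) \<xi>"
    unfolding expect_Suc' by (rule expect_mono) (use mean_spread_le in simp)
  also have "\<dots> = (1 - rate) * expect t spread \<xi>"
    unfolding expect_linear by simp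
  also have "\<dots> \<le> (1 - rate) * ((1 - rate) ^ t * spread \<xi>)"
    using rate_le by (intro mult_left_mono Suc.IH) simp
  finally show ?case by simp
qed simp

lemma prob_potential_small:
  assumes "0 < \<epsilon>"
  shows "1 - (1 - rate) ^ t * spread \<xi> / \<epsilon> \<le> measure \<Omega> {\<omega>. potential G (edge_model \<alpha> \<xi> t \<omega>) \<le> \<epsilon>}"
proof -
  let ?A = "{\<xi>. potential G \<xi> \<le> \<epsilon>}"
  have "1 - (1 - rate) ^ t * spread \<xi> / \<epsilon> \<le> 1 * 1 + (- (1 / \<epsilon>)) * expect t spread \<xi>"
    using expect_spread_le[of t \<xi>] assms by (simp add: divide_right_mono)
  also have "\<dots> = expect t (\<lambda>\<xi>. 1 * 1 + (- (1 / \<epsilon>)) * spread \<xi>) \<xi>"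
    unfolding expect_linear by simp
  also have "\<dots> \<le> expect t (indicator ?A) \<xi>"
  proof (rule expect_mono)
    fix \<xi>
    show "1 * 1 + (- (1 / \<epsilon>)) * spread \<xi> \<le> indicator ?A \<xi>"
      using potential_le_spread[of \<xi>] spread_nonneg[of \<xi>] assms
      by (auto simp: indicator_def field_simps)
  qed
  also have "\<dots> = measure \<Omega> {\<omega>. potential G (edge_model \<alpha> \<xi> t \<omega>) \<le> \<epsilon>}"
    unfolding prob_edge_model[symmetric] by simp
  finally show ?thesis .
qed

lemma hitting_time_event:
  assumes "0 \<le> x"
  shows "{\<omega> \<in> space \<Omega>. ennreal_of_enat (hitting_time G \<alpha> \<xi> \<epsilon> \<omega>) \<le> ennreal x}
    = (\<Union>t\<in>{..nat \<lfloor>x\<rfloor>}. {\<omega>. potential G (edge_model \<alpha> \<xi> t \<omega>) \<le> \<epsilon>})"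
  unfolding ennreal_of_enat_le_iff_floor[OF assms] hitting_time_le_iff by auto

lemma prob_hitting_time:
  assumes "0 \<le> x" "0 < \<epsilon>" "t \<le> nat \<lfloor>x\<rfloor>"
  shows "1 - (1 - rate) ^ t * spread \<xi> / \<epsilon>
    \<le> measure \<Omega> {\<omega> \<in> space \<Omega>. ennreal_of_enat (hitting_time G \<alpha> \<xi> \<epsilon> \<omega>) \<le> ennreal x}"
proof -
  interpret prob_space \<Omega> by (rule prob_space_\<Omega>)
  have "measure \<Omega> {\<omega>. potential G (edge_model \<alpha> \<xi> t \<omega>) \<le> \<epsilon>}
      \<le> measure \<Omega> (\<Union>t\<in>{..nat \<lfloor>x\<rfloor>}. {\<omega>. potential G (edge_model \<alpha> \<xi> t \<omega>) \<le> \<epsilon>})"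
    by (rule finite_measure_mono) (use assms(3) in \<open>auto intro!: sets.finite_UN edge_model_event_measurable\<close>)
  then show ?thesis
    using prob_potential_small[OF assms(2), of t \<xi>] unfolding hitting_time_event[OF assms(1)] by simp
qed

text \<open>
  Put \<open>X = \<parallel>\<xi>\<parallel>\<^sup>2 / \<epsilon>\<close>. If \<open>X \<le> 1\<close>, the potential is below \<open>\<epsilon>\<close> from the start, whatever the sign of the
  logarithm. If \<open>X > 1\<close>, the time bound exceeds a positive constant, so that rounding down
  costs a factor 2 at most, and Markov's inequality gives the failure probability
  \<open>(n X) powr -(c + 1) * X \<le> n powr -c\<close>.
\<close>

theorem convergence_time_whp:
  assumes c: "1 \<le> c" and \<epsilon>: "0 < \<epsilon>"
  shows "1 - real n powr (- c) \<le> measure \<Omega> {\<omega> \<in> space \<Omega>.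
    ennreal_of_enat (hitting_time G \<alpha> \<xi> \<epsilon> \<omega>)
      \<le> ennreal (2 * (c + 1) / (\<alpha> * \<beta>) * time_bound G \<xi> \<epsilon>)}"
proof -
  define C where "C = 2 * (c + 1) / (\<alpha> * \<beta>)"
  define B where "B = time_bound G \<xi> \<epsilon>"
  have \<alpha>\<beta>: "0 < \<alpha> * \<beta>" using \<alpha>_pos \<beta>_pos by simp
  have "16 * (\<alpha> * \<beta>) \<le> 16 * (1 / 4)" by (rule mult_left_mono[OF \<alpha>\<beta>_le]) simp
  also have "\<dots> \<le> 2 * (c + 1)" using c by simp
  finally have "16 * (\<alpha> * \<beta>) \<le> 2 * (c + 1)" .
  then have C: "16 \<le> C" unfolding C_def using \<alpha>\<beta> by (simp add: pos_le_divide_eq)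
  have B: "0 \<le> B" by (simp add: B_def time_bound_def)
  define X where "X = sqnorm \<xi> / \<epsilon>"
  have X0: "spread \<xi> / \<epsilon> \<le> X"
    unfolding X_def using spread_le_sqnorm \<epsilon> by (simp add: divide_right_mono)
  have small: "spread \<xi> \<le> \<epsilon>" if "X \<le> 1"
  proof -
    have "spread \<xi> / \<epsilon> \<le> 1" using X0 that by (rule order_trans)
    then show ?thesis using \<epsilon> by (simp add: pos_divide_le_eq)
  qed
  consider "X \<le> 1" | "1 < X" using not_le by blast
  then have "1 - real n powr (- c) \<le> measure \<Omega> {\<omega> \<in> space \<Omega>.
    ennreal_of_enat (hitting_time G \<alpha> \<xi> \<epsilon> \<omega>) \<le> ennreal (C * B)}"
  proof cases
    case 1
    have "hitting_time G \<alpha> \<xi> \<epsilon> \<omega> \<le> enat 0" for \<omega>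
      unfolding hitting_time_le_iff using potential_le_spread[of \<xi>] small[OF 1] by auto
    then have "{\<omega> \<in> space \<Omega>. ennreal_of_enat (hitting_time G \<alpha> \<xi> \<epsilon> \<omega>) \<le> ennreal (C * B)} = space \<Omega>"
      by (auto simp: enat_0)
    then show ?thesis
      using prob_space.prob_space[OF prob_space_\<Omega>] by simp
  next
    case 2
    \<comment> \<open>The logarithm in the time bound; both summands of \<open>ln n + ln X\<close> are positive.\<close>
    define l where "l = ln (real n * X)"
    have l_eq: "l = ln n + ln X" unfolding l_def using n_pos 2 by (simp add: ln_mult)
    have ln2: "1 / 2 \<le> ln (real n)"
    proof -
      have "(1::real) / 2 \<le> ln 2" using ln_2_less_1 ln2_ge_two_thirds by simp
      also have "\<dots> \<le> ln (real n)" using two_le_n by simp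
      finally show ?thesis .
    qed
    have lX: "0 < ln X" using 2 by simp
    have "sqnorm \<xi> \<noteq> 0" using 2 by (auto simp: X_def)
    then have "0 < sqnorm \<xi>" using sqnorm_nonneg[of \<xi>] by simp
    moreover have "1 * 1 \<le> real n * X" using two_le_n 2 by (intro mult_mono) auto
    ultimately have B_eq: "B = m * l / lambda2 G"
      unfolding B_def l_def X_def times_divide_eq_right by (intro time_bound_eq) simp_all
    have "1 / 2 * lambda2 G \<le> m"
      using lambda2_le_2m by simp
    then have "1 / 2 \<le> m / lambda2 G" using lambda2_pos by (simp add: pos_le_divide_eq)
    then have "1 / 2 * (1 / 2) \<le> m / lambda2 G * l"
      using l_eq ln2 lX m_pos lambda2_pos by (intro mult_mono) auto
    then have B4: "1 / 4 \<le> B" unfolding B_eq by simp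
    define t where "t = nat \<lfloor>C * B\<rfloor>"
    have "4 \<le> C * B" using mult_mono[OF C B4] C B by simp
    moreover have "C * B \<le> real t + 1" unfolding t_def by linarith
    ultimately have "C * B / 2 \<le> real t" by simp
    then have "rate * (C * B / 2) \<le> rate * t" using rate_pos by (intro mult_left_mono) auto
    moreover have "rate * (C * B / 2) = (c + 1) * l"
      using \<alpha>\<beta> m_pos lambda2_pos \<alpha>_pos \<beta>_pos by (simp add: rate_def C_def B_eq)
    ultimately have rt: "(c + 1) * l \<le> rate * t" by simp
    have "(1 - rate) ^ t \<le> exp (- rate) ^ t"
      using rate_le exp_ge_add_one_self[of "- rate"] by (intro power_mono) auto
    also have "\<dots> = exp (- (rate * t))" by (simp add: exp_of_nat_mult[symmetric] mult.commute)
    also have "\<dots> \<le> exp (- ((c + 1) * l))" using rt by simp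
    finally have "(1 - rate) ^ t * X \<le> exp (- ((c + 1) * l)) * exp (ln X)"
      using 2 by (intro mult_mono) auto
    also have "\<dots> = exp (- ((c + 1) * l) + ln X)" by (simp only: exp_add)
    also have "\<dots> \<le> exp (- c * ln n)"
    proof -
      have "0 \<le> c * ln X + ln n" using c lX ln2 by simp
      then show ?thesis by (simp add: l_eq algebra_simps)
    qed
    also have "\<dots> = real n powr (- c)" using n_pos by (simp add: powr_def)
    finally have "(1 - rate) ^ t * X \<le> real n powr (- c)" .
    moreover have "(1 - rate) ^ t * spread \<xi> / \<epsilon> \<le> (1 - rate) ^ t * X"
      using X0 rate_le mult_left_mono[OF X0, of "(1 - rate) ^ t"] by simp
    moreover have "0 \<le> C * B" using \<open>4 \<le> C * B\<close> by simp
    ultimately show ?thesis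
      using prob_hitting_time[OF \<open>0 \<le> C * B\<close> \<epsilon>, of t \<xi>] by (simp add: t_def)
  qed
  then show ?thesis by (simp add: C_def B_def)
qed

end

section \<open>The limit value and its variance\<close>

context edge_process
begin

lemma mean_lin_const [simp]: "mean_step (lin (\<lambda>_. c)) = lin (\<lambda>_. c)"
  by (rule ext) (simp add: mean_lin)

lemma expect_invariant:
  assumes "mean_step h = h"
  shows "expect t h \<xi> = h \<xi>"
proof -
  have "expect t h = h" by (induction t) (simp_all add: assms)
  then show ?thesis by simp
qed

text \<open>
  The expected spreads form a convergent geometric series.
\<close>

lemma AE_spread_tendsto_0:
  "AE \<omega> in \<Omega>. (\<lambda>t. spread (edge_model \<alpha> \<xi> t \<omega>)) \<longlonglongrightarrow> 0"
proof -
  let ?S = "\<lambda>t \<omega>. spread (edge_model \<alpha> \<xi> t \<omega>)"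
  have sum: "summable (\<lambda>t. (1 - rate) ^ t * spread \<xi>)"
    using rate_le rate_pos by (intro summable_mult2 summable_geometric) simp
  have "(\<integral>\<^sup>+ \<omega>. (\<Sum>t. ennreal (?S t \<omega>)) \<partial>\<Omega>) = (\<Sum>t. \<integral>\<^sup>+ \<omega>. ennreal (?S t \<omega>) \<partial>\<Omega>)"
    by (rule nn_integral_suminf) simp
  also have "\<dots> = (\<Sum>t. ennreal (expect t spread \<xi>))"
    by (simp add: nn_integral_eq_integral integrable_edge_model spread_nonneg integral_edge_model)
  also have "\<dots> \<le> (\<Sum>t. ennreal ((1 - rate) ^ t * spread \<xi>))"
    by (intro suminf_le ennreal_leI expect_spread_le) auto
  also have "\<dots> = ennreal (\<Sum>t. (1 - rate) ^ t * spread \<xi>)"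
    using sum rate_le spread_nonneg by (intro suminf_ennreal2) auto
  finally have "(\<integral>\<^sup>+ \<omega>. (\<Sum>t. ennreal (?S t \<omega>)) \<partial>\<Omega>) \<noteq> \<infinity>"
    by (auto simp: top_unique)
  then have "AE \<omega> in \<Omega>. (\<Sum>t. ennreal (?S t \<omega>)) \<noteq> \<infinity>"
    by (intro nn_integral_noteq_infinite) auto
  then show ?thesis
  proof eventually_elim
    case (elim \<omega>)
    then have "summable (\<lambda>t. ?S t \<omega>)"
      by (intro summable_suminf_not_top) (auto simp: spread_nonneg)
    then show ?case by (rule summable_LIMSEQ_zero)
  qed
qed

text \<open>
  From time \<open>t\<close> on, all values stay within the distance \<open>\<surd>spread\<close> of the average at time \<open>t\<close>.
\<close>

lemma node_values_close:
  assumes "\<And>t. \<omega> t \<in> E" "t \<le> s" "t \<le> s'" "u < n" "v < n"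
  shows "\<bar>edge_model \<alpha> \<xi> s \<omega> u - edge_model \<alpha> \<xi> s' \<omega> v\<bar>
    \<le> 2 * sqrt (spread (edge_model \<alpha> \<xi> t \<omega>))"
proof -
  let ?x = "edge_model \<alpha> \<xi> t \<omega>"
  let ?c = "lin (\<lambda>_. 1) ?x / n" and ?r = "sqrt (spread ?x)"
  have "?c - ?r \<le> ?x w \<and> ?x w \<le> ?c + ?r" if "w < n" for w
  proof -
    have "\<bar>?x w - ?c\<bar> \<le> ?r"
      using deviation_le_spread[OF that] by (intro real_le_rsqrt) simp
    then show ?thesis by linarith
  qed
  from edge_model_between[where \<omega> = \<omega> and \<xi> = \<xi>, OF assms(1) this assms(2,4)]
    edge_model_between[where \<omega> = \<omega> and \<xi> = \<xi>, OF assms(1) this assms(3,5)]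
  show ?thesis by linarith
qed

lemma AE_convergence:
  "AE \<omega> in \<Omega>. \<forall>u<n. (\<lambda>t. edge_model \<alpha> \<xi> t \<omega> u) \<longlonglongrightarrow> limit_value \<alpha> \<xi> \<omega>"
  using AE_spread_tendsto_0[of \<xi>] AE_edges
proof eventually_elim
  case (elim \<omega>)
  let ?x = "edge_model \<alpha> \<xi>"
  let ?r = "\<lambda>t. 2 * sqrt (spread (?x t \<omega>))"
  have edges: "\<And>t. \<omega> t \<in> E" using elim by blast
  have "?r \<longlonglongrightarrow> 2 * sqrt 0" using elim by (intro tendsto_intros) auto
  then have r: "?r \<longlonglongrightarrow> 0" by simp
  have "Cauchy (\<lambda>t. ?x t \<omega> 0)"
  proof (rule metric_CauchyI)
    fix e :: real assume "0 < e"
    with r have "\<forall>\<^sub>F t in sequentially. ?r t < e" by (rule order_tendstoD)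
    then obtain M where M: "?r M < e" by (auto simp: eventually_sequentially)
    have "dist (?x s \<omega> 0) (?x s' \<omega> 0) < e" if "M \<le> s" "M \<le> s'" for s s'
      using node_values_close[where \<omega> = \<omega>, OF edges that, of 0 0 \<xi>] two_le_n M
      by (simp add: dist_real_def)
    then show "\<exists>M. \<forall>s\<ge>M. \<forall>s'\<ge>M. dist (?x s \<omega> 0) (?x s' \<omega> 0) < e" by blast
  qed
  then have lim: "(\<lambda>t. ?x t \<omega> 0) \<longlonglongrightarrow> limit_value \<alpha> \<xi> \<omega>"
    unfolding limit_value_def by (simp add: Cauchy_convergent convergent_LIMSEQ_iff[symmetric])
  show ?case
  proof (intro allI impI)
    fix u assume u: "u < n"
    have "(\<lambda>t. ?x t \<omega> u - ?x t \<omega> 0) \<longlonglongrightarrow> 0"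
    proof (rule Lim_null_comparison[OF _ r])
      show "\<forall>\<^sub>F t in sequentially. norm (?x t \<omega> u - ?x t \<omega> 0) \<le> ?r t"
        using node_values_close[where \<omega> = \<omega>, OF edges order_refl order_refl u, of 0 \<xi>] two_le_n
        by (intro always_eventually) simp
    qed
    from tendsto_add[OF this lim] show "(\<lambda>t. ?x t \<omega> u) \<longlonglongrightarrow> limit_value \<alpha> \<xi> \<omega>" by simp
  qed
qed

lemma limit_value_measurable [measurable]: "limit_value \<alpha> \<xi> \<in> borel_measurable \<Omega>"
  unfolding limit_value_def by (intro borel_measurable_lim_metric) simp

lemma AE_bounded:
  "AE \<omega> in \<Omega>. \<forall>t. \<forall>u<n. \<bar>edge_model \<alpha> \<xi> t \<omega> u\<bar> \<le> (\<Sum>v<n. \<bar>\<xi> v\<bar>)"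
  using AE_edges
proof eventually_elim
  case (elim \<omega>)
  let ?B = "\<Sum>v<n. \<bar>\<xi> v\<bar>"
  have "\<bar>\<xi> u\<bar> \<le> ?B" if "u < n" for u
    by (rule member_le_sum) (use that in auto)
  then have "- ?B \<le> edge_model \<alpha> \<xi> 0 \<omega> u \<and> edge_model \<alpha> \<xi> 0 \<omega> u \<le> ?B" if "u < n" for u
    using that by (simp add: abs_le_iff) (metis minus_le_iff)
  from edge_model_between[where \<omega> = \<omega>, OF _ this le0] elim
  show ?case by (simp add: abs_le_iff) (metis minus_le_iff)
qed

text \<open>
  Dominated convergence for a function of the state that the transition operator leaves fixed; node values are
  bounded by the sum of the initial absolute values.
\<close>

lemma integral_limit:
  fixes h :: "(nat \<Rightarrow> real) \<Rightarrow> real"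
  assumes inv: "mean_step h = h"
    and bound: "\<And>x. (\<And>u. u < n \<Longrightarrow> \<bar>x u\<bar> \<le> (\<Sum>v<n. \<bar>\<xi> v\<bar>)) \<Longrightarrow> \<bar>h x\<bar> \<le> B"
    and lim: "\<And>x y. (\<And>u. u < n \<Longrightarrow> (\<lambda>t. x t u) \<longlonglongrightarrow> y) \<Longrightarrow> (\<lambda>t. h (x t)) \<longlonglongrightarrow> k y"
    and [measurable]: "k \<in> borel_measurable borel"
  shows "(\<integral>\<omega>. k (limit_value \<alpha> \<xi> \<omega>) \<partial>\<Omega>) = h \<xi>"
proof -
  interpret prob_space \<Omega> by (rule prob_space_\<Omega>)
  have "(\<lambda>t. \<integral>\<omega>. h (edge_model \<alpha> \<xi> t \<omega>) \<partial>\<Omega>) \<longlonglongrightarrow> (\<integral>\<omega>. k (limit_value \<alpha> \<xi> \<omega>) \<partial>\<Omega>)"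
  proof (rule integral_dominated_convergence[where w = "\<lambda>_. B"])
    show "AE \<omega> in \<Omega>. (\<lambda>t. h (edge_model \<alpha> \<xi> t \<omega>)) \<longlonglongrightarrow> k (limit_value \<alpha> \<xi> \<omega>)"
      using AE_convergence[of \<xi>] by eventually_elim (rule lim, blast)
    show "AE \<omega> in \<Omega>. norm (h (edge_model \<alpha> \<xi> t \<omega>)) \<le> B" for t
      using AE_bounded[of \<xi>] by eventually_elim (simp, rule bound, blast)
  qed simp_all
  then show ?thesis
    by (simp add: integral_edge_model expect_invariant[OF inv] LIMSEQ_const_iff)
qed

text \<open>
  In one step the square of the average gains \<open>\<beta>\<^sup>2 D(\<xi>) / (n\<^sup>2 m)\<close> in the mean and \<open>\<parallel>\<xi>\<parallel>\<^sup>2\<close> loses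
  \<open>\<alpha> \<beta> D(\<xi>) / m\<close>; the coefficient \<open>\<beta> / (\<alpha> n\<^sup>2)\<close> balances the two.
\<close>

lemma second_moment_invariant:
  "mean_step (\<lambda>\<xi>. (lin (\<lambda>_. 1 / n) \<xi>)\<^sup>2 + \<beta> / (\<alpha> * (real n)\<^sup>2) * sqnorm \<xi>)
    = (\<lambda>\<xi>. (lin (\<lambda>_. 1 / n) \<xi>)\<^sup>2 + \<beta> / (\<alpha> * (real n)\<^sup>2) * sqnorm \<xi>)"
proof (rule ext)
  fix \<xi>
  have "mean_step (\<lambda>\<xi>. (lin (\<lambda>_. 1 / n) \<xi>)\<^sup>2 + \<beta> / (\<alpha> * (real n)\<^sup>2) * sqnorm \<xi>) \<xi>
      = 1 * mean_step (\<lambda>\<xi>. (lin (\<lambda>_. 1 / n) \<xi>)\<^sup>2) \<xi> + \<beta> / (\<alpha> * (real n)\<^sup>2) * mean_step sqnorm \<xi>"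
    unfolding mean_step_linear[symmetric] by simp
  also have "\<dots> = (lin (\<lambda>_. 1 / n) \<xi>)\<^sup>2 + \<beta>\<^sup>2 * (1 / n)\<^sup>2 / m * dirichlet \<xi> \<xi>
      + (\<beta> / (\<alpha> * (real n)\<^sup>2) * sqnorm \<xi> - \<beta> / (\<alpha> * (real n)\<^sup>2) * (\<alpha> * \<beta> / m * dirichlet \<xi> \<xi>))"
    unfolding mean_lin_const_square mean_sqnorm by (simp only: right_diff_distrib mult_1)
  also have "\<beta> / (\<alpha> * (real n)\<^sup>2) * (\<alpha> * \<beta> / m * dirichlet \<xi> \<xi>) = \<beta>\<^sup>2 * (1 / n)\<^sup>2 / m * dirichlet \<xi> \<xi>"
    using \<alpha>_pos by (simp add: power2_eq_square)
  finally show "mean_step (\<lambda>\<xi>. (lin (\<lambda>_. 1 / n) \<xi>)\<^sup>2 + \<beta> / (\<alpha> * (real n)\<^sup>2) * sqnorm \<xi>) \<xi>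
      = (lin (\<lambda>_. 1 / n) \<xi>)\<^sup>2 + \<beta> / (\<alpha> * (real n)\<^sup>2) * sqnorm \<xi>"
    by simp
qed

lemma abs_lin_mean_le:
  assumes "\<And>u. u < n \<Longrightarrow> \<bar>x u\<bar> \<le> B"
  shows "\<bar>lin (\<lambda>_. 1 / n) x\<bar> \<le> B"
proof -
  have "\<bar>lin (\<lambda>_. 1 / n) x\<bar> \<le> (\<Sum>u<n. 1 / n * B)"
    unfolding lin_def
    by (intro order_trans[OF sum_abs] sum_mono) (simp add: abs_mult assms divide_right_mono)
  then show ?thesis using n_pos by simp
qed

lemma tendsto_lin_mean:
  assumes "\<And>u. u < n \<Longrightarrow> (\<lambda>t. x t u) \<longlonglongrightarrow> y"
  shows "(\<lambda>t. lin (\<lambda>_. 1 / n) (x t)) \<longlonglongrightarrow> y"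
proof -
  have "(\<lambda>t. lin (\<lambda>_. 1 / n) (x t)) \<longlonglongrightarrow> (\<Sum>u<n. 1 / n * y)"
    unfolding lin_def by (intro tendsto_sum tendsto_mult tendsto_const assms) simp
  then show ?thesis using n_pos by simp
qed

text \<open>
  At time 0 the invariant of \<open>second_moment_invariant\<close> is \<open>\<beta> \<parallel>\<xi>\<parallel>\<^sup>2 / (\<alpha> n\<^sup>2)\<close>. In the limit it is
  \<open>F\<^sup>2 (1 + \<beta> / (\<alpha> n))\<close>, and \<open>F\<close> has mean 0.
\<close>

theorem variance_limit_value:
  assumes "(\<Sum>u<n. \<xi> u) = 0"
  shows "prob_space.variance \<Omega> (limit_value \<alpha> \<xi>) = \<beta> * sqnorm \<xi> / (\<alpha> * (real n)\<^sup>2 + \<beta> * n)"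
proof -
  interpret prob_space \<Omega> by (rule prob_space_\<Omega>)
  let ?B = "\<Sum>v<n. \<bar>\<xi> v\<bar>" and ?\<kappa> = "\<beta> / (\<alpha> * (real n)\<^sup>2)"
  have B: "0 \<le> ?B" by (rule sum_nonneg) simp
  have \<kappa>: "0 \<le> ?\<kappa>" using \<alpha>_pos \<beta>_pos by simp
  have mean0: "lin (\<lambda>_. 1 / n) \<xi> = 0"
    using assms by (simp add: lin_def sum_divide_distrib[symmetric])
  have "expectation (limit_value \<alpha> \<xi>) = lin (\<lambda>_. 1 / n) \<xi>"
    by (rule integral_limit[where k = "\<lambda>y. y" and B = ?B])
      (simp_all add: abs_lin_mean_le tendsto_lin_mean)
  then have E0: "expectation (limit_value \<alpha> \<xi>) = 0" by (simp add: mean0)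
  have "(\<integral>\<omega>. (limit_value \<alpha> \<xi> \<omega>)\<^sup>2 * (1 + ?\<kappa> * n) \<partial>\<Omega>)
      = (lin (\<lambda>_. 1 / n) \<xi>)\<^sup>2 + ?\<kappa> * sqnorm \<xi>"
  proof (rule integral_limit[OF second_moment_invariant, where B = "?B\<^sup>2 + ?\<kappa> * (n * ?B\<^sup>2)"])
    fix x :: "nat \<Rightarrow> real" assume x: "\<And>u. u < n \<Longrightarrow> \<bar>x u\<bar> \<le> ?B"
    have "(x u)\<^sup>2 \<le> ?B\<^sup>2" if "u < n" for u
      using power_mono[OF x[OF that], of 2] by simp
    then have "sqnorm x \<le> (\<Sum>u<n. ?B\<^sup>2)" unfolding sqnorm_def by (intro sum_mono) simp
    moreover have "(lin (\<lambda>_. 1 / n) x)\<^sup>2 \<le> ?B\<^sup>2"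
      using power_mono[OF abs_lin_mean_le[of x ?B], of 2] x by simp
    ultimately have "(lin (\<lambda>_. 1 / n) x)\<^sup>2 + ?\<kappa> * sqnorm x \<le> ?B\<^sup>2 + ?\<kappa> * (n * ?B\<^sup>2)"
      using \<kappa> by (intro add_mono mult_left_mono) auto
    moreover have "0 \<le> (lin (\<lambda>_. 1 / n) x)\<^sup>2 + ?\<kappa> * sqnorm x"
      by (intro add_nonneg_nonneg mult_nonneg_nonneg \<kappa> sqnorm_nonneg) simp
    ultimately show "\<bar>(lin (\<lambda>_. 1 / n) x)\<^sup>2 + ?\<kappa> * sqnorm x\<bar> \<le> ?B\<^sup>2 + ?\<kappa> * (n * ?B\<^sup>2)"
      by simp
  next
    fix x :: "nat \<Rightarrow> nat \<Rightarrow> real" and y assume x: "\<And>u. u < n \<Longrightarrow> (\<lambda>t. x t u) \<longlonglongrightarrow> y"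
    have "(\<lambda>t. sqnorm (x t)) \<longlonglongrightarrow> (\<Sum>u<n. y\<^sup>2)"
      unfolding sqnorm_def by (intro tendsto_sum tendsto_power x) simp
    then have "(\<lambda>t. (lin (\<lambda>_. 1 / n) (x t))\<^sup>2 + ?\<kappa> * sqnorm (x t)) \<longlonglongrightarrow> y\<^sup>2 + ?\<kappa> * (n * y\<^sup>2)"
      by (intro tendsto_intros tendsto_lin_mean x) simp_all
    then show "(\<lambda>t. (lin (\<lambda>_. 1 / n) (x t))\<^sup>2 + ?\<kappa> * sqnorm (x t)) \<longlonglongrightarrow> y\<^sup>2 * (1 + ?\<kappa> * n)"
      by (simp add: algebra_simps)
  qed simp
  then have "expectation (\<lambda>\<omega>. (limit_value \<alpha> \<xi> \<omega>)\<^sup>2) * (1 + ?\<kappa> * n) = ?\<kappa> * sqnorm \<xi>"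
    by (simp add: mean0)
  moreover have "1 + ?\<kappa> * n = (\<alpha> * (real n)\<^sup>2 + \<beta> * n) / (\<alpha> * (real n)\<^sup>2)"
    using \<alpha>_pos n_pos by (simp add: field_simps)
  moreover have "0 < \<alpha> * (real n)\<^sup>2 + \<beta> * n" using \<alpha>_pos \<beta>_pos n_pos by (intro add_pos_pos) auto
  ultimately have "expectation (\<lambda>\<omega>. (limit_value \<alpha> \<xi> \<omega>)\<^sup>2) = \<beta> * sqnorm \<xi> / (\<alpha> * (real n)\<^sup>2 + \<beta> * n)"
    using \<alpha>_pos n_pos by (simp add: field_simps)
  then show ?thesis by (simp add: E0)
qed

lemma variance_bounds:
  assumes "(\<Sum>u<n. \<xi> u) = 0"
  shows "\<beta> * (sqnorm \<xi> / (real n)\<^sup>2) \<le> prob_space.variance \<Omega> (limit_value \<alpha> \<xi>)"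
    and "prob_space.variance \<Omega> (limit_value \<alpha> \<xi>) \<le> \<beta> / \<alpha> * (sqnorm \<xi> / (real n)\<^sup>2)"
proof -
  let ?D = "\<alpha> * (real n)\<^sup>2 + \<beta> * real n"
  have num: "0 \<le> \<beta> * sqnorm \<xi>" using \<beta>_pos sqnorm_nonneg by simp
  have pos: "0 < \<alpha> * (real n)\<^sup>2" using \<alpha>_pos n_pos by simp
  have "real n * 1 \<le> real n * real n" using two_le_n by (intro mult_left_mono) auto
  then have "\<beta> * real n \<le> \<beta> * (real n)\<^sup>2" using \<beta>_pos by (simp add: power2_eq_square)
  then have D1: "?D \<le> (real n)\<^sup>2" by (simp add: algebra_simps)
  have D2: "\<alpha> * (real n)\<^sup>2 \<le> ?D" using \<beta>_pos by simp
  show "\<beta> * (sqnorm \<xi> / (real n)\<^sup>2) \<le> prob_space.variance \<Omega> (limit_value \<alpha> \<xi>)"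
    unfolding variance_limit_value[OF assms] times_divide_eq_right
    by (rule frac_le[OF num order_refl less_le_trans[OF pos D2] D1])
  show "prob_space.variance \<Omega> (limit_value \<alpha> \<xi>) \<le> \<beta> / \<alpha> * (sqnorm \<xi> / (real n)\<^sup>2)"
    using frac_le[OF num order_refl pos D2] unfolding variance_limit_value[OF assms] by simp
qed

end

section \<open>Starting from a set of few nodes\<close>

lemma ln_ge_one_minus_inverse:
  fixes x :: real
  assumes "0 < x"
  shows "1 - 1 / x \<le> ln x"
  using ln_le_minus_one[of "1 / x"] assms by (simp add: ln_div)

text \<open>
  If \<open>b\<close> is at most \<open>a / 2\<close>, both squares are bounded by multiples of \<open>(a - b)\<^sup>2\<close> and the logarithms are at
  least \<open>ln \<alpha>\<close>. Otherwise write the right-hand side as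
  \<open>b\<^sup>2 (L1 + L2) + (a - b) (a + b) L1\<close> for the two logarithms \<open>L1\<close> and \<open>L2\<close>. Their
  sum is the logarithm of \<open>1 + \<alpha> \<beta> (1 - \<rho>)\<^sup>2 / \<rho>\<close>, hence nonnegative and of second order in \<open>1 - \<rho>\<close>,
  while \<open>L1\<close> is negative at most to first order. Completing the square leaves a multiple of
  \<open>(a - b)\<^sup>2\<close>.
\<close>

lemma log_pair_lower_bound_ordered:
  fixes \<alpha> a b \<rho> :: real
  assumes \<alpha>: "0 < \<alpha>" "\<alpha> < 1" and ab: "0 \<le> b" "b \<le> a" and \<rho>: "0 < \<rho>"
  shows "- (13 / \<alpha> ^ 3) * (a - b)\<^sup>2
    \<le> a\<^sup>2 * ln (\<alpha> + (1 - \<alpha>) * \<rho>) + b\<^sup>2 * ln (\<alpha> + (1 - \<alpha>) / \<rho>)"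
proof -
  define \<beta> where "\<beta> = 1 - \<alpha>"
  define L1 where "L1 = ln (\<alpha> + \<beta> * \<rho>)"
  define L2 where "L2 = ln (\<alpha> + \<beta> / \<rho>)"
  have \<beta>: "0 < \<beta>" "\<beta> < 1" "\<alpha> + \<beta> = 1" using \<alpha> by (simp_all add: \<beta>_def)
  have \<alpha>3: "0 < \<alpha> ^ 3" "\<alpha> ^ 3 \<le> \<alpha>" using \<alpha> power_decreasing[of 1 3 \<alpha>] by simp_all
  have p1: "\<alpha> < \<alpha> + \<beta> * \<rho>" and p2: "\<alpha> < \<alpha> + \<beta> / \<rho>" using \<beta> \<rho> by simp_all
  have ln\<alpha>: "- (1 / \<alpha>) \<le> ln \<alpha>" using ln_ge_one_minus_inverse[of \<alpha>] \<alpha> by simp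
  have "ln \<alpha> \<le> L1" "ln \<alpha> \<le> L2" unfolding L1_def L2_def using p1 p2 \<alpha> by simp_all
  with ln\<alpha> have L: "- (1 / \<alpha>) \<le> L1" "- (1 / \<alpha>) \<le> L2" by linarith+
  have prod: "(\<alpha> + \<beta> * \<rho>) * (\<alpha> + \<beta> / \<rho>) = 1 + \<alpha> * \<beta> * (1 - \<rho>)\<^sup>2 / \<rho>"
  proof -
    have "(\<alpha> + \<beta> * \<rho>) * (\<alpha> + \<beta> / \<rho>) = \<alpha>\<^sup>2 + \<beta>\<^sup>2 + \<alpha> * \<beta> * (\<rho> + 1 / \<rho>)"
      using \<rho> by (simp add: field_simps power2_eq_square)
    also have "\<dots> = (\<alpha> + \<beta>)\<^sup>2 + \<alpha> * \<beta> * (\<rho> + 1 / \<rho> - 2)"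
      by (simp add: power2_eq_square algebra_simps)
    also have "\<rho> + 1 / \<rho> - 2 = (1 - \<rho>)\<^sup>2 / \<rho>"
      using \<rho> by (simp add: field_simps power2_eq_square)
    finally show ?thesis using \<beta> by simp
  qed
  have Lsum: "L1 + L2 = ln (1 + \<alpha> * \<beta> * (1 - \<rho>)\<^sup>2 / \<rho>)"
  proof -
    have "0 < \<alpha> + \<beta> * \<rho>" "0 < \<alpha> + \<beta> / \<rho>" using p1 p2 \<alpha> by linarith+
    then show ?thesis unfolding L1_def L2_def prod[symmetric] by (simp add: ln_mult)
  qed
  have split: "a\<^sup>2 * L1 + b\<^sup>2 * L2 = b\<^sup>2 * (L1 + L2) + (a - b) * (a + b) * L1"
    by (simp add: power2_eq_square algebra_simps)
  have neg: "- (13 / \<alpha> ^ 3) * (a - b)\<^sup>2 \<le> 0" using \<alpha>3 by simp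
  have "- (13 / \<alpha> ^ 3) * (a - b)\<^sup>2 \<le> a\<^sup>2 * L1 + b\<^sup>2 * L2"
  proof (cases "b \<le> a / 2")
    case True
    have "a\<^sup>2 \<le> (2 * (a - b))\<^sup>2" using True ab by (intro power_mono) auto
    moreover have "b\<^sup>2 \<le> (a - b)\<^sup>2" using True ab by (intro power_mono) auto
    ultimately have "a\<^sup>2 + b\<^sup>2 \<le> 5 * (a - b)\<^sup>2" unfolding power_mult_distrib by simp
    moreover have "1 / \<alpha> \<le> 1 / \<alpha> ^ 3" using \<alpha>3 \<alpha> by (intro divide_left_mono) auto
    ultimately have "1 / \<alpha> * (a\<^sup>2 + b\<^sup>2) \<le> 1 / \<alpha> ^ 3 * (5 * (a - b)\<^sup>2)"
      using \<alpha>3 \<alpha> by (intro mult_mono) auto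
    also have "\<dots> \<le> 13 / \<alpha> ^ 3 * (a - b)\<^sup>2" using \<alpha>3 by (simp add: divide_right_mono)
    finally have "- (13 / \<alpha> ^ 3) * (a - b)\<^sup>2 \<le> a\<^sup>2 * (- (1 / \<alpha>)) + b\<^sup>2 * (- (1 / \<alpha>))"
      by (simp add: algebra_simps)
    also have "\<dots> \<le> a\<^sup>2 * L1 + b\<^sup>2 * L2" using L by (intro add_mono mult_left_mono) auto
    finally show ?thesis .
  next
    case False
    have Lsum0: "0 \<le> L1 + L2" unfolding Lsum using \<alpha> \<beta> \<rho> by (intro ln_ge_zero) auto
    show ?thesis
    proof (cases "1 \<le> \<rho>")
      case True
      have "\<beta> * 1 \<le> \<beta> * \<rho>" using True \<beta> by (intro mult_left_mono) auto
      then have "1 \<le> \<alpha> + \<beta> * \<rho>" using \<beta> by linarith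
      then have "0 \<le> L1" by (simp add: L1_def)
      then have "0 \<le> (a - b) * (a + b) * L1" using ab by simp
      moreover have "0 \<le> b\<^sup>2 * (L1 + L2)" using Lsum0 by (rule mult_nonneg_nonneg[rotated]) simp
      ultimately have "0 \<le> a\<^sup>2 * L1 + b\<^sup>2 * L2" unfolding split by linarith
      then show ?thesis using neg by linarith
    next
      case False
      define x where "x = 1 - \<rho>"
      have x: "0 < x" "x < 1" using False \<rho> by (simp_all add: x_def)
      define d where "d = a - b"
      define y where "y = b * x"
      have d0: "0 \<le> d" and y0: "0 \<le> y" using ab x by (simp_all add: d_def y_def)
      have den: "\<alpha> + \<beta> * \<rho> = 1 - \<beta> * x" using \<beta> by (simp add: x_def algebra_simps)
      have "\<beta> * x \<le> \<beta>" using x \<beta> by simp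
      then have "\<alpha> \<le> 1 - \<beta> * x" using \<beta> by linarith
      then have "\<beta> * x / (1 - \<beta> * x) \<le> \<beta> * x / \<alpha>"
        using \<alpha> \<beta> x by (intro divide_left_mono) auto
      moreover have "1 - 1 / (1 - \<beta> * x) = - (\<beta> * x / (1 - \<beta> * x))"
        using \<open>\<alpha> \<le> 1 - \<beta> * x\<close> \<alpha> by (simp add: field_simps)
      ultimately have L1: "- (\<beta> * x / \<alpha>) \<le> L1"
        using ln_ge_one_minus_inverse[of "1 - \<beta> * x"] \<open>\<alpha> \<le> 1 - \<beta> * x\<close> \<alpha>
        unfolding L1_def den by linarith
      define z where "z = \<alpha> * \<beta> * x\<^sup>2"
      have z: "0 \<le> z" "z \<le> 1"
      proof -
        show "0 \<le> z" using \<alpha> \<beta> by (simp add: z_def)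
        have "\<alpha> * \<beta> \<le> 1 * 1" using \<alpha> \<beta> by (intro mult_mono) auto
        moreover have "x\<^sup>2 \<le> 1" using x by (simp add: power_le_one)
        ultimately show "z \<le> 1"
          unfolding z_def using mult_mono[of "\<alpha> * \<beta>" 1 "x\<^sup>2" 1] by simp
      qed
      have "z / 1 \<le> z / \<rho>" using z False \<rho> by (intro divide_left_mono) auto
      then have "ln (1 + z) \<le> L1 + L2"
        unfolding Lsum x_def[symmetric] z_def[symmetric] using z \<rho> by simp
      moreover have "z / 2 \<le> ln (1 + z)"
      proof -
        have "z / 2 \<le> z / (1 + z)" using z by (intro divide_left_mono) auto
        also have "\<dots> = 1 - 1 / (1 + z)" using z by (simp add: field_simps)
        also have "\<dots> \<le> ln (1 + z)" using z by (intro ln_ge_one_minus_inverse) auto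
        finally show ?thesis .
      qed
      ultimately have L12: "z / 2 \<le> L1 + L2" by linarith
      have s: "d * (a + b) \<le> d * (3 * b)"
        using d0 \<open>\<not> b \<le> a / 2\<close> by (intro mult_left_mono) auto
      have "- (\<beta> * x / \<alpha>) \<le> 0" using \<beta> x \<alpha> by simp
      then have "d * (3 * b) * (- (\<beta> * x / \<alpha>)) \<le> d * (a + b) * (- (\<beta> * x / \<alpha>))"
        using s by (rule mult_right_mono_neg[rotated])
      also have "\<dots> \<le> d * (a + b) * L1" using L1 d0 ab by (intro mult_left_mono) auto
      finally have t1: "d * (3 * b) * (- (\<beta> * x / \<alpha>)) \<le> d * (a + b) * L1" .
      have t2: "b\<^sup>2 * (z / 2) \<le> b\<^sup>2 * (L1 + L2)" using L12 by (rule mult_left_mono) simp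
      have "b\<^sup>2 * (z / 2) + d * (3 * b) * (- (\<beta> * x / \<alpha>)) = \<beta> * (\<alpha> / 2 * y\<^sup>2 - 3 * d * y / \<alpha>)"
        by (simp add: y_def z_def power2_eq_square algebra_simps)
      \<comment> \<open>Complete the square in \<open>y\<close>; the factor 3 comes from \<open>a + b \<le> 3 b\<close>.\<close>
      also have "\<alpha> / 2 * y\<^sup>2 - 3 * d * y / \<alpha> = \<alpha> / 2 * (y - 3 * d / \<alpha>\<^sup>2)\<^sup>2 - 9 / 2 * d\<^sup>2 / \<alpha> ^ 3"
        using \<alpha> by (simp add: power2_eq_square power3_eq_cube field_simps)
      finally have "\<beta> * (\<alpha> / 2 * (y - 3 * d / \<alpha>\<^sup>2)\<^sup>2 - 9 / 2 * d\<^sup>2 / \<alpha> ^ 3) \<le> a\<^sup>2 * L1 + b\<^sup>2 * L2"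
        unfolding split d_def[symmetric] using t1 t2 by linarith
      moreover have "\<beta> * (0 - 9 / 2 * d\<^sup>2 / \<alpha> ^ 3) \<le> \<beta> * (\<alpha> / 2 * (y - 3 * d / \<alpha>\<^sup>2)\<^sup>2 - 9 / 2 * d\<^sup>2 / \<alpha> ^ 3)"
        using \<alpha> \<beta> by (intro mult_left_mono diff_right_mono) auto
      moreover have "\<beta> * (9 / 2 * d\<^sup>2 / \<alpha> ^ 3) \<le> 1 * (13 * d\<^sup>2 / \<alpha> ^ 3)"
        using \<alpha>3 \<beta> by (intro mult_mono divide_right_mono mult_right_mono) auto
      ultimately show ?thesis by (simp add: d_def[symmetric])
    qed
  qed
  then show ?thesis by (simp add: L1_def L2_def \<beta>_def)
qed

lemma log_pair_lower_bound:
  fixes \<alpha> a b \<rho> :: real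
  assumes \<alpha>: "0 < \<alpha>" "\<alpha> < 1" and ab: "0 \<le> a" "0 \<le> b" and \<rho>: "0 < \<rho>"
  shows "- (13 / \<alpha> ^ 3) * (a - b)\<^sup>2
    \<le> a\<^sup>2 * ln (\<alpha> + (1 - \<alpha>) * \<rho>) + b\<^sup>2 * ln (\<alpha> + (1 - \<alpha>) / \<rho>)"
proof (cases "b \<le> a")
  case True
  then show ?thesis using log_pair_lower_bound_ordered assms by blast
next
  case False
  then have "- (13 / \<alpha> ^ 3) * (b - a)\<^sup>2
      \<le> b\<^sup>2 * ln (\<alpha> + (1 - \<alpha>) * (1 / \<rho>)) + a\<^sup>2 * ln (\<alpha> + (1 - \<alpha>) / (1 / \<rho>))"
    using assms by (intro log_pair_lower_bound_ordered) auto
  then show ?thesis by (simp add: power2_commute[of b a] add.commute)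
qed

context edge_process
begin

lemma expect_affine:
  "expect t (\<lambda>\<xi>. a + b * h \<xi> + c * k \<xi>) \<xi> = a + b * expect t h \<xi> + c * expect t k \<xi>"
proof -
  have "expect t (\<lambda>\<xi>. 1 * (a * 1 + b * h \<xi>) + c * k \<xi>) \<xi>
      = 1 * expect t (\<lambda>\<xi>. a * 1 + b * h \<xi>) \<xi> + c * expect t k \<xi>"
    by (rule expect_linear)
  also have "expect t (\<lambda>\<xi>. a * 1 + b * h \<xi>) \<xi> = a * expect t (\<lambda>_. 1) \<xi> + b * expect t h \<xi>"
    by (rule expect_linear)
  finally show ?thesis by simp
qed

lemma expect_drift:
  assumes step: "\<And>\<xi> e. \<xi> \<in> I \<Longrightarrow> e \<in> E \<Longrightarrow> step \<alpha> \<xi> e \<in> I"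
    and drift: "\<And>\<xi>. \<xi> \<in> I \<Longrightarrow> h \<xi> - c \<le> mean_step h \<xi>" and "\<xi> \<in> I"
  shows "h \<xi> - real t * c \<le> expect t h \<xi>"
proof (induction t)
  case (Suc t)
  have "expect t h \<xi> - c = expect t (\<lambda>\<xi>. - c + 1 * h \<xi> + 0 * h \<xi>) \<xi>"
    unfolding expect_affine by simp
  also have "\<dots> \<le> expect (Suc t) h \<xi>"
    unfolding expect_Suc' by (rule expect_mono_on[OF step]) (use drift \<open>\<xi> \<in> I\<close> in force)+
  finally show ?case using Suc.IH by (simp add: algebra_simps del: funpow.simps)
qed simp

text \<open>
  The terms with \<open>g u = 0\<close> vanish, so the default value of the logarithm outside of the positive reals
  does not matter for states in \<open>positive_on_support g K\<close>.
\<close>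

definition log_energy :: "(nat \<Rightarrow> real) \<Rightarrow> (nat \<Rightarrow> real) \<Rightarrow> real" where
  "log_energy g \<xi> = (\<Sum>u<n. (g u)\<^sup>2 * ln (\<xi> u))"

definition positive_on_support :: "(nat \<Rightarrow> real) \<Rightarrow> real \<Rightarrow> (nat \<Rightarrow> real) set" where
  "positive_on_support g K = {\<xi>. \<forall>u<n. 0 \<le> \<xi> u \<and> \<xi> u \<le> K \<and> (g u \<noteq> 0 \<longrightarrow> 0 < \<xi> u)}"

lemma positive_on_support_step:
  assumes \<xi>: "\<xi> \<in> positive_on_support g K" and e: "e \<in> E"
  shows "step \<alpha> \<xi> e \<in> positive_on_support g K"
  unfolding positive_on_support_def
proof (intro CollectI allI impI conjI)
  fix w assume w: "w < n"
  show "0 \<le> step \<alpha> \<xi> e w" "step \<alpha> \<xi> e w \<le> K"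
    using step_between[OF e, of 0 \<xi> K w] \<xi> w by (auto simp: positive_on_support_def)
  assume g: "g w \<noteq> 0"
  obtain x y where e': "e = (x, y)" by (cases e)
  then have "x < n" "y < n" using E_lt e by auto
  then show "0 < step \<alpha> \<xi> e w"
    using \<xi> w g \<alpha>_pos \<beta>_pos
    by (auto simp: positive_on_support_def step_def e' intro!: add_pos_nonneg)
qed

text \<open>
  Along an edge between two support nodes, the two orientations together change the log energy by at
  least \<open>-(13/\<alpha>\<^sup>3) (g u - g v)\<^sup>2\<close>, by \<open>log_pair_lower_bound\<close> with \<open>\<rho> = \<xi> v / \<xi> u\<close>. Along an edge that
  leaves the support, the value at the support node keeps at least the factor \<open>\<alpha>\<close>, at the cost
  \<open>g\<^sup>2 ln \<alpha>\<close>, which is of the same form because \<open>g\<close> is 0 at the other end.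
\<close>

lemma mean_log_energy:
  assumes g: "\<And>u. u < n \<Longrightarrow> 0 \<le> g u" and \<xi>: "\<xi> \<in> positive_on_support g K"
  shows "log_energy g \<xi> - 13 / \<alpha> ^ 3 / (2 * m) * dirichlet g g \<le> mean_step (log_energy g) \<xi>"
proof -
  define T where "T = (\<lambda>u v. (g u)\<^sup>2 * ln (\<alpha> * \<xi> u + \<beta> * \<xi> v) - (g u)\<^sup>2 * ln (\<xi> u))"
  let ?C = "13 / \<alpha> ^ 3"
  have zero: "- ?C * (g u)\<^sup>2 \<le> T u v" if u: "u < n" and v: "v < n" and gu: "g u \<noteq> 0" for u v
  proof -
    have pos: "0 < \<xi> u" "0 \<le> \<xi> v" using \<xi> u v gu by (auto simp: positive_on_support_def)
    have "ln (\<alpha> * \<xi> u) \<le> ln (\<alpha> * \<xi> u + \<beta> * \<xi> v)"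
      using pos \<alpha>_pos \<beta>_pos by (subst ln_le_cancel_iff) (auto intro: add_pos_nonneg)
    then have "ln \<alpha> \<le> ln (\<alpha> * \<xi> u + \<beta> * \<xi> v) - ln (\<xi> u)"
      using pos \<alpha>_pos by (simp add: ln_mult)
    moreover have "- ?C \<le> ln \<alpha>"
    proof -
      have "\<alpha> ^ 3 \<le> \<alpha>" using power_decreasing[of 1 3 \<alpha>] \<alpha>_pos \<alpha>_less_1 by simp
      then have "1 / \<alpha> \<le> 13 / \<alpha> ^ 3" using \<alpha>_pos by (intro frac_le) auto
      then show ?thesis using ln_ge_one_minus_inverse[OF \<alpha>_pos] by linarith
    qed
    ultimately have "- ?C \<le> ln (\<alpha> * \<xi> u + \<beta> * \<xi> v) - ln (\<xi> u)" by linarith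
    then have "(g u)\<^sup>2 * - ?C \<le> (g u)\<^sup>2 * (ln (\<alpha> * \<xi> u + \<beta> * \<xi> v) - ln (\<xi> u))"
      by (rule mult_left_mono) simp
    then show ?thesis by (simp add: T_def algebra_simps)
  qed
  have both: "- ?C * (g u - g v)\<^sup>2 \<le> T u v + T v u" if uv: "(u, v) \<in> E" for u v
  proof -
    have u: "u < n" and v: "v < n" using E_lt uv by auto
    consider "g u = 0" "g v = 0" | "g u \<noteq> 0" "g v = 0" | "g u = 0" "g v \<noteq> 0" | "g u \<noteq> 0" "g v \<noteq> 0"
      by blast
    then show ?thesis
    proof cases
      case 1
      then show ?thesis by (simp add: T_def)
    next
      case 2
      then show ?thesis using zero[OF u v] by (simp add: T_def)
    next
      case 3
      then show ?thesis using zero[OF v u] by (simp add: T_def)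
    next
      case 4
      then have pos: "0 < \<xi> u" "0 < \<xi> v" using \<xi> u v by (auto simp: positive_on_support_def)
      have ratio: "ln (\<alpha> * x + \<beta> * y) - ln x = ln (\<alpha> + \<beta> * (y / x))" if "0 < x" "0 < y" for x y
      proof -
        have "\<alpha> + \<beta> * (y / x) = (\<alpha> * x + \<beta> * y) / x" using that by (simp add: field_simps)
        moreover have "0 < \<alpha> * x + \<beta> * y"
          using that \<alpha>_pos \<beta>_pos by (intro add_pos_pos mult_pos_pos)
        ultimately show ?thesis using that by (simp add: ln_div)
      qed
      have "T u v + T v u = (g u)\<^sup>2 * ln (\<alpha> + \<beta> * (\<xi> v / \<xi> u)) + (g v)\<^sup>2 * ln (\<alpha> + \<beta> * (\<xi> u / \<xi> v))"
        unfolding ratio[OF pos, symmetric] ratio[OF pos(2) pos(1), symmetric] T_def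
        by (simp add: algebra_simps)
      moreover have "- ?C * (g u - g v)\<^sup>2
          \<le> (g u)\<^sup>2 * ln (\<alpha> + \<beta> * (\<xi> v / \<xi> u)) + (g v)\<^sup>2 * ln (\<alpha> + \<beta> / (\<xi> v / \<xi> u))"
        using pos g[OF u] g[OF v] \<alpha>_pos \<alpha>_less_1 by (intro log_pair_lower_bound) auto
      ultimately show ?thesis by simp
    qed
  qed
  have "- ?C * (2 * dirichlet g g) = (\<Sum>(u, v)\<in>E. - ?C * (g u - g v)\<^sup>2)"
    unfolding edge_square_sum[symmetric] case_prod_unfold sum_distrib_left ..
  also have "\<dots> \<le> (\<Sum>(u, v)\<in>E. T u v + T v u)"
    by (rule sum_mono) (use both in auto)
  also have "\<dots> = 2 * (\<Sum>(u, v)\<in>E. T u v)"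
    using sum_E_swap[of T] by (simp add: case_prod_unfold sum.distrib)
  finally have "- ?C * dirichlet g g \<le> (\<Sum>(u, v)\<in>E. T u v)" by simp
  then have "- ?C * dirichlet g g / (2 * m) \<le> (\<Sum>(u, v)\<in>E. T u v) / (2 * m)"
    using m_pos by (intro divide_right_mono) auto
  moreover have "mean_step (log_energy g) \<xi> = log_energy g \<xi> + (\<Sum>(u, v)\<in>E. T u v) / (2 * m)"
    unfolding log_energy_def T_def
    by (rule mean_step_eq) (rule sum_step[of _ _ "\<lambda>u x. (g u)\<^sup>2 * ln x"])
  ultimately show ?thesis by simp
qed

definition apart :: "real \<Rightarrow> (nat \<Rightarrow> real) set" where
  "apart d = {\<xi>. \<exists>u<n. \<exists>v<n. d \<le> \<xi> u - \<xi> v}"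

text \<open>
  Two applications of Markov's inequality, each with failure probability \<open>1/4\<close>. The deficit
  \<open>q ln K - log_energy\<close>, where \<open>q = \<parallel>g\<parallel>\<^sup>2\<close>, is nonnegative and has mean at most \<open>q J\<close>; if it is below \<open>4 q J\<close>,
  then some support node has a value of at least \<open>K exp (-4 J)\<close>. The sum of all values has mean \<open>K card A\<close>
  for the support \<open>A\<close>; if it is below \<open>4 K card A\<close>, then some node has a value of at most the
  corresponding average. Both bounds enter through one affine
  function of these two quantities below the indicator of the event.
\<close>

lemma localised_start_stays_apart:
  assumes g: "\<And>u. u < n \<Longrightarrow> 0 \<le> g u" and gpos: "0 < sqnorm g"
    and dir: "dirichlet g g \<le> 4 * lambda2 G * sqnorm g"
    and K: "0 < K" and J: "0 < J" "real t * (26 / \<alpha> ^ 3 * lambda2 G / m) \<le> J"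
  shows "1 / 2 \<le> expect t (indicator (apart (K * (exp (- 4 * J) - 4 * real (card {u. u < n \<and> g u \<noteq> 0}) / n))))
    (\<lambda>u. if g u \<noteq> 0 then K else 0)"
proof -
  define A where "A = {u. u < n \<and> g u \<noteq> 0}"
  define a where "a = real (card A)"
  define q where "q = sqnorm g"
  define \<xi>0 where "\<xi>0 = (\<lambda>u. if g u \<noteq> 0 then K else 0)"
  define I where "I = positive_on_support g K"
  define H where "H = apart (K * (exp (- 4 * J) - 4 * a / n))"
  have q: "0 < q" using gpos by (simp add: q_def)
  have finA: "finite A" by (simp add: A_def)
  have "A \<noteq> {}"
  proof
    assume "A = {}"
    then have "sqnorm g = 0" by (auto simp: sqnorm_def A_def)
    then show False using gpos by simp
  qed
  then have a: "0 < a" using finA by (simp add: a_def card_gt_0_iff)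
  have \<xi>0: "\<xi>0 \<in> I" using K by (auto simp: I_def \<xi>0_def positive_on_support_def)
  have log0: "log_energy g \<xi>0 = q * ln K"
    unfolding log_energy_def q_def sqnorm_def sum_distrib_right by (rule sum.cong) (auto simp: \<xi>0_def)
  have lin0: "lin (\<lambda>_. 1) \<xi>0 = K * a"
  proof -
    have "lin (\<lambda>_. 1) \<xi>0 = (\<Sum>u\<in>A. K)"
      unfolding lin_def \<xi>0_def by (rule sum.mono_neutral_cong_right) (auto simp: A_def)
    then show ?thesis by (simp add: a_def)
  qed
  let ?c = "13 / \<alpha> ^ 3 / (2 * m) * dirichlet g g"
  have "log_energy g \<xi>0 - real t * ?c \<le> expect t (log_energy g) \<xi>0"
    using mean_log_energy[OF g] positive_on_support_step \<xi>0 unfolding I_def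
    by (intro expect_drift[where I = "positive_on_support g K"]) auto
  moreover have "real t * ?c \<le> q * J"
  proof -
    have "real t * ?c \<le> real t * (13 / \<alpha> ^ 3 / (2 * m) * (4 * lambda2 G * sqnorm g))"
      using dir \<alpha>_pos m_pos by (intro mult_left_mono) auto
    also have "\<dots> = real t * (26 / \<alpha> ^ 3 * lambda2 G / m) * q" by (simp add: q_def mult_ac)
    also have "\<dots> \<le> J * q" using J q by (intro mult_right_mono) auto
    finally show ?thesis by (simp add: mult.commute)
  qed
  ultimately have E1: "q * ln K - q * J \<le> expect t (log_energy g) \<xi>0" by (simp add: log0)
  have E2: "expect t (lin (\<lambda>_. 1)) \<xi>0 = K * a"
    using expect_invariant[OF mean_lin_const] by (simp add: lin0)
  have H: "(1 - ln K / (4 * J)) + 1 / (4 * q * J) * log_energy g \<xi> + (- (1 / (4 * K * a))) * lin (\<lambda>_. 1) \<xi>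
      \<le> indicator H \<xi>" if \<xi>: "\<xi> \<in> I" for \<xi>
  proof -
    define P where "P = (q * ln K - log_energy g \<xi>) / (4 * q * J)"
    define Q where "Q = lin (\<lambda>_. 1) \<xi> / (4 * K * a)"
    have lhs: "(1 - ln K / (4 * J)) + 1 / (4 * q * J) * log_energy g \<xi> + (- (1 / (4 * K * a))) * lin (\<lambda>_. 1) \<xi>
        = 1 - P - Q"
      using q J by (simp add: P_def Q_def diff_divide_distrib)
    have "log_energy g \<xi> \<le> q * ln K"
      unfolding log_energy_def q_def sqnorm_def sum_distrib_right
    proof (rule sum_mono)
      fix u assume "u \<in> {..<n}"
      then show "(g u)\<^sup>2 * ln (\<xi> u) \<le> (g u)\<^sup>2 * ln K"
        using \<xi> by (cases "g u = 0") (auto simp: I_def positive_on_support_def)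
    qed
    then have P: "0 \<le> P" unfolding P_def using q J by simp
    have "0 \<le> lin (\<lambda>_. 1) \<xi>"
      unfolding lin_def using \<xi> by (intro sum_nonneg) (auto simp: I_def positive_on_support_def)
    then have Q: "0 \<le> Q" unfolding Q_def using K a by simp
    have "\<xi> \<in> H" if "P < 1" "Q < 1"
    proof -
      have P1: "q * (ln K - 4 * J) < log_energy g \<xi>"
        using that(1) q J by (simp add: P_def field_simps)
      have "\<exists>u\<in>A. ln K - 4 * J < ln (\<xi> u)"
      proof (rule ccontr)
        assume *: "\<not> ?thesis"
        have "log_energy g \<xi> \<le> q * (ln K - 4 * J)"
          unfolding log_energy_def q_def sqnorm_def sum_distrib_right
        proof (rule sum_mono)
          fix u assume "u \<in> {..<n}"
          then show "(g u)\<^sup>2 * ln (\<xi> u) \<le> (g u)\<^sup>2 * (ln K - 4 * J)"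
          proof (cases "g u = 0")
            case False
            then have "ln (\<xi> u) \<le> ln K - 4 * J"
              using * \<open>u \<in> {..<n}\<close> by (simp add: A_def not_less) (metis not_le)
            then show ?thesis by (rule mult_left_mono) simp
          qed simp
        qed
        with P1 show False by simp
      qed
      then obtain u where u: "u < n" "g u \<noteq> 0" "ln K - 4 * J < ln (\<xi> u)" by (auto simp: A_def)
      then have "0 < \<xi> u" using \<xi> by (auto simp: I_def positive_on_support_def)
      then have "exp (ln K - 4 * J) \<le> \<xi> u" using u(3) by (metis exp_le_cancel_iff exp_ln less_imp_le)
      moreover have "exp (ln K - 4 * J) = K * exp (- 4 * J)"
        using K by (simp add: exp_diff exp_minus divide_inverse)
      ultimately have big: "K * exp (- 4 * J) \<le> \<xi> u" by simp
      have "\<exists>w<n. \<xi> w \<le> 4 * K * a / n"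
      proof (rule ccontr)
        assume *: "\<not> ?thesis"
        have "(\<Sum>w<n. 4 * K * a / n) \<le> lin (\<lambda>_. 1) \<xi>"
          unfolding lin_def by (rule sum_mono) (use * in force)
        then have "4 * K * a \<le> lin (\<lambda>_. 1) \<xi>" using n_pos by simp
        then show False using that(2) K a by (simp add: Q_def)
      qed
      then obtain w where w: "w < n" "\<xi> w \<le> 4 * K * a / n" by blast
      have "K * (exp (- 4 * J) - 4 * a / n) \<le> \<xi> u - \<xi> w"
        using big w(2) by (simp add: algebra_simps)
      then show ?thesis using u(1) w(1) by (auto simp: H_def apart_def)
    qed
    then show ?thesis
    proof (cases "P < 1 \<and> Q < 1")
      case True
      then show ?thesis unfolding lhs using P Q \<open>P < 1 \<Longrightarrow> Q < 1 \<Longrightarrow> \<xi> \<in> H\<close> by simp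
    next
      case False
      then have "1 - P - Q \<le> 0" using P Q by linarith
      then show ?thesis unfolding lhs by (rule order_trans) (rule indicator_pos_le)
    qed
  qed
  have "1 / 2 = (1 - ln K / (4 * J)) + 1 / (4 * q * J) * (q * ln K - q * J) + (- (1 / (4 * K * a))) * (K * a)"
    using q J K a by (simp add: field_simps)
  also have "\<dots> \<le> (1 - ln K / (4 * J)) + 1 / (4 * q * J) * expect t (log_energy g) \<xi>0
      + (- (1 / (4 * K * a))) * expect t (lin (\<lambda>_. 1)) \<xi>0"
    unfolding E2 using E1 q J by (intro add_mono mult_left_mono order_refl) auto
  also have "\<dots> = expect t (\<lambda>\<xi>. (1 - ln K / (4 * J)) + 1 / (4 * q * J) * log_energy g \<xi>
      + (- (1 / (4 * K * a))) * lin (\<lambda>_. 1) \<xi>) \<xi>0"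
    by (rule expect_affine[symmetric])
  also have "\<dots> \<le> expect t (indicator H) \<xi>0"
    by (rule expect_mono_on[where I = I]) (use H \<xi>0 positive_on_support_step in \<open>auto simp: I_def\<close>)
  finally show ?thesis by (simp add: H_def a_def A_def \<xi>0_def)
qed

end

section \<open>Starting from a flat vector\<close>

context connected_ugraph
begin

lemma lambda2_gap_vector: "u < n \<Longrightarrow> lap gap_vector u = lambda2 G * gap_vector u"
  by (simp add: lap_gap_vector lambda2_eq_gap)

lemma sqnorm_gap_vector: "sqnorm gap_vector = 1"
  by (simp add: sqnorm_def norm_gap_vector)

lemma dirichlet_eigenvector:
  assumes "\<And>u. u < n \<Longrightarrow> lap f u = \<kappa> * f u"
  shows "dirichlet f g = \<kappa> * lin g f"
  unfolding dirichlet_lap lin_def sum_distrib_left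
  by (rule sum.cong) (simp_all add: assms mult.left_commute mult.commute)

lemma abs_lin_le: "\<bar>lin g f\<bar> \<le> sqrt (sqnorm g) * sqrt (sqnorm f)"
proof -
  have "(lin g f)\<^sup>2 \<le> sqnorm g * sqnorm f"
    unfolding lin_def sqnorm_def by (rule Cauchy_Schwarz_ineq_sum)
  then have "sqrt ((lin g f)\<^sup>2) \<le> sqrt (sqnorm g * sqnorm f)" by (rule real_sqrt_le_mono)
  then show ?thesis by (simp add: real_sqrt_mult)
qed

lemma dirichlet_gap_vector: "dirichlet gap_vector g = lambda2 G * lin g gap_vector"
  by (rule dirichlet_eigenvector) (rule lambda2_gap_vector)

definition excess :: "real \<Rightarrow> (nat \<Rightarrow> real) \<Rightarrow> nat \<Rightarrow> real" where
  "excess \<theta> f u = max (f u - \<theta>) 0"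

text \<open>
  Cutting at a level is monotone and 1-Lipschitz, so it can only shrink the increments along edges without
  changing their signs.
\<close>

lemma dirichlet_excess_le: "dirichlet (excess \<theta> f) (excess \<theta> f) \<le> dirichlet f (excess \<theta> f)"
proof -
  have "(excess \<theta> f u - excess \<theta> f v) * (excess \<theta> f u - excess \<theta> f v)
      \<le> (f u - f v) * (excess \<theta> f u - excess \<theta> f v)" for u v
  proof (cases "f u \<le> f v")
    case True
    then have "f u - f v \<le> excess \<theta> f u - excess \<theta> f v" "excess \<theta> f u - excess \<theta> f v \<le> 0"
      by (auto simp: excess_def)
    then show ?thesis by (rule mult_right_mono_neg)
  next
    case False
    then have "excess \<theta> f u - excess \<theta> f v \<le> f u - f v" "0 \<le> excess \<theta> f u - excess \<theta> f v"
      by (auto simp: excess_def)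
    then show ?thesis by (rule mult_right_mono)
  qed
  then show ?thesis
    unfolding dirichlet_def by (intro divide_right_mono sum_mono) auto
qed

text \<open>
  By the eigenvector equation and the Cauchy-Schwarz inequality, the Dirichlet form of the excess is at most
  \<open>\<lambda>\<^sub>2\<close> times its norm; a norm of at least \<open>1/4\<close> is at most 4 times its square.
\<close>

lemma dirichlet_excess_eigenvector:
  assumes eig: "\<And>u. u < n \<Longrightarrow> lap f u = lambda2 G * f u" and f: "sqnorm f = 1"
    and large: "1 / 16 \<le> sqnorm (excess \<theta> f)"
  shows "dirichlet (excess \<theta> f) (excess \<theta> f) \<le> 4 * lambda2 G * sqnorm (excess \<theta> f)"
proof -
  define s where "s = sqrt (sqnorm (excess \<theta> f))"
  have s2: "s * s = sqnorm (excess \<theta> f)" using sqnorm_nonneg by (simp add: s_def)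
  have s: "1 / 4 \<le> s"
    unfolding s_def using large by (intro real_le_rsqrt) (simp add: power2_eq_square)
  have "dirichlet (excess \<theta> f) (excess \<theta> f) \<le> lambda2 G * lin (excess \<theta> f) f"
    using dirichlet_excess_le[of \<theta> f] by (simp add: dirichlet_eigenvector[OF eig])
  also have "\<dots> \<le> lambda2 G * s"
    using abs_lin_le[of "excess \<theta> f" f] lambda2_pos by (intro mult_left_mono) (auto simp: f s_def)
  also have "\<dots> \<le> lambda2 G * (4 * s * s)"
    using s lambda2_pos by (intro mult_left_mono) auto
  finally show ?thesis by (simp add: s2[symmetric] mult_ac)
qed

lemma card_support_excess:
  fixes \<theta> :: real
  assumes \<theta>: "0 < \<theta>" and f: "sqnorm f = 1"
  shows "card {u. u < n \<and> excess \<theta> f u \<noteq> 0} * \<theta>\<^sup>2 \<le> 1"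
proof -
  let ?A = "{u. u < n \<and> excess \<theta> f u \<noteq> 0}"
  have "(\<Sum>u\<in>?A. \<theta>\<^sup>2) \<le> (\<Sum>u\<in>?A. (f u)\<^sup>2)"
    by (intro sum_mono power_mono) (use \<theta> in \<open>auto simp: excess_def max_def split: if_splits\<close>)
  also have "\<dots> \<le> sqnorm f"
    unfolding sqnorm_def by (rule sum_mono2) auto
  finally show ?thesis by (simp add: f)
qed

text \<open>
  \<open>f\<close> truncated to the interval \<open>[-\<theta>, \<theta>]\<close>.
\<close>

definition clip :: "real \<Rightarrow> (nat \<Rightarrow> real) \<Rightarrow> nat \<Rightarrow> real" where
  "clip \<theta> f u = f u - excess \<theta> f u + excess \<theta> (\<lambda>v. - f v) u"

lemma abs_clip_le: "0 \<le> \<theta> \<Longrightarrow> \<bar>clip \<theta> f u\<bar> \<le> \<theta>"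
  by (auto simp: clip_def excess_def)

lemma lin_clip:
  "lin (clip \<theta> f) f = sqnorm f - lin (excess \<theta> f) f + lin (excess \<theta> (\<lambda>v. - f v)) f"
  unfolding lin_def sqnorm_def clip_def sum_subtractf[symmetric] sum.distrib[symmetric]
  by (rule sum.cong) (simp_all add: algebra_simps power2_eq_square)

text \<open>
  The clipped eigenvector, recentred to have sum 0. Recentring does not change the inner product
  with an eigenvector orthogonal to the constants, and clipping changes it by at most \<open>1/4 + 1/4\<close>.
\<close>

lemma spread_test_vector:
  assumes \<theta>: "0 \<le> \<theta>"
    and small: "sqnorm (excess \<theta> gap_vector) < 1 / 16"
      "sqnorm (excess \<theta> (\<lambda>v. - gap_vector v)) < 1 / 16"
  obtains g where "(\<Sum>u<n. g u) = 0" "\<And>u. u < n \<Longrightarrow> \<bar>g u\<bar> \<le> 2 * \<theta>" "1 / 2 \<le> lin g gap_vector"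
proof -
  let ?f = gap_vector
  define c where "c = (\<Sum>u<n. clip \<theta> ?f u) / n"
  define g where "g = (\<lambda>u. clip \<theta> ?f u - c)"
  have "\<bar>c\<bar> \<le> (\<Sum>u<n. \<bar>clip \<theta> ?f u\<bar>) / n"
    unfolding c_def using n_pos by (simp add: divide_right_mono sum_abs)
  also have "\<dots> \<le> (\<Sum>u<n. \<theta>) / n"
    by (intro divide_right_mono sum_mono abs_clip_le \<theta>) simp
  also have "\<dots> = \<theta>" using n_pos by simp
  finally have c: "\<bar>c\<bar> \<le> \<theta>" .
  have quarter: "\<bar>lin h ?f\<bar> \<le> 1 / 4" if "sqnorm h < 1 / 16" for h
  proof -
    have "\<bar>lin h ?f\<bar> \<le> sqrt (sqnorm h)" using abs_lin_le[of h ?f] by (simp add: sqnorm_gap_vector)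
    also have "\<dots> \<le> 1 / 4" using that by (intro real_le_lsqrt) (auto simp: power2_eq_square)
    finally show ?thesis .
  qed
  have "lin g ?f = lin (clip \<theta> ?f) ?f - c * (\<Sum>u<n. ?f u)"
    unfolding lin_def g_def sum_distrib_left sum_subtractf[symmetric]
    by (rule sum.cong) (simp_all add: algebra_simps)
  then have "lin g ?f = 1 - lin (excess \<theta> ?f) ?f + lin (excess \<theta> (\<lambda>v. - ?f v)) ?f"
    by (simp add: sum_gap_vector lin_clip sqnorm_gap_vector)
  then have "1 / 2 \<le> lin g ?f" using quarter[OF small(1)] quarter[OF small(2)] by linarith
  moreover have "(\<Sum>u<n. g u) = 0" using n_pos by (simp add: g_def sum_subtractf c_def)
  moreover have "\<bar>g u\<bar> \<le> 2 * \<theta>" for u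
    using abs_clip_le[OF \<theta>, of ?f u] c unfolding g_def by linarith
  ultimately show ?thesis using that by blast
qed

lemma card_E_le: "2 * m \<le> (real n)\<^sup>2"
proof -
  have "E \<subseteq> {..<n} \<times> {..<n}" using E_lt by auto
  then have "card E \<le> card ({..<n} \<times> {..<n})" by (intro card_mono) auto
  then have "real (card E) \<le> real (n * n)" by (simp add: card_cartesian_product del: of_nat_mult)
  then show ?thesis by (simp add: card_E power2_eq_square)
qed

lemma one_le_deg: "u < n \<Longrightarrow> 1 \<le> deg u"
proof (rule ccontr)
  assume u: "u < n" and "\<not> 1 \<le> deg u"
  then have "deg u = 0" by simp
  then have "{v. (u, v) \<in> E} = {}" by (simp add: deg_eq)
  then have no: "(u, v) \<notin> E" "(v, u) \<notin> E" for v using E_sym by auto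
  define w where "w = (if u = 0 then 1 else 0 :: nat)"
  have "w < n" "w \<noteq> u" using two_le_n by (auto simp: w_def)
  have "(\<lambda>v. v = u) u = (\<lambda>v. v = u) w"
    by (rule constant_of_edgewise_equal[OF _ u \<open>w < n\<close>]) (use no in metis)
  with \<open>w \<noteq> u\<close> show False by simp
qed

text \<open>
  Every degree is at least 1, so each node weight is at least \<open>1/(2m) \<ge> 1/n\<^sup>2\<close>, and the potential
  is the weighted variance of the node values.
\<close>

lemma small_potential_narrow:
  assumes "potential G \<xi> \<le> \<epsilon>" "0 \<le> \<epsilon>"
  obtains c where "\<And>u. u < n \<Longrightarrow> c - n * sqrt \<epsilon> \<le> \<xi> u \<and> \<xi> u \<le> c + n * sqrt \<epsilon>"
proof -
  let ?w = "node_weight G"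
  define c where "c = (\<Sum>u<n. ?w u * \<xi> u)"
  have w0: "(\<Sum>u<n. ?w u * (\<xi> u - c)) = 0"
    by (simp add: right_diff_distrib sum_subtractf sum_distrib_right[symmetric] sum_node_weight)
      (simp add: c_def)
  have "c - n * sqrt \<epsilon> \<le> \<xi> u \<and> \<xi> u \<le> c + n * sqrt \<epsilon>" if u: "u < n" for u
  proof -
    have "1 / (2 * m) * (\<xi> u - c)\<^sup>2 \<le> ?w u * (\<xi> u - c)\<^sup>2"
      unfolding node_weight_eq using one_le_deg[OF u] m_pos by (intro mult_right_mono divide_right_mono) auto
    also have "\<dots> \<le> (\<Sum>u<n. ?w u * (\<xi> u - c)\<^sup>2)"
      by (rule member_le_sum) (use u in \<open>auto simp: node_weight_eq\<close>)
    also have "\<dots> = potential G \<xi>" unfolding potential_shift[of \<xi> c] w0 by simp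
    also have "\<dots> \<le> \<epsilon>" by (rule assms(1))
    finally have "(\<xi> u - c)\<^sup>2 \<le> 2 * m * \<epsilon>" using m_pos by (simp add: field_simps)
    also have "\<dots> \<le> (real n)\<^sup>2 * \<epsilon>" using card_E_le assms(2) by (intro mult_right_mono) auto
    also have "\<dots> = (n * sqrt \<epsilon>)\<^sup>2" using assms(2) by (simp add: power_mult_distrib)
    finally have "\<bar>\<xi> u - c\<bar> \<le> n * sqrt \<epsilon>"
      using n_pos assms(2) by (intro power2_le_imp_le[of "\<bar>\<xi> u - c\<bar>"]) auto
    then show ?thesis by linarith
  qed
  then show ?thesis using that by blast
qed

end

context edge_process
begin

text \<open>
  The heat flow \<open>I - \<beta> L / 2m\<close>. It is a symmetric stochastic matrix, so it contracts the supremum norm.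
\<close>

definition diffuse :: "(nat \<Rightarrow> real) \<Rightarrow> nat \<Rightarrow> real" where
  "diffuse g u = g u - \<beta> / (2 * m) * lap g u"

lemma lin_diffuse: "lin (diffuse g) \<xi> = lin g \<xi> - \<beta> / (2 * m) * dirichlet \<xi> g"
proof -
  have "dirichlet \<xi> g = (\<Sum>u<n. lap g u * \<xi> u)"
    by (subst dirichlet_sym) (rule dirichlet_lap)
  then show ?thesis
    unfolding lin_def diffuse_def by (simp add: sum_distrib_left sum_subtractf left_diff_distrib mult.assoc)
qed

lemma mean_lin_eq: "mean_step (lin g) = lin (diffuse g)"
  by (rule ext) (simp only: mean_lin lin_diffuse)

lemma expect_lin: "expect t (lin g) \<xi> = lin ((diffuse ^^ t) g) \<xi>"
proof (induction t arbitrary: g)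
  case (Suc t)
  show ?case unfolding expect_Suc' mean_lin_eq Suc.IH by (simp add: funpow_swap1)
qed simp

lemma diffuse_contracts:
  assumes g: "\<And>u. u < n \<Longrightarrow> \<bar>g u\<bar> \<le> \<theta>" and u: "u < n"
  shows "\<bar>diffuse g u\<bar> \<le> \<theta>"
proof -
  define r where "r = \<beta> / (2 * m)"
  have r: "0 \<le> r" using \<beta>_pos m_pos by (simp add: r_def)
  have "r * deg u \<le> r * (2 * m)" using deg_le[OF u] r by (rule mult_left_mono)
  also have "\<dots> = \<beta>" using m_pos by (simp add: r_def)
  finally have rd: "r * deg u \<le> 1" using \<alpha>_pos by simp
  have "diffuse g u = (1 - r * deg u) * g u + r * (\<Sum>v | (u, v) \<in> E. g v)"
    unfolding diffuse_def lap_eq[OF u] r_def[symmetric] by (simp add: algebra_simps)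
  also have "\<bar>\<dots>\<bar> \<le> \<bar>(1 - r * deg u) * g u\<bar> + \<bar>r * (\<Sum>v | (u, v) \<in> E. g v)\<bar>"
    by (rule abs_triangle_ineq)
  also have "\<dots> \<le> (1 - r * deg u) * \<theta> + r * (\<Sum>v | (u, v) \<in> E. \<theta>)"
  proof (intro add_mono)
    show "\<bar>(1 - r * deg u) * g u\<bar> \<le> (1 - r * deg u) * \<theta>"
      using rd g[OF u] by (simp add: abs_mult mult_left_mono)
    have "\<bar>\<Sum>v | (u, v) \<in> E. g v\<bar> \<le> (\<Sum>v | (u, v) \<in> E. \<theta>)"
      by (intro order_trans[OF sum_abs] sum_mono g) (auto dest: E_lt)
    then show "\<bar>r * (\<Sum>v | (u, v) \<in> E. g v)\<bar> \<le> r * (\<Sum>v | (u, v) \<in> E. \<theta>)"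
      using r by (simp add: abs_mult mult_left_mono)
  qed
  also have "\<dots> = \<theta>" by (simp add: deg_eq algebra_simps)
  finally show ?thesis .
qed

text \<open>
  The variance of \<open>\<langle>g, \<xi>\<rangle>\<close> created in one step is at most \<open>\<beta>\<^sup>2 \<theta>\<^sup>2 D(\<xi>) / m\<close>. The term
  with \<open>\<parallel>\<xi>\<parallel>\<^sup>2\<close> pays for it, because \<open>\<parallel>\<xi>\<parallel>\<^sup>2\<close> loses \<open>\<alpha> \<beta> D(\<xi>) / m\<close> in the same step.
\<close>

lemma mean_second_moment_le:
  assumes g: "\<And>u. u < n \<Longrightarrow> \<bar>g u\<bar> \<le> \<theta>" and \<theta>: "0 \<le> \<theta>"
  shows "mean_step (\<lambda>\<xi>. (lin g \<xi>)\<^sup>2 + \<beta> * \<theta>\<^sup>2 / \<alpha> * sqnorm \<xi>) \<xi>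
    \<le> (lin (diffuse g) \<xi>)\<^sup>2 + \<beta> * \<theta>\<^sup>2 / \<alpha> * sqnorm \<xi>"
proof -
  let ?\<kappa> = "\<beta> * \<theta>\<^sup>2 / \<alpha>" and ?X = "lin g \<xi>" and ?D = "dirichlet \<xi> g"
  have "(\<Sum>(u, v)\<in>E. (g u)\<^sup>2 * (\<xi> u - \<xi> v)\<^sup>2) \<le> (\<Sum>(u, v)\<in>E. \<theta>\<^sup>2 * (\<xi> u - \<xi> v)\<^sup>2)"
  proof (rule sum_mono, clarify)
    fix u v assume "(u, v) \<in> E"
    then have "\<bar>g u\<bar>\<^sup>2 \<le> \<theta>\<^sup>2" using g E_lt by (intro power_mono) auto
    then show "(g u)\<^sup>2 * (\<xi> u - \<xi> v)\<^sup>2 \<le> \<theta>\<^sup>2 * (\<xi> u - \<xi> v)\<^sup>2" by (intro mult_right_mono) auto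
  qed
  also have "\<dots> = \<theta>\<^sup>2 * (2 * dirichlet \<xi> \<xi>)"
    unfolding edge_square_sum[symmetric] case_prod_unfold sum_distrib_left ..
  finally have "\<beta>\<^sup>2 / (2 * m) * (\<Sum>(u, v)\<in>E. (g u)\<^sup>2 * (\<xi> u - \<xi> v)\<^sup>2)
      \<le> \<beta>\<^sup>2 / (2 * m) * (\<theta>\<^sup>2 * (2 * dirichlet \<xi> \<xi>))"
    using m_pos by (intro mult_left_mono) auto
  also have "\<dots> = ?\<kappa> * (\<alpha> * \<beta> / m * dirichlet \<xi> \<xi>)"
    using \<alpha>_pos by (simp add: power2_eq_square)
  finally have noise: "\<beta>\<^sup>2 / (2 * m) * (\<Sum>(u, v)\<in>E. (g u)\<^sup>2 * (\<xi> u - \<xi> v)\<^sup>2)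
      \<le> ?\<kappa> * (\<alpha> * \<beta> / m * dirichlet \<xi> \<xi>)" .
  have "mean_step (\<lambda>\<xi>. 1 * (lin g \<xi>)\<^sup>2 + ?\<kappa> * sqnorm \<xi>) \<xi>
      = 1 * mean_step (\<lambda>\<xi>. (lin g \<xi>)\<^sup>2) \<xi> + ?\<kappa> * mean_step sqnorm \<xi>"
    by (rule mean_step_linear)
  also have "\<dots> \<le> ?X\<^sup>2 - \<beta> / m * ?X * ?D + ?\<kappa> * sqnorm \<xi>"
  proof -
    have "1 * (a + b) + (c - d) \<le> a + c" if "b \<le> d" for a b c d :: real using that by simp
    from this[OF noise] show ?thesis
      unfolding mean_lin_square mean_sqnorm right_diff_distrib[of ?\<kappa>] .
  qed
  also have "?X\<^sup>2 - \<beta> / m * ?X * ?D \<le> (?X - \<beta> / (2 * m) * ?D)\<^sup>2"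
  proof -
    have complete: "a\<^sup>2 - c \<le> (a - b)\<^sup>2" if "2 * a * b = c" for a b c :: real
      unfolding power2_diff that by simp
    show ?thesis by (rule complete) simp
  qed
  finally show ?thesis by (simp add: lin_diffuse)
qed

lemma expect_second_moment_le:
  assumes "\<And>u. u < n \<Longrightarrow> \<bar>g u\<bar> \<le> \<theta>" and \<theta>: "0 \<le> \<theta>"
  shows "expect t (\<lambda>\<xi>. (lin g \<xi>)\<^sup>2 + \<beta> * \<theta>\<^sup>2 / \<alpha> * sqnorm \<xi>) \<xi>
    \<le> (lin ((diffuse ^^ t) g) \<xi>)\<^sup>2 + \<beta> * \<theta>\<^sup>2 / \<alpha> * sqnorm \<xi>"
  using assms(1)
proof (induction t arbitrary: g)
  case (Suc t)
  have "expect (Suc t) (\<lambda>\<xi>. (lin g \<xi>)\<^sup>2 + \<beta> * \<theta>\<^sup>2 / \<alpha> * sqnorm \<xi>) \<xi>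
      \<le> expect t (\<lambda>\<xi>. (lin (diffuse g) \<xi>)\<^sup>2 + \<beta> * \<theta>\<^sup>2 / \<alpha> * sqnorm \<xi>) \<xi>"
    unfolding expect_Suc' by (rule expect_mono) (rule mean_second_moment_le[OF Suc.prems \<theta>])
  also have "\<dots> \<le> (lin ((diffuse ^^ t) (diffuse g)) \<xi>)\<^sup>2 + \<beta> * \<theta>\<^sup>2 / \<alpha> * sqnorm \<xi>"
    by (rule Suc.IH) (rule diffuse_contracts[OF Suc.prems])
  finally show ?case by (simp add: funpow_swap1)
qed simp

lemma lin_diffuse_gap_vector:
  "lin ((diffuse ^^ t) g) (\<lambda>u. K * gap_vector u)
    = K * (1 - \<beta> * lambda2 G / (2 * m)) ^ t * lin g gap_vector"
proof (induction t arbitrary: g)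
  case 0
  show ?case by (simp add: lin_def sum_distrib_left mult.left_commute)
next
  case (Suc t)
  have "lin (diffuse g) gap_vector = (1 - \<beta> * lambda2 G / (2 * m)) * lin g gap_vector"
    unfolding lin_diffuse dirichlet_gap_vector by (simp add: algebra_simps)
  then show ?case using Suc.IH[of "diffuse g"] by (simp add: funpow_swap1)
qed

text \<open>
  Chebyshev's inequality for \<open>\<langle>g, \<xi>\<rangle>\<close>, whose mean at time \<open>t\<close> is \<open>\<mu>\<close> and whose variance is at most
  \<open>(\<beta> \<theta>\<^sup>2 / \<alpha>) K\<^sup>2\<close>: the functional exceeds \<open>\<mu>/2\<close> with the stated probability. Since \<open>g\<close> has sum 0
  and entries of size at most 1, it could not exceed \<open>\<mu>/4\<close> if all values were within \<open>\<mu>/(4n)\<close> of that at node 0.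
\<close>

lemma spread_start_stays_apart:
  assumes g0: "(\<Sum>u<n. g u) = 0" and g: "\<And>u. u < n \<Longrightarrow> \<bar>g u\<bar> \<le> \<theta>" and \<theta>: "0 \<le> \<theta>" "\<theta> \<le> 1"
    and \<mu>: "\<mu> = K * (1 - \<beta> * lambda2 G / (2 * m)) ^ t * lin g gap_vector" "0 < \<mu>"
  shows "1 - 4 * (\<beta> * \<theta>\<^sup>2 / \<alpha> * K\<^sup>2) / \<mu>\<^sup>2
    \<le> expect t (indicator (apart (\<mu> / (4 * n)))) (\<lambda>u. K * gap_vector u)"
proof -
  let ?\<xi> = "\<lambda>u. K * gap_vector u" and ?\<kappa> = "\<beta> * \<theta>\<^sup>2 / \<alpha>"
  have \<kappa>: "0 \<le> ?\<kappa>" using \<alpha>_pos \<beta>_pos by simp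
  have sq: "sqnorm ?\<xi> = K\<^sup>2"
    unfolding sqnorm_def power_mult_distrib sum_distrib_left[symmetric] norm_gap_vector by simp
  have E1: "expect t (lin g) ?\<xi> = \<mu>"
    unfolding expect_lin lin_diffuse_gap_vector \<mu>(1) ..
  have "expect t (\<lambda>\<xi>. (lin g \<xi>)\<^sup>2) ?\<xi> \<le> expect t (\<lambda>\<xi>. (lin g \<xi>)\<^sup>2 + ?\<kappa> * sqnorm \<xi>) ?\<xi>"
    by (rule expect_mono) (use mult_nonneg_nonneg[OF \<kappa> sqnorm_nonneg] in simp)
  also have "\<dots> \<le> (lin ((diffuse ^^ t) g) ?\<xi>)\<^sup>2 + ?\<kappa> * sqnorm ?\<xi>"
    by (rule expect_second_moment_le[OF g \<theta>(1)])
  finally have E2: "expect t (\<lambda>\<xi>. (lin g \<xi>)\<^sup>2) ?\<xi> \<le> \<mu>\<^sup>2 + ?\<kappa> * K\<^sup>2"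
    unfolding lin_diffuse_gap_vector \<mu>(1)[symmetric] sq .
  have "1 - 4 * (\<beta> * \<theta>\<^sup>2 / \<alpha> * K\<^sup>2) / \<mu>\<^sup>2 = - 3 + (- 4 / \<mu>\<^sup>2) * (\<mu>\<^sup>2 + ?\<kappa> * K\<^sup>2) + 8 / \<mu> * \<mu>"
  proof -
    have "1 - 4 * x / \<mu>\<^sup>2 = - 3 + (- 4 / \<mu>\<^sup>2) * (\<mu>\<^sup>2 + x) + 8 / \<mu> * \<mu>" for x
      using \<mu>(2) by (simp add: field_simps power2_eq_square)
    then show ?thesis .
  qed
  also have "\<dots> \<le> - 3 + (- 4 / \<mu>\<^sup>2) * expect t (\<lambda>\<xi>. (lin g \<xi>)\<^sup>2) ?\<xi> + 8 / \<mu> * expect t (lin g) ?\<xi>"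
    unfolding E1 using mult_left_mono_neg[OF E2, of "- 4 / \<mu>\<^sup>2"] by simp
  also have "\<dots> = expect t (\<lambda>\<xi>. - 3 + (- 4 / \<mu>\<^sup>2) * (lin g \<xi>)\<^sup>2 + 8 / \<mu> * lin g \<xi>) ?\<xi>"
    by (rule expect_affine[symmetric])
  also have "\<dots> \<le> expect t (indicator (apart (\<mu> / (4 * n)))) ?\<xi>"
  proof (rule expect_mono)
    fix \<xi>
    \<comment> \<open>The lower bound of the indicator in Chebyshev's inequality, expanded so that \<open>expect_affine\<close> applies.\<close>
    have lhs: "- 3 + (- 4 / \<mu>\<^sup>2) * (lin g \<xi>)\<^sup>2 + 8 / \<mu> * lin g \<xi> = 1 - 4 * (lin g \<xi> / \<mu> - 1)\<^sup>2"
      using \<mu>(2) by (simp add: field_simps power2_eq_square)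
    show "- 3 + (- 4 / \<mu>\<^sup>2) * (lin g \<xi>)\<^sup>2 + 8 / \<mu> * lin g \<xi> \<le> indicator (apart (\<mu> / (4 * n))) \<xi>"
    proof (cases "\<xi> \<in> apart (\<mu> / (4 * n))")
      case True
      then show ?thesis unfolding lhs by simp
    next
      case False
      have close: "\<bar>\<xi> u - \<xi> 0\<bar> \<le> \<mu> / (4 * n)" if "u < n" for u
        using False that two_le_n by (force simp: apart_def abs_le_iff not_le)
      have "lin g \<xi> = (\<Sum>u<n. g u * (\<xi> u - \<xi> 0))"
        using g0 by (simp add: lin_def right_diff_distrib sum_subtractf sum_distrib_right[symmetric])
      also have "\<dots> \<le> (\<Sum>u<n. 1 * (\<mu> / (4 * n)))"
      proof (rule sum_mono)
        fix u assume u: "u \<in> {..<n}"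
        have "g u * (\<xi> u - \<xi> 0) \<le> \<bar>g u\<bar> * \<bar>\<xi> u - \<xi> 0\<bar>" by (metis abs_ge_self abs_mult)
        also have "\<dots> \<le> 1 * (\<mu> / (4 * n))"
          using g[of u] close[of u] u \<theta> by (intro mult_mono) auto
        finally show "g u * (\<xi> u - \<xi> 0) \<le> 1 * (\<mu> / (4 * n))" .
      qed
      also have "\<dots> = \<mu> / 4" using n_pos by simp
      finally have "lin g \<xi> / \<mu> \<le> 1 / 4" using \<mu>(2) by (simp add: field_simps)
      then have "1 / 2 \<le> 1 - lin g \<xi> / \<mu>" by linarith
      then have "(1 / 2)\<^sup>2 \<le> (1 - lin g \<xi> / \<mu>)\<^sup>2" by (rule power_mono) simp
      then have "1 - 4 * (lin g \<xi> / \<mu> - 1)\<^sup>2 \<le> 0"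
        by (simp add: power2_commute[of 1] power_divide)
      then show ?thesis unfolding lhs using False by simp
    qed
  qed
  finally show ?thesis .
qed

text \<open>
  If the potential had dropped to \<open>\<epsilon>\<close> by time \<open>t\<close>, the values would be confined from then on to an
  interval of length \<open>2 n \<surd>\<epsilon>\<close>. So the hitting time exceeds \<open>t\<close> whenever two values are further
  apart at time \<open>t\<close>.
\<close>

lemma expected_hitting_time_ge:
  assumes apart: "p \<le> expect t (indicator (apart d)) \<xi>" and d: "2 * n * sqrt \<epsilon> < d" and \<epsilon>: "0 \<le> \<epsilon>"
  shows "ennreal (real (Suc t) * p) \<le> (\<integral>\<^sup>+ \<omega>. ennreal_of_enat (hitting_time G \<alpha> \<xi> \<epsilon> \<omega>) \<partial>\<Omega>)"
proof -
  interpret prob_space \<Omega> by (rule prob_space_\<Omega>)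
  let ?A = "{\<omega>. edge_model \<alpha> \<xi> t \<omega> \<in> apart d}"
  have "AE \<omega> in \<Omega>. ennreal (real (Suc t)) * indicator ?A \<omega> \<le> ennreal_of_enat (hitting_time G \<alpha> \<xi> \<epsilon> \<omega>)"
    using AE_edges
  proof eventually_elim
    case (elim \<omega>)
    show ?case
    proof (cases "\<omega> \<in> ?A")
      case True
      then obtain u v where uv: "u < n" "v < n" "d \<le> edge_model \<alpha> \<xi> t \<omega> u - edge_model \<alpha> \<xi> t \<omega> v"
        by (auto simp: apart_def)
      have "\<not> hitting_time G \<alpha> \<xi> \<epsilon> \<omega> \<le> enat t"
      proof
        assume "hitting_time G \<alpha> \<xi> \<epsilon> \<omega> \<le> enat t"
        then obtain s where s: "s \<le> t" "potential G (edge_model \<alpha> \<xi> s \<omega>) \<le> \<epsilon>"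
          by (auto simp: hitting_time_le_iff)
        obtain c where c: "\<And>u. u < n \<Longrightarrow> c - n * sqrt \<epsilon> \<le> edge_model \<alpha> \<xi> s \<omega> u
            \<and> edge_model \<alpha> \<xi> s \<omega> u \<le> c + n * sqrt \<epsilon>"
          using small_potential_narrow[OF s(2) \<epsilon>] by blast
        have "c - n * sqrt \<epsilon> \<le> edge_model \<alpha> \<xi> t \<omega> w \<and> edge_model \<alpha> \<xi> t \<omega> w \<le> c + n * sqrt \<epsilon>"
          if "w < n" for w
          by (rule edge_model_between[where s = s]) (use elim c s(1) that in auto)
        from this[OF uv(1)] this[OF uv(2)] uv(3) d show False by linarith
      qed
      then have "enat (Suc t) \<le> hitting_time G \<alpha> \<xi> \<epsilon> \<omega>"
        by (metis Suc_ile_eq not_le)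
      then have "ennreal_of_enat (enat (Suc t)) \<le> ennreal_of_enat (hitting_time G \<alpha> \<xi> \<epsilon> \<omega>)"
        by (simp only: ennreal_of_enat_le_iff)
      then show ?thesis using True by (simp add: ennreal_of_nat_eq_real_of_nat)
    qed simp
  qed
  then have mono: "(\<integral>\<^sup>+ \<omega>. ennreal (real (Suc t)) * indicator ?A \<omega> \<partial>\<Omega>)
      \<le> (\<integral>\<^sup>+ \<omega>. ennreal_of_enat (hitting_time G \<alpha> \<xi> \<epsilon> \<omega>) \<partial>\<Omega>)"
    by (rule nn_integral_mono_AE)
  have "p \<le> measure \<Omega> ?A" unfolding prob_edge_model by (rule apart)
  then have "ennreal (real (Suc t) * p) \<le> ennreal (real (Suc t) * measure \<Omega> ?A)"
    by (intro ennreal_leI mult_left_mono) simp_all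
  also have "\<dots> = ennreal (real (Suc t)) * ennreal (measure \<Omega> ?A)"
    by (rule ennreal_mult) simp_all
  also have "\<dots> = (\<integral>\<^sup>+ \<omega>. ennreal (real (Suc t)) * indicator ?A \<omega> \<partial>\<Omega>)"
    by (subst nn_integral_cmult_indicator) (auto simp: emeasure_eq_measure)
  also note mono
  finally show ?thesis .
qed

end

section \<open>Starting vectors with slow convergence\<close>

context connected_ugraph
begin

text \<open>
  The height \<open>17 n\<^sup>3 \<surd>\<epsilon>\<close> is chosen such that \<open>K / (8 n\<^sup>2)\<close>, the distance that survives in
  \<open>localised_eigenvector_start\<close> and \<open>spread_eigenvector_start\<close>, exceeds the length \<open>2 n \<surd>\<epsilon>\<close> of the
  interval in \<open>small_potential_narrow\<close>.
\<close>

lemma time_bound_range: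
  fixes K :: real
  assumes \<epsilon>: "0 < \<epsilon>" and K: "K = 17 * real n ^ 3 * sqrt \<epsilon>"
    and lower: "K\<^sup>2 \<le> sqnorm \<xi>" and upper: "sqnorm \<xi> \<le> n * K\<^sup>2"
  shows "0 < time_bound G \<xi> \<epsilon>" "time_bound G \<xi> \<epsilon> \<le> m / lambda2 G * ln (289 * real n ^ 8)"
proof -
  have n1: "1 \<le> real n" using two_le_n by simp
  have K2: "K\<^sup>2 = 289 * real n ^ 6 * \<epsilon>"
    using \<epsilon> by (simp add: K power_mult_distrib power_mult[symmetric])
  have "1 * 1 \<le> real n * real n ^ 6" using n1 by (intro mult_mono one_le_power) auto
  then have "289 \<le> n * K\<^sup>2 / \<epsilon>" using \<epsilon> by (simp add: K2)
  also have "\<dots> \<le> n * sqnorm \<xi> / \<epsilon>" using lower \<epsilon> by (intro divide_right_mono mult_left_mono) auto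
  finally have big: "289 \<le> n * sqnorm \<xi> / \<epsilon>" .
  have "0 < K\<^sup>2" using n1 \<epsilon> by (simp add: K2)
  then have "0 < sqnorm \<xi>" using lower by (rule less_le_trans)
  moreover have "1 \<le> n * sqnorm \<xi> / \<epsilon>" using big by linarith
  ultimately have tb: "time_bound G \<xi> \<epsilon> = m / lambda2 G * ln (n * sqnorm \<xi> / \<epsilon>)"
    by (simp add: time_bound_eq)
  have ml: "0 < m / lambda2 G" using m_pos lambda2_pos by simp
  have "0 < ln (n * sqnorm \<xi> / \<epsilon>)" using big by (intro ln_gt_zero) linarith
  then show "0 < time_bound G \<xi> \<epsilon>" unfolding tb using ml by (rule mult_pos_pos[rotated])
  have "n * sqnorm \<xi> / \<epsilon> \<le> n * (n * K\<^sup>2) / \<epsilon>"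
    using upper \<epsilon> by (intro divide_right_mono mult_left_mono) auto
  also have "\<dots> = 289 * real n ^ 8" unfolding K2 using \<epsilon> by (simp add: power_numeral_reduce)
  finally have le: "n * sqnorm \<xi> / \<epsilon> \<le> 289 * real n ^ 8" .
  have "0 < n * sqnorm \<xi> / \<epsilon>" using big by linarith
  then have "ln (n * sqnorm \<xi> / \<epsilon>) \<le> ln (289 * real n ^ 8)"
    using le by (simp only: ln_mono)
  then show "time_bound G \<xi> \<epsilon> \<le> m / lambda2 G * ln (289 * real n ^ 8)"
    unfolding tb using ml by (intro mult_left_mono) auto
qed

end

context edge_process
begin

lemma expect_apart_mono:
  assumes "d \<le> d'"
  shows "expect t (indicator (apart d')) \<xi> \<le> expect t (indicator (apart d)) \<xi>"
proof (rule expect_mono)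
  fix x
  have "apart d' \<subseteq> apart d" using assms by (force simp: apart_def)
  then show "indicator (apart d') x \<le> (indicator (apart d) x :: real)"
    by (auto simp: indicator_def)
qed

text \<open>
  In \<open>localised_start_stays_apart\<close> the logarithmic loss is \<open>J = ln n / 16\<close>, so the maximum stays
  above \<open>K n powr (-1/4) = K / y\<close>, whereas some value is at most \<open>4 K \<surd>n / n = 4 K / y\<^sup>2\<close>. The constant 416 is
  \<open>16 * 26\<close>.
\<close>

lemma localised_eigenvector_start:
  fixes K :: real
  assumes eig: "\<And>u. u < n \<Longrightarrow> lap f u = lambda2 G * f u" and f: "sqnorm f = 1"
    and y: "128 \<le> y" "y ^ 4 = real n" and large: "1 / 16 \<le> sqnorm (excess (1 / y) f)"
    and t: "real t \<le> \<alpha> ^ 3 / 416 * ln n * m / lambda2 G" and K: "0 < K"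
  shows "\<exists>\<xi>. K\<^sup>2 \<le> sqnorm \<xi> \<and> sqnorm \<xi> \<le> n * K\<^sup>2
    \<and> 1 / 2 \<le> expect t (indicator (apart (K / (8 * (real n)\<^sup>2)))) \<xi>"
proof -
  define g where "g = excess (1 / y) f"
  define A where "A = {u. u < n \<and> g u \<noteq> 0}"
  define \<xi> where "\<xi> = (\<lambda>u. if g u \<noteq> 0 then K else 0)"
  define J where "J = ln (real n) / 16"
  have y0: "0 < y" using y by simp
  have "1 < real n" using two_le_n by simp
  then have J: "0 < J" by (simp add: J_def)
  have "real t * (26 / \<alpha> ^ 3 * lambda2 G / m)
      \<le> \<alpha> ^ 3 / 416 * ln n * m / lambda2 G * (26 / \<alpha> ^ 3 * lambda2 G / m)"
    using t \<alpha>_pos lambda2_pos m_pos by (intro mult_right_mono) auto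
  also have "\<dots> = J" using \<alpha>_pos lambda2_pos m_pos by (simp add: J_def)
  finally have tJ: "real t * (26 / \<alpha> ^ 3 * lambda2 G / m) \<le> J" .
  have half: "1 / 2 \<le> expect t (indicator (apart (K * (exp (- 4 * J) - 4 * real (card A) / n)))) \<xi>"
    unfolding A_def \<xi>_def
  proof (rule localised_start_stays_apart[OF _ _ _ K J tJ])
    show "dirichlet g g \<le> 4 * lambda2 G * sqnorm g"
      unfolding g_def by (rule dirichlet_excess_eigenvector[OF eig f large])
    show "0 < sqnorm g" using large by (simp add: g_def)
    show "0 \<le> g u" for u by (simp add: g_def excess_def)
  qed
  have "real (card A) * (1 / y)\<^sup>2 \<le> 1"
    using card_support_excess[of "1 / y" f] y0 f unfolding A_def g_def by simp
  then have cardA: "real (card A) \<le> y\<^sup>2" using y0 by (simp add: power_divide)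
  have "exp (- 4 * J) = 1 / y"
  proof -
    have "ln (real n) = 4 * ln y" using y0 unfolding y(2)[symmetric] by (simp add: ln_realpow)
    then have "- 4 * J = - ln y" by (simp add: J_def)
    then show ?thesis using y0 by (simp add: exp_minus divide_inverse)
  qed
  moreover have "1 / (8 * (real n)\<^sup>2) \<le> 1 / y - 4 * real (card A) / n"
  proof -
    have "4 * real (card A) / n \<le> 4 * y\<^sup>2 / y ^ 4"
      unfolding y(2)[symmetric] using cardA y0 by (intro divide_right_mono) auto
    also have "\<dots> = 4 / y\<^sup>2" using y0 by (simp add: field_simps power_numeral_reduce)
    finally have "(y - 4) / y\<^sup>2 \<le> 1 / y - 4 * real (card A) / n"
      using y0 by (simp add: diff_divide_distrib power2_eq_square)
    moreover have "1 / (8 * (real n)\<^sup>2) \<le> (y - 4) / y\<^sup>2"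
    proof -
      have "y\<^sup>2 * 1 \<le> y\<^sup>2 * y ^ 6" using y by (intro mult_left_mono one_le_power) auto
      also have "\<dots> = (real n)\<^sup>2"
        unfolding y(2)[symmetric] power_add[symmetric] power_mult[symmetric] by simp
      finally have "y\<^sup>2 \<le> 8 * (real n)\<^sup>2" using zero_le_power2[of "real n"] by linarith
      then show ?thesis using y y0 by (intro frac_le) auto
    qed
    ultimately show ?thesis by linarith
  qed
  ultimately have "K * (1 / (8 * (real n)\<^sup>2)) \<le> K * (exp (- 4 * J) - 4 * real (card A) / n)"
    using K by (intro mult_left_mono) auto
  then have "K / (8 * (real n)\<^sup>2) \<le> K * (exp (- 4 * J) - 4 * real (card A) / n)" by simp
  from order_trans[OF half expect_apart_mono[OF this]]
  have 1: "1 / 2 \<le> expect t (indicator (apart (K / (8 * (real n)\<^sup>2)))) \<xi>" .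
  have "sqnorm \<xi> = (\<Sum>u\<in>A. K\<^sup>2)"
    unfolding sqnorm_def \<xi>_def by (rule sum.mono_neutral_cong_right) (auto simp: A_def)
  then have sq: "sqnorm \<xi> = real (card A) * K\<^sup>2" by simp
  have "A \<noteq> {}"
  proof
    assume "A = {}"
    then have "sqnorm g = 0" by (auto simp: sqnorm_def A_def)
    then show False using large by (simp add: g_def)
  qed
  then have "1 \<le> card A" by (simp add: A_def Suc_le_eq card_gt_0_iff)
  then have "1 * K\<^sup>2 \<le> real (card A) * K\<^sup>2" by (intro mult_right_mono) auto
  moreover have "card A \<le> n"
    using card_mono[of "{..<n}" A] by (auto simp: A_def)
  then have "real (card A) * K\<^sup>2 \<le> n * K\<^sup>2" by (intro mult_right_mono) auto
  ultimately show ?thesis using 1 sq by (intro exI[of _ \<xi>] conjI) simp_all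
qed

text \<open>
  Up to time \<open>t\<close> the mean decays by a factor \<open>\<rho>\<close> with \<open>\<rho>\<^sup>2 \<ge> 1/y\<close>, and the entries of the test vector are of
  size \<open>2/y\<close>. The failure probability in \<open>spread_start_stays_apart\<close> is then of order \<open>y / (\<alpha> y\<^sup>2)\<close>, which is
  at most \<open>1/2\<close> for \<open>y \<ge> 128/\<alpha>\<close>.
\<close>

lemma spread_eigenvector_start:
  fixes K :: real
  assumes y: "128 / \<alpha> \<le> y" "y ^ 4 = real n"
    and small: "sqnorm (excess (1 / y) gap_vector) < 1 / 16"
      "sqnorm (excess (1 / y) (\<lambda>v. - gap_vector v)) < 1 / 16"
    and t: "real t \<le> \<alpha> ^ 3 / 416 * ln n * m / lambda2 G" and K: "0 < K"
  shows "\<exists>\<xi>. K\<^sup>2 \<le> sqnorm \<xi> \<and> sqnorm \<xi> \<le> n * K\<^sup>2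
    \<and> 1 / 2 \<le> expect t (indicator (apart (K / (8 * (real n)\<^sup>2)))) \<xi>"
proof -
  define \<rho> where "\<rho> = (1 - \<beta> * lambda2 G / (2 * m)) ^ t"
  define r where "r = \<beta> * lambda2 G / (2 * m)"
  have "128 / 1 \<le> 128 / \<alpha>" using \<alpha>_pos \<alpha>_less_1 by (intro divide_left_mono) auto
  then have y128: "128 \<le> y" using y by simp
  then have y0: "0 < y" by simp
  have y_le_n: "y \<le> real n"
    unfolding y(2)[symmetric] using power_increasing[of 1 4 y] y128 by simp
  then have n4: "4 \<le> real n" using y128 by simp
  have "\<beta> * lambda2 G \<le> 1 * lambda2 G" using \<alpha>_pos lambda2_pos by (intro mult_right_mono) auto
  moreover have "4 * lambda2 G \<le> n * lambda2 G" using n4 lambda2_pos by (intro mult_right_mono) auto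
  ultimately have "\<beta> * lambda2 G \<le> m" using lambda2_le by simp
  then have r: "0 \<le> r" "r \<le> 1 / 2"
    using \<beta>_pos lambda2_pos m_pos by (simp_all add: r_def pos_divide_le_eq)
  have exp_r: "exp (- (2 * r)) \<le> 1 - r"
  proof -
    have "r * (1 / (1 - r)) \<le> r * 2" using r by (intro mult_left_mono) (simp_all add: pos_divide_le_eq)
    moreover have "1 - 1 / (1 - r) = - (r * (1 / (1 - r)))" using r by (simp add: field_simps)
    ultimately have "- (2 * r) \<le> ln (1 - r)"
      using ln_ge_one_minus_inverse[of "1 - r"] r by simp
    then have "exp (- (2 * r)) \<le> exp (ln (1 - r))" by simp
    then show ?thesis using r by simp
  qed
  have \<rho>1: "\<rho> \<le> 1" unfolding \<rho>_def r_def[symmetric] using r by (intro power_le_one) auto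
  have \<rho>0: "0 < \<rho>" unfolding \<rho>_def r_def[symmetric] using r by (intro zero_less_power) auto
  have \<rho>2: "1 / y \<le> \<rho>\<^sup>2"
  proof -
    have "\<alpha> ^ 3 \<le> 1" using \<alpha>_pos \<alpha>_less_1 by (simp add: power_le_one)
    have ln0: "0 \<le> ln (real n)" using n4 by simp
    have "4 * (r * real t) \<le> 4 * (r * (\<alpha> ^ 3 / 416 * ln n * m / lambda2 G))"
      using t r by (intro mult_left_mono) auto
    also have "\<dots> = \<beta> * \<alpha> ^ 3 / 208 * ln n"
      using lambda2_pos m_pos by (simp add: r_def)
    also have "\<dots> \<le> 1 / 4 * ln n"
    proof -
      have "\<beta> * \<alpha> ^ 3 \<le> 1 * 1" using \<alpha>_pos \<alpha>_less_1 \<open>\<alpha> ^ 3 \<le> 1\<close> by (intro mult_mono) auto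
      then have "\<beta> * \<alpha> ^ 3 / 208 \<le> 1 / 4" by simp
      then show ?thesis using ln0 by (rule mult_right_mono)
    qed
    also have "1 / 4 * ln (real n) = ln y"
      using y0 unfolding y(2)[symmetric] by (simp add: ln_realpow)
    finally have "exp (- ln y) \<le> exp (- (4 * (r * real t)))" by simp
    also have "\<dots> = (exp (- (2 * r)) ^ t)\<^sup>2"
      by (simp add: exp_of_nat_mult[symmetric] exp_double[symmetric] power2_eq_square exp_add[symmetric] algebra_simps)
    also have "\<dots> \<le> ((1 - r) ^ t)\<^sup>2" using exp_r by (intro power_mono) auto
    also have "\<dots> = \<rho>\<^sup>2" by (simp only: \<rho>_def r_def)
    finally show ?thesis using y0 by (simp add: exp_minus inverse_eq_divide)
  qed
  obtain g where g: "(\<Sum>u<n. g u) = 0" "\<And>u. u < n \<Longrightarrow> \<bar>g u\<bar> \<le> 2 * (1 / y)" "1 / 2 \<le> lin g gap_vector"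
    using spread_test_vector[OF _ small] y0 by auto
  define \<mu> where "\<mu> = K * \<rho> * lin g gap_vector"
  have \<mu>_ge: "K * \<rho> * (1 / 2) \<le> \<mu>"
    unfolding \<mu>_def using g(3) K \<rho>0 by (intro mult_left_mono) auto
  have \<mu>0: "0 < \<mu>" using \<mu>_ge K \<rho>0 less_le_trans[of 0 "K * \<rho> * (1 / 2)" \<mu>] by simp
  have "1 - 4 * (\<beta> * (2 * (1 / y))\<^sup>2 / \<alpha> * K\<^sup>2) / \<mu>\<^sup>2
      \<le> expect t (indicator (apart (\<mu> / (4 * n)))) (\<lambda>u. K * gap_vector u)"
    by (rule spread_start_stays_apart[OF g(1,2)])
       (use y128 \<mu>0 in \<open>auto simp: \<mu>_def \<rho>_def\<close>)
  moreover have "1 / 2 \<le> 1 - 4 * (\<beta> * (2 * (1 / y))\<^sup>2 / \<alpha> * K\<^sup>2) / \<mu>\<^sup>2"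
  proof -
    have "K\<^sup>2 * (1 / y) * (1 / 4) \<le> K\<^sup>2 * \<rho>\<^sup>2 * (1 / 4)"
      using \<rho>2 by (intro mult_right_mono mult_left_mono) auto
    also have "\<dots> = (K * \<rho> * (1 / 2))\<^sup>2" by (simp add: power_mult_distrib power_divide)
    also have "\<dots> \<le> \<mu>\<^sup>2" using \<mu>_ge K \<rho>0 by (intro power_mono) auto
    finally have \<mu>2: "K\<^sup>2 * (1 / y) * (1 / 4) \<le> \<mu>\<^sup>2" .
    have "4 * (\<beta> * (2 * (1 / y))\<^sup>2 / \<alpha> * K\<^sup>2) / \<mu>\<^sup>2
        \<le> 4 * (\<beta> * (2 * (1 / y))\<^sup>2 / \<alpha> * K\<^sup>2) / (K\<^sup>2 * (1 / y) * (1 / 4))"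
      using \<mu>2 \<mu>0 K y0 \<alpha>_pos \<beta>_pos by (intro divide_left_mono) auto
    also have "\<dots> = \<beta> * (64 / (\<alpha> * y))"
      using K y0 \<alpha>_pos by (simp add: power2_eq_square field_simps)
    also have "\<dots> \<le> 1 * (64 / (\<alpha> * y))"
      using y0 \<alpha>_pos by (intro mult_right_mono) auto
    also have "\<dots> \<le> 1 / 2"
    proof -
      have "128 \<le> \<alpha> * y" using y(1) \<alpha>_pos by (simp add: pos_divide_le_eq mult.commute)
      then show ?thesis using y0 \<alpha>_pos by (simp add: pos_divide_le_eq)
    qed
    finally show ?thesis by simp
  qed
  ultimately have half: "1 / 2 \<le> expect t (indicator (apart (\<mu> / (4 * n)))) (\<lambda>u. K * gap_vector u)"
    by linarith
  have "1 / real n \<le> 1 / y" using y_le_n y0 by (intro divide_left_mono) auto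
  also have "\<dots> \<le> \<rho> * \<rho>" using \<rho>2 by (simp add: power2_eq_square)
  also have "\<dots> \<le> \<rho>" using \<rho>0 \<rho>1 by simp
  finally have "K * (1 / real n) * (1 / 2) \<le> K * \<rho> * (1 / 2)"
    using K by (intro mult_right_mono mult_left_mono) auto
  then have "K * (1 / real n) * (1 / 2) \<le> \<mu>" using \<mu>_ge by (rule order_trans)
  then have "K * (1 / real n) * (1 / 2) / (4 * n) \<le> \<mu> / (4 * n)" by (rule divide_right_mono) simp
  then have "K / (8 * (real n)\<^sup>2) \<le> \<mu> / (4 * n)" by (simp add: power2_eq_square)
  from order_trans[OF half expect_apart_mono[OF this]]
  have "1 / 2 \<le> expect t (indicator (apart (K / (8 * (real n)\<^sup>2)))) (\<lambda>u. K * gap_vector u)" .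
  moreover have "sqnorm (\<lambda>u. K * gap_vector u) = K\<^sup>2"
    unfolding sqnorm_def power_mult_distrib sum_distrib_left[symmetric] norm_gap_vector by simp
  moreover have "1 * K\<^sup>2 \<le> n * K\<^sup>2" using n4 by (intro mult_right_mono) auto
  ultimately show ?thesis by (intro exI[of _ "\<lambda>u. K * gap_vector u"]) simp
qed

text \<open>
  With \<open>y = n powr (1/4)\<close>, the three cases ask whether the eigenvector has a large part above \<open>1/y\<close>, a large
  part below \<open>-1/y\<close>, or neither. The constant 7488 is \<open>416 * 2 * 9\<close>, where 2 comes from the probability \<open>1/2\<close>
  and 9 from \<open>ln (289 n\<^sup>8) \<le> 9 ln n\<close>.
\<close>

theorem slow_start_large_graph:
  assumes large: "(128 / \<alpha>) ^ 4 \<le> real n" and \<epsilon>: "0 < \<epsilon>"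
  shows "\<exists>\<xi>. 0 < time_bound G \<xi> \<epsilon> \<and> ennreal (\<alpha> ^ 3 / 7488 * time_bound G \<xi> \<epsilon>)
    \<le> (\<integral>\<^sup>+ \<omega>. ennreal_of_enat (hitting_time G \<alpha> \<xi> \<epsilon> \<omega>) \<partial>\<Omega>)"
proof -
  define y where "y = root 4 (real n)"
  have y4: "y ^ 4 = real n" by (simp add: y_def)
  have y: "128 / \<alpha> \<le> y"
  proof -
    have "root 4 ((128 / \<alpha>) ^ 4) \<le> y" unfolding y_def using large by simp
    then show ?thesis using \<alpha>_pos by (simp add: real_root_power_cancel)
  qed
  have "128 / 1 \<le> 128 / \<alpha>" using \<alpha>_pos \<alpha>_less_1 by (intro divide_left_mono) auto
  then have y128: "128 \<le> y" using y by simp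
  define x where "x = \<alpha> ^ 3 / 416 * ln n * m / lambda2 G"
  define t where "t = nat \<lfloor>x\<rfloor>"
  define K where "K = 17 * real n ^ 3 * sqrt \<epsilon>"
  have n1: "1 \<le> real n" using two_le_n by simp
  have K: "0 < K" using \<epsilon> n1 by (simp add: K_def)
  have x0: "0 \<le> x"
    unfolding x_def using \<alpha>_pos n1 m_pos lambda2_pos
    by (intro divide_nonneg_pos mult_nonneg_nonneg) auto
  then have t: "real t \<le> \<alpha> ^ 3 / 416 * ln n * m / lambda2 G" unfolding t_def x_def by simp
  have "\<exists>\<xi>. K\<^sup>2 \<le> sqnorm \<xi> \<and> sqnorm \<xi> \<le> n * K\<^sup>2
    \<and> 1 / 2 \<le> expect t (indicator (apart (K / (8 * (real n)\<^sup>2)))) \<xi>"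
  proof (cases "1 / 16 \<le> sqnorm (excess (1 / y) gap_vector)")
    case True
    then show ?thesis
      by (intro localised_eigenvector_start[OF _ sqnorm_gap_vector y128 y4 _ t K] lambda2_gap_vector)
  next
    case plus: False
    show ?thesis
    proof (cases "1 / 16 \<le> sqnorm (excess (1 / y) (\<lambda>v. - gap_vector v))")
      case True
      have "lap (\<lambda>v. - gap_vector v) u = lambda2 G * - gap_vector u" if "u < n" for u
      proof -
        have "lap (\<lambda>v. - gap_vector v) u = - lap gap_vector u"
          unfolding lap_def sum_negf[symmetric] by (rule sum.cong) simp_all
        then show ?thesis using lambda2_gap_vector[OF that] by simp
      qed
      moreover have "sqnorm (\<lambda>v. - gap_vector v) = 1"
        using sqnorm_gap_vector by (simp add: sqnorm_def)
      ultimately show ?thesis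
        using localised_eigenvector_start[OF _ _ y128 y4 True t K] by blast
    next
      case False
      then show ?thesis using plus by (intro spread_eigenvector_start[OF y y4 _ _ t K]) auto
    qed
  qed
  then obtain \<xi> where \<xi>: "K\<^sup>2 \<le> sqnorm \<xi>" "sqnorm \<xi> \<le> n * K\<^sup>2"
    and half: "1 / 2 \<le> expect t (indicator (apart (K / (8 * (real n)\<^sup>2)))) \<xi>" by blast
  \<comment> \<open>Here \<open>17/8 > 2\<close> is what the factor 17 in \<open>K\<close> is for.\<close>
  have "2 * n * sqrt \<epsilon> < 17 / 8 * n * sqrt \<epsilon>" using \<epsilon> n1 by simp
  also have "\<dots> = K / (8 * (real n)\<^sup>2)" using n1 by (simp add: K_def power2_eq_square power3_eq_cube)
  finally have "2 * n * sqrt \<epsilon> < K / (8 * (real n)\<^sup>2)" .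
  from expected_hitting_time_ge[OF half this] \<epsilon>
  have hit: "ennreal (real (Suc t) * (1 / 2))
      \<le> (\<integral>\<^sup>+ \<omega>. ennreal_of_enat (hitting_time G \<alpha> \<xi> \<epsilon> \<omega>) \<partial>\<Omega>)" by simp
  have "(128::real) ^ 4 \<le> y ^ 4" using y128 by (intro power_mono) auto
  then have "289 \<le> real n" unfolding y4 by simp
  then have "289 * real n ^ 8 \<le> real n * real n ^ 8" by (intro mult_right_mono) auto
  also have "\<dots> = real n ^ 9" by (simp add: power_numeral_reduce)
  finally have "ln (289 * real n ^ 8) \<le> ln (real n ^ 9)" using n1 by (intro ln_mono) auto
  then have "ln (289 * real n ^ 8) \<le> 9 * ln n" using n1 by (simp add: ln_realpow)
  then have "m / lambda2 G * ln (289 * real n ^ 8) \<le> m / lambda2 G * (9 * ln n)"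
    using m_pos lambda2_pos by (intro mult_left_mono) auto
  with time_bound_range(2)[OF \<epsilon> K_def \<xi>]
  have "time_bound G \<xi> \<epsilon> \<le> m / lambda2 G * (9 * ln n)" by (rule order_trans)
  then have "\<alpha> ^ 3 / 7488 * time_bound G \<xi> \<epsilon> \<le> \<alpha> ^ 3 / 7488 * (m / lambda2 G * (9 * ln n))"
    using \<alpha>_pos by (intro mult_left_mono) auto
  also have "\<dots> = x * (1 / 2)" by (simp add: x_def)
  also have "\<dots> \<le> real (Suc t) * (1 / 2)"
    unfolding t_def by (intro mult_right_mono) linarith+
  finally have "ennreal (\<alpha> ^ 3 / 7488 * time_bound G \<xi> \<epsilon>) \<le> ennreal (real (Suc t) * (1 / 2))"
    by (rule ennreal_leI)
  with hit have "ennreal (\<alpha> ^ 3 / 7488 * time_bound G \<xi> \<epsilon>)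
      \<le> (\<integral>\<^sup>+ \<omega>. ennreal_of_enat (hitting_time G \<alpha> \<xi> \<epsilon> \<omega>) \<partial>\<Omega>)" by (rule order_trans[rotated])
  then show ?thesis using time_bound_range(1)[OF \<epsilon> K_def \<xi>] by blast
qed

text \<open>
  A single node of height \<open>K\<close> keeps the potential above \<open>\<epsilon>\<close> at time 0.
\<close>

lemma slow_start_any_graph:
  assumes \<epsilon>: "0 < \<epsilon>"
  shows "\<exists>\<xi>. 0 < time_bound G \<xi> \<epsilon> \<and> time_bound G \<xi> \<epsilon> \<le> m / lambda2 G * ln (289 * real n ^ 8)
    \<and> 1 \<le> (\<integral>\<^sup>+ \<omega>. ennreal_of_enat (hitting_time G \<alpha> \<xi> \<epsilon> \<omega>) \<partial>\<Omega>)"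
proof -
  define K where "K = 17 * real n ^ 3 * sqrt \<epsilon>"
  define \<xi> :: "nat \<Rightarrow> real" where "\<xi> = (\<lambda>u. if u = 0 then K else 0)"
  have n1: "1 \<le> real n" using two_le_n by simp
  have "sqnorm \<xi> = K\<^sup>2"
    using two_le_n by (simp add: sqnorm_def \<xi>_def if_distrib[of "\<lambda>x. x\<^sup>2"] cong: if_cong)
  moreover have "1 * K\<^sup>2 \<le> n * K\<^sup>2" using n1 by (intro mult_right_mono) auto
  ultimately have \<xi>: "K\<^sup>2 \<le> sqnorm \<xi>" "sqnorm \<xi> \<le> n * K\<^sup>2" by simp_all
  have "K \<le> \<xi> 0 - \<xi> 1" by (simp add: \<xi>_def)
  then have "\<xi> \<in> apart K"
    unfolding apart_def using two_le_n by (intro CollectI exI[of _ 0] conjI exI[of _ 1]) auto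
  then have "1 \<le> expect 0 (indicator (apart K)) \<xi>" by simp
  moreover have "2 * n * sqrt \<epsilon> < K"
  proof -
    have "real n * 1 \<le> real n * real n ^ 2" using n1 by (intro mult_left_mono one_le_power) auto
    then have "2 * n < 17 * real n ^ 3" using n1 by (simp add: power3_eq_cube power2_eq_square)
    then show ?thesis unfolding K_def using \<epsilon> by (intro mult_strict_right_mono) auto
  qed
  ultimately have "1 \<le> (\<integral>\<^sup>+ \<omega>. ennreal_of_enat (hitting_time G \<alpha> \<xi> \<epsilon> \<omega>) \<partial>\<Omega>)"
    using expected_hitting_time_ge[of 1 0 K \<xi> \<epsilon>] \<epsilon> by simp
  then show ?thesis using time_bound_range[OF \<epsilon> K_def \<xi>] by blast
qed

end

lemma finite_connected_graphs: "finite {G. \<exists>n<N. connected_graph n G}"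
proof -
  let ?P = "{..<N} \<times> Pow ({..<N} \<times> {..<N})" and ?f = "\<lambda>(n, A). \<lparr>pverts = {0..<n}, parcs = A\<rparr>"
  have "G \<in> ?f ` ?P"
    if G: "connected_graph n G" "n < N" for n G
  proof -
    interpret connected_ugraph n G by unfold_locales (rule G)
    have "E \<subseteq> {..<N} \<times> {..<N}" using E_lt G(2) by fastforce
    moreover have "G = \<lparr>pverts = {0..<n}, parcs = E\<rparr>"
      using pverts_eq by (simp add: atLeast0LessThan)
    ultimately show ?thesis using G(2) by (intro image_eqI[of _ _ "(n, E)"]) auto
  qed
  then have "{G. \<exists>n<N. connected_graph n G} \<subseteq> ?f ` ?P" by blast
  then show ?thesis by (rule finite_subset) simp
qed

lemma small_graphs_bounded:
  "\<exists>B\<ge>0. \<forall>n G. n < N \<longrightarrow> connected_graph n G \<longrightarrow>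
    real (num_edges G) / lambda2 G * ln (289 * real n ^ 8) \<le> B"
proof -
  define F where "F = (\<lambda>G. real (num_edges G) / lambda2 G * ln (289 * real (card (pverts G)) ^ 8))"
  let ?S = "{G. \<exists>n<N. connected_graph n G}"
  have F: "F G = real (num_edges G) / lambda2 G * ln (289 * real n ^ 8)" "0 \<le> F G"
    if "connected_graph n G" for n G
  proof -
    interpret connected_ugraph n G by unfold_locales (rule that)
    show *: "F G = real (num_edges G) / lambda2 G * ln (289 * real n ^ 8)"
      by (simp add: F_def pverts_eq)
    have "1 * 1 \<le> 289 * real n ^ 8" using two_le_n by (intro mult_mono one_le_power) auto
    then show "0 \<le> F G" unfolding * using m_pos lambda2_pos
      by (intro mult_nonneg_nonneg divide_nonneg_pos ln_ge_zero) auto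
  qed
  show ?thesis
  proof (intro exI[of _ "\<Sum>G\<in>?S. F G"] conjI allI impI)
    show "0 \<le> (\<Sum>G\<in>?S. F G)" by (rule sum_nonneg) (use F(2) in blast)
    fix n G assume G: "n < N" "connected_graph n G"
    have "F G \<le> (\<Sum>G\<in>?S. F G)"
      by (rule member_le_sum) (use F(2) G finite_connected_graphs in blast)+
    then show "real (num_edges G) / lambda2 G * ln (289 * real n ^ 8) \<le> (\<Sum>G\<in>?S. F G)"
      using F(1)[OF G(2)] by simp
  qed
qed

theorem theorem2p4:
  fixes \<alpha> :: real
  assumes "0 < \<alpha>" and "\<alpha> < 1"
  shows
    "(\<forall>c\<ge>1. \<exists>C>0. \<forall>n G \<xi>0 \<epsilon>.
        connected_graph n G \<longrightarrow> 0 < \<epsilon> \<longrightarrow> \<epsilon> < 1 \<longrightarrow>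
        measure (edge_space G)
          {\<omega> \<in> space (edge_space G).
             ennreal_of_enat (hitting_time G \<alpha> \<xi>0 \<epsilon> \<omega>) \<le> ennreal (C * time_bound G \<xi>0 \<epsilon>)}
        \<ge> 1 - real n powr (- c))
   \<and> (\<exists>C>0. \<forall>n G \<epsilon>.
        connected_graph n G \<longrightarrow> 0 < \<epsilon> \<longrightarrow> \<epsilon> < 1 \<longrightarrow>
        (\<exists>\<xi>0. 0 < time_bound G \<xi>0 \<epsilon> \<and>
          ennreal (C * time_bound G \<xi>0 \<epsilon>)
          \<le> (\<integral>\<^sup>+ \<omega>. ennreal_of_enat (hitting_time G \<alpha> \<xi>0 \<epsilon> \<omega>) \<partial>edge_space G)))
   \<and> (\<exists>C1>0. \<exists>C2>0. \<forall>n G \<xi>0.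
        connected_graph n G \<longrightarrow> regular_graph G \<longrightarrow> (\<Sum>i<n. \<xi>0 i) = 0 \<longrightarrow>
        (AE \<omega> in edge_space G. \<forall>u<n.
           (\<lambda>t. edge_model \<alpha> \<xi>0 t \<omega> u) \<longlonglongrightarrow> limit_value \<alpha> \<xi>0 \<omega>)
        \<and> C1 * ((L2_set \<xi>0 {..<n})\<^sup>2 / (real n)\<^sup>2)
            \<le> prob_space.variance (edge_space G) (limit_value \<alpha> \<xi>0)
        \<and> prob_space.variance (edge_space G) (limit_value \<alpha> \<xi>0)
            \<le> C2 * ((L2_set \<xi>0 {..<n})\<^sup>2 / (real n)\<^sup>2))"
proof (intro conjI)
  have process: "edge_process n G \<alpha>" if "connected_graph n G" for n G
    using that assms by unfold_locales
  show "\<forall>c\<ge>1. \<exists>C>0. \<forall>n G \<xi>0 \<epsilon>.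
        connected_graph n G \<longrightarrow> 0 < \<epsilon> \<longrightarrow> \<epsilon> < 1 \<longrightarrow>
        measure (edge_space G)
          {\<omega> \<in> space (edge_space G).
             ennreal_of_enat (hitting_time G \<alpha> \<xi>0 \<epsilon> \<omega>) \<le> ennreal (C * time_bound G \<xi>0 \<epsilon>)}
        \<ge> 1 - real n powr (- c)"
  proof (intro allI impI)
    fix c :: real assume c: "1 \<le> c"
    have "0 < 2 * (c + 1) / (\<alpha> * (1 - \<alpha>))" using assms c by simp
    moreover have "1 - real n powr (- c) \<le> measure (edge_space G)
          {\<omega> \<in> space (edge_space G). ennreal_of_enat (hitting_time G \<alpha> \<xi>0 \<epsilon> \<omega>)
            \<le> ennreal (2 * (c + 1) / (\<alpha> * (1 - \<alpha>)) * time_bound G \<xi>0 \<epsilon>)}"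
      if G: "connected_graph n G" and \<epsilon>: "0 < \<epsilon>" for n G \<xi>0 \<epsilon>
    proof -
      interpret edge_process n G \<alpha> by (rule process[OF G])
      show ?thesis by (rule convergence_time_whp[OF c \<epsilon>])
    qed
    ultimately show "\<exists>C>0. \<forall>n G \<xi>0 \<epsilon>.
        connected_graph n G \<longrightarrow> 0 < \<epsilon> \<longrightarrow> \<epsilon> < 1 \<longrightarrow>
        measure (edge_space G)
          {\<omega> \<in> space (edge_space G).
             ennreal_of_enat (hitting_time G \<alpha> \<xi>0 \<epsilon> \<omega>) \<le> ennreal (C * time_bound G \<xi>0 \<epsilon>)}
        \<ge> 1 - real n powr (- c)" by blast
  qed
  define N where "N = nat \<lceil>(128 / \<alpha>) ^ 4\<rceil>"
  obtain B where B: "0 \<le> B"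
    "\<And>n G. n < N \<Longrightarrow> connected_graph n G \<Longrightarrow>
      real (num_edges G) / lambda2 G * ln (289 * real n ^ 8) \<le> B"
    using small_graphs_bounded by blast
  define C where "C = min (\<alpha> ^ 3 / 7488) (1 / (B + 1))"
  have C: "0 < C" using assms B(1) by (simp add: C_def)
  have "\<exists>\<xi>0. 0 < time_bound G \<xi>0 \<epsilon> \<and> ennreal (C * time_bound G \<xi>0 \<epsilon>)
      \<le> (\<integral>\<^sup>+ \<omega>. ennreal_of_enat (hitting_time G \<alpha> \<xi>0 \<epsilon> \<omega>) \<partial>edge_space G)"
    if G: "connected_graph n G" and \<epsilon>: "0 < \<epsilon>" for n G \<epsilon>
  proof -
    interpret edge_process n G \<alpha> by (rule process[OF G])
    show ?thesis
    proof (cases "n < N")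
      case True
      obtain \<xi> where \<xi>: "0 < time_bound G \<xi> \<epsilon>"
        "time_bound G \<xi> \<epsilon> \<le> m / lambda2 G * ln (289 * real n ^ 8)"
        "1 \<le> (\<integral>\<^sup>+ \<omega>. ennreal_of_enat (hitting_time G \<alpha> \<xi> \<epsilon> \<omega>) \<partial>\<Omega>)"
        using slow_start_any_graph[OF \<epsilon>] by blast
      have "C * time_bound G \<xi> \<epsilon> \<le> 1 / (B + 1) * B"
        using \<xi>(1,2) B(1) B(2)[OF True G] by (intro mult_mono) (auto simp: C_def)
      also have "\<dots> \<le> 1" using B(1) by simp
      finally have "ennreal (C * time_bound G \<xi> \<epsilon>) \<le> ennreal 1" by (rule ennreal_leI)
      then have "ennreal (C * time_bound G \<xi> \<epsilon>) \<le> 1" by simp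
      from order_trans[OF this \<xi>(3)] \<xi>(1) show ?thesis by blast
    next
      case False
      then have "(128 / \<alpha>) ^ 4 \<le> real n" unfolding N_def by linarith
      then obtain \<xi> where \<xi>: "0 < time_bound G \<xi> \<epsilon>"
        "ennreal (\<alpha> ^ 3 / 7488 * time_bound G \<xi> \<epsilon>)
          \<le> (\<integral>\<^sup>+ \<omega>. ennreal_of_enat (hitting_time G \<alpha> \<xi> \<epsilon> \<omega>) \<partial>\<Omega>)"
        using slow_start_large_graph[OF _ \<epsilon>] by blast
      have "C * time_bound G \<xi> \<epsilon> \<le> \<alpha> ^ 3 / 7488 * time_bound G \<xi> \<epsilon>"
        using \<xi>(1) by (intro mult_right_mono) (auto simp: C_def)
      then have "ennreal (C * time_bound G \<xi> \<epsilon>) \<le> ennreal (\<alpha> ^ 3 / 7488 * time_bound G \<xi> \<epsilon>)"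
        by (rule ennreal_leI)
      from order_trans[OF this \<xi>(2)] \<xi>(1) show ?thesis by blast
    qed
  qed
  with C show "\<exists>C>0. \<forall>n G \<epsilon>.
        connected_graph n G \<longrightarrow> 0 < \<epsilon> \<longrightarrow> \<epsilon> < 1 \<longrightarrow>
        (\<exists>\<xi>0. 0 < time_bound G \<xi>0 \<epsilon> \<and>
          ennreal (C * time_bound G \<xi>0 \<epsilon>)
          \<le> (\<integral>\<^sup>+ \<omega>. ennreal_of_enat (hitting_time G \<alpha> \<xi>0 \<epsilon> \<omega>) \<partial>edge_space G))" by blast
  have limit: "(AE \<omega> in edge_space G. \<forall>u<n.
           (\<lambda>t. edge_model \<alpha> \<xi>0 t \<omega> u) \<longlonglongrightarrow> limit_value \<alpha> \<xi>0 \<omega>)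
        \<and> (1 - \<alpha>) * ((L2_set \<xi>0 {..<n})\<^sup>2 / (real n)\<^sup>2)
            \<le> prob_space.variance (edge_space G) (limit_value \<alpha> \<xi>0)
        \<and> prob_space.variance (edge_space G) (limit_value \<alpha> \<xi>0)
            \<le> (1 - \<alpha>) / \<alpha> * ((L2_set \<xi>0 {..<n})\<^sup>2 / (real n)\<^sup>2)"
    if G: "connected_graph n G" and zero: "(\<Sum>i<n. \<xi>0 i) = 0" for n G \<xi>0
  proof -
    interpret edge_process n G \<alpha> by (rule process[OF G])
    show ?thesis
      unfolding sqnorm_eq_L2 using AE_convergence variance_bounds[OF zero] by blast
  qed
  show "\<exists>C1>0. \<exists>C2>0. \<forall>n G \<xi>0.
        connected_graph n G \<longrightarrow> regular_graph G \<longrightarrow> (\<Sum>i<n. \<xi>0 i) = 0 \<longrightarrow>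
        (AE \<omega> in edge_space G. \<forall>u<n.
           (\<lambda>t. edge_model \<alpha> \<xi>0 t \<omega> u) \<longlonglongrightarrow> limit_value \<alpha> \<xi>0 \<omega>)
        \<and> C1 * ((L2_set \<xi>0 {..<n})\<^sup>2 / (real n)\<^sup>2)
            \<le> prob_space.variance (edge_space G) (limit_value \<alpha> \<xi>0)
        \<and> prob_space.variance (edge_space G) (limit_value \<alpha> \<xi>0)
            \<le> C2 * ((L2_set \<xi>0 {..<n})\<^sup>2 / (real n)\<^sup>2)"
    by (rule exI[of _ "1 - \<alpha>"], rule conjI, simp add: assms,
        rule exI[of _ "(1 - \<alpha>) / \<alpha>"], rule conjI, simp add: assms,
        intro allI impI, rule limit)
qed

end
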